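(* Let $\mathcal{Z}$ be a cubical zonotopal tiling of a zonotope $Z$ with associated vector configuration $V_{\mathcal{Z}}$. Then, for any choices of zones made during the splitting algorithm, the polynomial $T^{\ast}(\mathcal{Z};x,y)$ equals the Tutte polynomial $T(V^{\ast}_{\mathcal{Z}};x,y)$ of the matroid $V^{\ast}_{\mathcal{Z}}$.
   Context: A zonotope generated by $v_1,\dots,v_d\in\mathbb{R}^n$ is $Z=\{\sum a_iv_i: 0\le a_i\le 1\}$. A parallelotope is a zonotope generated by a basis of the (linear span of the) ambient space. A cubical zonotopal tiling $\mathcal{Z}$ of $Z$ is a polyhedral complex of finitely many zonotopes with union $Z$ whose maximal cells (tiles) are parallelotopes. Edges of $\mathcal{Z}$ are grouped into equivalence classes generated by the relation of being opposite edges of a 2-dimensional face; each class has a representative vector $w_j$, a positive multiple of some generator $v_i$, and the representatives of classes parallel to $v_i$ sum to $v_i$. The list $V_{\mathcal{Z}}=(w_j)$ is the associated vector configuration. The zone $B_w$ is the set of tiles containing an edge of the class of $w$. Shrinking: $Z-B_w$ is obtained by deleting the zone $B_w$ and gluing its two sides together; its tiles are the tiles of $\mathcal{Z}$ not in $B_w$, and its vector configuration is $V_{\mathcal{Z}}\setminus\{w\}$. Projection: with $P_w$ the quotient map by $\mathbb{R}w$, $Z|B_w=P_w(B_w)$ with tiles $P_w(Z_i)$ for tiles $Z_i$ of $B_w$, and vector configuration the image of $V_{\mathcal{Z}}\setminus\{w\}$ with resulting zero vectors discarded. Splitting algorithm: $T^*(\bullet)=1$ for a point. Otherwise choose a zone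 $B_w$; if $Z-B_w$ and $Z|B_w$ are the same tiled zonotope, $T^*(\mathcal{Z})=y\,T^*(\mathcal{Z}-B_w)$; otherwise $T^*(\mathcal{Z})=x^{\gamma}T^*(\mathcal{Z}|B_w)+T^*(\mathcal{Z}-B_w)$, where $\gamma$ is the number of vectors of $V_{\mathcal{Z}}\setminus\{w\}$ parallel to $w$ (the zero vectors produced by the projection), and the recursion is applied to each resulting tiled zonotope. $V^*_{\mathcal{Z}}$ is the matroid on the list $V_{\mathcal{Z}}$ whose bases are the complements of the sublists forming a linear basis of $\mathrm{span}(V_{\mathcal{Z}})$ (the dual of the linear matroid of $V_{\mathcal{Z}}$). For a matroid on $E$ with rank function $r$, $T(M;x,y)=\sum_{A\subseteq E}(x-1)^{r(E)-r(A)}(y-1)^{|A|-r(A)}$. *)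

theory Defs
  imports "HOL-Analysis.Analysis" "HOL-Computational_Algebra.Polynomial"
begin

section \<open>Zonotopes and cubical zonotopal tilings\<close>

definition zonotope :: "'a::real_vector list \<Rightarrow> 'a set" where
  "zonotope vs =
     {(\<Sum>i<length vs. a i *\<^sub>R vs ! i) | a. \<forall>i<length vs. 0 \<le> a i \<and> a i \<le> (1::real)}"

text \<open>A tiled zonotope is represented by the set of \<^emph>\<open>all\<close> its nonempty cells.\<close>

definition polyhedral_complex :: "'a::euclidean_space set set \<Rightarrow> bool" where
  "polyhedral_complex C \<longleftrightarrow>
     finite C \<and>
     (\<forall>F\<in>C. polytope F \<and> F \<noteq> {}) \<and>
     (\<forall>F\<in>C. \<forall>G. G face_of F \<and> G \<noteq> {} \<longrightarrow> G \<in> C) \<and>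
     (\<forall>F\<in>C. \<forall>G\<in>C. (F \<inter> G) face_of F \<and> (F \<inter> G) face_of G)"

definition tiles :: "'a set set \<Rightarrow> 'a set set" where
  "tiles C = {T \<in> C. \<forall>F\<in>C. T \<subseteq> F \<longrightarrow> F = T}"

definition parallelotope_in :: "'a::real_vector set \<Rightarrow> 'a set \<Rightarrow> bool" where
  "parallelotope_in U T \<longleftrightarrow>
     (\<exists>a bs. distinct bs \<and> independent (set bs) \<and> span (set bs) = U \<and>
             T = (+) a ` zonotope bs)"

definition cubical_zonotopal_tiling :: "'a::euclidean_space list \<Rightarrow> 'a set set \<Rightarrow> bool" where
  "cubical_zonotopal_tiling vs C \<longleftrightarrow>
     polyhedral_complex C \<and>
     (\<forall>F\<in>C. \<exists>a us. F = (+) a ` zonotope us) \<and>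
     \<Union>C = zonotope vs \<and>
     (\<forall>T\<in>tiles C. parallelotope_in (span (set vs)) T)"

section \<open>Edge classes, vector configuration, zones\<close>

definition edges :: "'a::euclidean_space set set \<Rightarrow> 'a set set" where
  "edges C = {e \<in> C. aff_dim e = 1}"

text \<open>The two-dimensional cells are parallelograms, in which two edges are opposite iff
  they are disjoint. The relation is symmetric, so its reflexive transitive closure is the
  equivalence relation it generates.\<close>

definition opposite_edges :: "'a::euclidean_space set set \<Rightarrow> ('a set \<times> 'a set) set" where
  "opposite_edges C =
     {(e, f). \<exists>Q\<in>C. aff_dim Q = 2 \<and> e edge_of Q \<and> f edge_of Q \<and> e \<inter> f = {}}"

definition edge_classes :: "'a::euclidean_space set set \<Rightarrow> 'a set set set" where
  "edge_classes C = edges C // (opposite_edges C)\<^sup>*"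

text \<open>The vector of a class of edges, which is determined up to sign.\<close>

definition edge_vector :: "'a::euclidean_space set set \<Rightarrow> 'a \<Rightarrow> bool" where
  "edge_vector c w \<longleftrightarrow> (\<exists>e\<in>c. \<exists>a. e = closed_segment a (a + w))"

text \<open>The configuration is a family of vectors indexed by the edge classes, so that equal
  vectors belonging to different classes are kept apart. The sign is fixed by the generators.\<close>

definition vector_configuration ::
    "'a::euclidean_space list \<Rightarrow> 'a set set \<Rightarrow> ('a set set \<Rightarrow> 'a) \<Rightarrow> bool" where
  "vector_configuration vs C V \<longleftrightarrow>
     (\<forall>c\<in>edge_classes C. edge_vector c (V c) \<and> (\<exists>v\<in>set vs. \<exists>t>0. V c = t *\<^sub>R v))"

definition zone :: "'a::euclidean_space set set \<Rightarrow> 'a set set \<Rightarrow> 'a set set" where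
  "zone C c = {T \<in> tiles C. \<exists>e\<in>c. e \<subseteq> T}"

section \<open>Shrinking and projecting a zone\<close>

text \<open>The closed part of space beyond the zone in direction \<open>w\<close>. A line parallel to \<open>w\<close>
  that meets the zone does so in a translate of the segment from \<open>0\<close> to \<open>w\<close>, so the points of
  the line lying on or past the exit point are those of the form \<open>z + t w\<close> with
  \<open>z\<close> in the zone and \<open>t \<ge> 1\<close>.\<close>

definition beyond_zone :: "'a::euclidean_space set set \<Rightarrow> 'a set set \<Rightarrow> 'a \<Rightarrow> 'a set" where
  "beyond_zone C c w = {z + t *\<^sub>R w | z t. z \<in> \<Union>(zone C c) \<and> 1 \<le> t}"

text \<open>Deleting the zone removes exactly the cells having an edge in the class \<open>c\<close>; gluing moves
  the cells beyond the zone by \<open>- w\<close>, which identifies the two sides of the zone. Working with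
  all cells also covers the case in which every tile lies in the zone: what remains then is the
  common copy of its two sides.\<close>

definition shrink ::
    "'a::euclidean_space set set \<Rightarrow> 'a set set \<Rightarrow> 'a \<Rightarrow> 'a set set" where
  "shrink C c w =
     (\<lambda>F. if F \<subseteq> beyond_zone C c w then (+) (- w) ` F else F) `
       {F \<in> C. \<not> (\<exists>e\<in>c. e \<subseteq> F)}"

text \<open>The quotient by the line spanned by \<open>w\<close> is modelled by the orthogonal complement of \<open>w\<close>.\<close>

definition quotient_map :: "'a::euclidean_space \<Rightarrow> 'a \<Rightarrow> 'a" where
  "quotient_map w x = x - ((x \<bullet> w) / (w \<bullet> w)) *\<^sub>R w"

definition project ::
    "'a::euclidean_space set set \<Rightarrow> 'a set set \<Rightarrow> 'a \<Rightarrow> 'a set set" where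
  "project C c w = {G. G \<noteq> {} \<and> (\<exists>T\<in>zone C c. G face_of (quotient_map w ` T))}"

text \<open>Equality of tiled zonotopes is understood up to affine isomorphism, since
  the shrinking and the projection live in different spaces.\<close>

definition same_tiled_zonotope ::
    "'a::euclidean_space set set \<Rightarrow> 'a set set \<Rightarrow> bool" where
  "same_tiled_zonotope C D \<longleftrightarrow>
     (\<exists>f a. linear f \<and> inj_on f (affine hull \<Union>C) \<and> D = (\<lambda>F. (+) a ` f ` F) ` C)"

section \<open>The splitting algorithm\<close>

text \<open>Polynomials in \<open>x\<close> and \<open>y\<close> are polynomials in \<open>x\<close> over the ring of polynomials in \<open>y\<close>.\<close>

abbreviation var_x :: "int poly poly" where "var_x \<equiv> [:0, 1:]"

abbreviation var_y :: "int poly poly" where "var_y \<equiv> [:[:0, 1:]:]"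

definition num_parallel :: "'a::euclidean_space set set \<Rightarrow> 'a set set \<Rightarrow> 'a \<Rightarrow> nat" where
  "num_parallel C c w =
     card {d \<in> edge_classes C. d \<noteq> c \<and> (\<exists>u. edge_vector d u \<and> collinear {0, w, u})}"

text \<open>\<open>splitting C p\<close>: some sequence of choices of zones makes the algorithm return \<open>p\<close>
  on \<open>C\<close>. The choices in different branches are independent of each other.\<close>

inductive splitting :: "'a::euclidean_space set set \<Rightarrow> int poly poly \<Rightarrow> bool" where
  point: "splitting {{a}} 1"
| same: "\<lbrakk>c \<in> edge_classes C; edge_vector c w;
          same_tiled_zonotope (shrink C c w) (project C c w);
          splitting (shrink C c w) p\<rbrakk>
         \<Longrightarrow> splitting C (var_y * p)"
| split: "\<lbrakk>c \<in> edge_classes C; edge_vector c w;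
           \<not> same_tiled_zonotope (shrink C c w) (project C c w);
           splitting (project C c w) q; splitting (shrink C c w) p\<rbrakk>
          \<Longrightarrow> splitting C (var_x ^ num_parallel C c w * q + p)"

section \<open>The dual matroid of a configuration and the Tutte polynomial\<close>

text \<open>A matroid is given by its ground set and its set of bases.\<close>

definition linear_bases :: "'i set \<Rightarrow> ('i \<Rightarrow> 'a::real_vector) \<Rightarrow> 'i set set" where
  "linear_bases E V =
     {B. B \<subseteq> E \<and> inj_on V B \<and> independent (V ` B) \<and> span (V ` B) = span (V ` E)}"

definition dual_bases :: "'i set \<Rightarrow> ('i \<Rightarrow> 'a::real_vector) \<Rightarrow> 'i set set" where
  "dual_bases E V = (\<lambda>B. E - B) ` linear_bases E V"

definition matroid_rank :: "'i set set \<Rightarrow> 'i set \<Rightarrow> nat" where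
  "matroid_rank \<B> A = Max ((\<lambda>B. card (A \<inter> B)) ` \<B>)"

definition tutte_polynomial :: "'i set \<Rightarrow> 'i set set \<Rightarrow> int poly poly" where
  "tutte_polynomial E \<B> =
     (\<Sum>A\<in>Pow E. (var_x - 1) ^ (matroid_rank \<B> E - matroid_rank \<B> A) *
                 (var_y - 1) ^ (card A - matroid_rank \<B> A))"

end

(*
  The recursion preserves a property that does not mention generators: being a "cubical" complex,
  that is, a polyhedral complex of parallelotopes with convex support.

  For an edge class with vector w, the coordinate of a point in direction w inside the cells of
  the zone is well defined modulo 1 on the whole support. As the support is convex, it lifts to a
  continuous potential psi, which is constantly 0 or 1 on every cell outside the zone and grows
  with slope 1 in direction w inside the zone. Every line parallel to w that meets the support runs
  from psi = 0 to psi = 1. Hence shrinking is the image under x |-> x - psi x w, whose support is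
  the intersection of the support with its translate by -w and so convex again, and the
  projection is a copy of the level set psi = 1/2, so its support is the projected support.

  In this way the classes after shrinking are the other classes, and the classes after projecting
  are those not parallel to w: two nonparallel zones cross because a potential takes both values 0
  and 1 on the middle section of the other zone, and crossing edges stay in one class because
  the edges along which a potential varies form a single class. The two results agree up to affine
  isomorphism iff w is a coloop of the configuration, so the algorithm performs the
  deletion-contraction recursion of the dual matroid.
*)
theory Submission
  imports Defs
begin

text \<open>Locally nothing forces a line parallel to \<open>w\<close> to come out on the far side
  of the zone, and the recursion keeps no generators that could say so. Linear optimisation over the
  convex support takes their place: at the last point of such a line in the support, some functional
  increasing along \<open>w\<close> is maximal, and there the potential must be 1. The same
  principle makes two zones cross.

  Convexity enters a second time: on a support with holes the coordinate modulo 1 could have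
  monodromy and lift to no real function.

  The level 1/2 stands for any level strictly between 0 and 1. A line parallel to \<open>w\<close>
  that meets the support has exactly one point there, while it may have a whole segment at level 0
  or 1.

  Dualising exchanges x and y. Vectors parallel to \<open>w\<close> become loops after contraction
  and contribute factors x; a coloop contributes the factor y. The choices of zones do not matter
  because every choice expands one and the same sum over subsets of the classes.\<close>

section \<open>Parallelotopes\<close>

text \<open>The edge vectors form a set, unlike the list in \<open>zonotope\<close>, so that a face
  is named by two disjoint subsets of \<open>B\<close>: the vectors taken with coefficient 1 and the
  free ones.\<close>

definition par :: "'a::euclidean_space \<Rightarrow> 'a set \<Rightarrow> 'a set" where
  "par a B = {a + (\<Sum>b\<in>B. t b *\<^sub>R b) | t. \<forall>b\<in>B. 0 \<le> t b \<and> t b \<le> (1::real)}"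

lemma par_unique:
  fixes B :: "'a::euclidean_space set"
  assumes "independent B" "(\<Sum>b\<in>B. t b *\<^sub>R b) = (\<Sum>b\<in>B. s b *\<^sub>R b)" "b \<in> B"
  shows "t b = s b"
proof -
  have "(\<Sum>b\<in>B. (t b - s b) *\<^sub>R b) = 0"
    using assms(2) by (simp add: scaleR_diff_left sum_subtractf)
  then have "t b - s b = 0"
    using independentD[OF assms(1) independent_imp_finite[OF assms(1)] subset_refl, of "\<lambda>b. t b - s b"] assms(3)
    by blast
  then show ?thesis by simp
qed

lemma par_memI:
  "(\<And>b. b \<in> B \<Longrightarrow> 0 \<le> t b \<and> t b \<le> (1::real)) \<Longrightarrow> a + (\<Sum>b\<in>B. t b *\<^sub>R b) \<in> par a B"
  unfolding par_def by auto

lemma par_memE: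
  assumes "x \<in> par a B"
  obtains t where "\<forall>b\<in>B. 0 \<le> t b \<and> t b \<le> (1::real)" "x = a + (\<Sum>b\<in>B. t b *\<^sub>R b)"
  using assms unfolding par_def by blast

lemma par_translation: "(+) v ` par a B = par (v + a) B"
  unfolding par_def by (auto simp: image_iff add.assoc)

lemma par_linear_image:
  assumes "linear f" "inj_on f B"
  shows "f ` par a B = par (f a) (f ` B)"
proof -
  have *: "f (a + (\<Sum>b\<in>B. t b *\<^sub>R b)) = f a + (\<Sum>b\<in>f ` B. t (inv_into B f b) *\<^sub>R b)" for t
    using assms by (simp add: linear_add linear_sum linear_cmul sum.reindex)
  have **: "f (a + (\<Sum>b\<in>B. t (f b) *\<^sub>R b)) = f a + (\<Sum>b\<in>f ` B. t b *\<^sub>R b)" for t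
    using assms by (simp add: linear_add linear_sum linear_cmul sum.reindex)
  show ?thesis
  proof (intro equalityI subsetI)
    fix x assume "x \<in> f ` par a B"
    then obtain t where t: "\<forall>b\<in>B. 0 \<le> t b \<and> t b \<le> (1::real)" "x = f (a + (\<Sum>b\<in>B. t b *\<^sub>R b))"
      unfolding par_def by auto
    then show "x \<in> par (f a) (f ` B)" unfolding par_def *
      using assms(2) by (auto intro!: exI[of _ "\<lambda>b. t (inv_into B f b)"])
  next
    fix x assume "x \<in> par (f a) (f ` B)"
    then obtain t where t: "\<forall>b\<in>B. 0 \<le> t (f b) \<and> t (f b) \<le> (1::real)" "x = f a + (\<Sum>b\<in>f ` B. t b *\<^sub>R b)"
      unfolding par_def by auto
    have "a + (\<Sum>b\<in>B. t (f b) *\<^sub>R b) \<in> par a B" unfolding par_def using t(1)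
      by (intro CollectI exI[of _ "\<lambda>b. t (f b)"]) auto
    then show "x \<in> f ` par a B" unfolding t(2) **[symmetric] by (rule imageI)
  qed
qed

lemma zonotope_eq_par:
  assumes "distinct bs" shows "(+) a ` zonotope bs = par a (set bs)"
proof -
  have b: "bij_betw (nth bs) {..<length bs} (set bs)"
    by (rule bij_betw_nth[OF assms refl refl])
  have 1: "(\<Sum>b\<in>set bs. t b *\<^sub>R b) = (\<Sum>i<length bs. t (bs ! i) *\<^sub>R bs ! i)" for t
    using sum.reindex_bij_betw[OF b, of "\<lambda>b. t b *\<^sub>R b"] by simp
  have 2: "(\<Sum>i<length bs. s i *\<^sub>R bs ! i) = (\<Sum>b\<in>set bs. s (inv_into {..<length bs} (nth bs) b) *\<^sub>R b)" for s
    unfolding 1 using b by (intro sum.cong) (auto simp: bij_betw_def)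
  have 3: "\<forall>b\<in>set bs. inv_into {..<length bs} (nth bs) b < length bs"
    using b by (metis bij_betw_def inv_into_into lessThan_iff)
  show ?thesis
  proof (intro equalityI subsetI)
    fix x assume "x \<in> (+) a ` zonotope bs"
    then obtain s where "\<forall>i<length bs. 0 \<le> s i \<and> s i \<le> (1::real)" "x = a + (\<Sum>i<length bs. s i *\<^sub>R bs ! i)"
      unfolding zonotope_def by auto
    then show "x \<in> par a (set bs)" using 3 by (simp only: 2) (rule par_memI, blast)
  next
    fix x assume "x \<in> par a (set bs)"
    then obtain t where t: "\<forall>b\<in>set bs. 0 \<le> t b \<and> t b \<le> (1::real)" "x = a + (\<Sum>b\<in>set bs. t b *\<^sub>R b)"
      unfolding par_def by auto
    show "x \<in> (+) a ` zonotope bs" unfolding zonotope_def t(2) 1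
      using t(1) by (intro imageI) (auto intro!: exI[of _ "\<lambda>i. t (bs ! i)"])
  qed
qed

lemma par_add_mem: assumes "finite B" "b \<in> B" shows "a + b \<in> par a B"
proof -
  have "(\<Sum>c\<in>B. (if c = b then 1 else 0) *\<^sub>R c) = (\<Sum>c\<in>B. if c = b then c else 0)"
    by (rule sum.cong) auto
  also have "\<dots> = b" using assms by simp
  finally have "a + b = a + (\<Sum>c\<in>B. (if c = b then 1 else 0) *\<^sub>R c)" by simp
  then show ?thesis unfolding par_def by (auto intro!: exI[of _ "\<lambda>c. if c = b then 1 else (0::real)"])
qed

lemma par_base: "a \<in> par a B"
  unfolding par_def by (auto intro!: exI[of _ "\<lambda>_. 0"])

lemma par_diff_span: assumes "x \<in> par a B" "y \<in> par a B" shows "x - y \<in> span B"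
proof -
  have "x - a \<in> span B" if x: "x \<in> par a B" for x
  proof -
    obtain t where "\<forall>b\<in>B. 0 \<le> t b \<and> t b \<le> (1::real)" "x = a + (\<Sum>b\<in>B. t b *\<^sub>R b)"
      by (rule par_memE[OF x])
    then show ?thesis by (simp add: span_sum span_scale span_base)
  qed
  from span_diff[OF this[OF assms(1)] this[OF assms(2)]] show ?thesis by simp
qed

lemma par_singleton: "b \<noteq> 0 \<Longrightarrow> par a {b} = closed_segment a (a + b)"
  unfolding par_def closed_segment_def
  apply (auto simp: algebra_simps)
  done

text \<open>Coefficients on \<open>D\<close> extend by 1 on \<open>S\<close> and by 0 elsewhere. In
  these coordinates of the whole parallelotope the two face lemmas can be checked one coefficient at
  a time.\<close>

lemma par_subface:
  fixes B :: "'a::euclidean_space set"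
  assumes "finite B" "S \<subseteq> B" "D \<subseteq> B" "S \<inter> D = {}"
  shows "par (a + \<Sum>S) D = {a + (\<Sum>b\<in>B. t b *\<^sub>R b) | t. (\<forall>b\<in>B. 0 \<le> t b \<and> t b \<le> (1::real)) \<and>
     (\<forall>b\<in>S. t b = 1) \<and> (\<forall>b\<in>B-S-D. t b = 0)}" (is "_ = ?R")
proof -
  have split: "(\<Sum>b\<in>B. t b *\<^sub>R b) = \<Sum>S + (\<Sum>b\<in>D. t b *\<^sub>R b)"
    if "\<forall>b\<in>S. t b = (1::real)" "\<forall>b\<in>B-S-D. t b = 0" for t
  proof -
    have "(\<Sum>b\<in>B. t b *\<^sub>R b) = (\<Sum>b\<in>S \<union> D. t b *\<^sub>R b)"
      using assms that by (intro sum.mono_neutral_right) auto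
    also have "\<dots> = (\<Sum>b\<in>S. t b *\<^sub>R b) + (\<Sum>b\<in>D. t b *\<^sub>R b)"
      using assms by (intro sum.union_disjoint) (auto intro: finite_subset)
    also have "(\<Sum>b\<in>S. t b *\<^sub>R b) = \<Sum>S" using that by simp
    finally show ?thesis .
  qed
  show ?thesis
  proof (intro equalityI subsetI)
    fix x assume "x \<in> par (a + \<Sum>S) D"
    then obtain t where t: "\<forall>b\<in>D. 0 \<le> t b \<and> t b \<le> (1::real)" "x = a + \<Sum>S + (\<Sum>b\<in>D. t b *\<^sub>R b)"
      unfolding par_def by auto
    define s where "s = (\<lambda>b. if b \<in> D then t b else if b \<in> S then 1 else 0)"
    have "(\<Sum>b\<in>B. s b *\<^sub>R b) = \<Sum>S + (\<Sum>b\<in>D. s b *\<^sub>R b)"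
      using assms(4) by (intro split) (auto simp: s_def)
    moreover have "(\<Sum>b\<in>D. s b *\<^sub>R b) = (\<Sum>b\<in>D. t b *\<^sub>R b)"
      by (rule sum.cong) (auto simp: s_def)
    ultimately have "x = a + (\<Sum>b\<in>B. s b *\<^sub>R b)" using t by simp
    moreover have "\<forall>b\<in>B. 0 \<le> s b \<and> s b \<le> 1" "\<forall>b\<in>S. s b = 1" "\<forall>b\<in>B-S-D. s b = 0"
      using t assms by (auto simp: s_def)
    ultimately show "x \<in> ?R" by blast
  next
    fix x assume "x \<in> ?R"
    then obtain t where t: "\<forall>b\<in>B. 0 \<le> t b \<and> t b \<le> (1::real)" "\<forall>b\<in>S. t b = 1" "\<forall>b\<in>B-S-D. t b = 0"
      "x = a + (\<Sum>b\<in>B. t b *\<^sub>R b)" by blast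
    then have "x = (a + \<Sum>S) + (\<Sum>b\<in>D. t b *\<^sub>R b)" using split[OF t(2,3)] by simp
    then show "x \<in> par (a + \<Sum>S) D" using t(1) assms unfolding par_def by blast
  qed
qed

lemma convex_par: "convex (par a B)"
  unfolding convex_alt
proof (intro ballI allI impI)
  fix x y and u :: real assume xy: "x \<in> par a B" "y \<in> par a B" and u: "0 \<le> u \<and> u \<le> 1"
  obtain t where t: "\<forall>b\<in>B. 0 \<le> t b \<and> t b \<le> (1::real)" "x = a + (\<Sum>b\<in>B. t b *\<^sub>R b)"
    using xy unfolding par_def by blast
  obtain s where s: "\<forall>b\<in>B. 0 \<le> s b \<and> s b \<le> (1::real)" "y = a + (\<Sum>b\<in>B. s b *\<^sub>R b)"
    using xy unfolding par_def by blast
  have "(1 - u) *\<^sub>R x + u *\<^sub>R y = a + (\<Sum>b\<in>B. ((1-u) * t b + u * s b) *\<^sub>R b)"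
    unfolding t(2) s(2) by (simp add: algebra_simps sum.distrib scaleR_sum_right sum_subtractf)
  moreover have "0 \<le> (1-u) * t b + u * s b \<and> (1-u) * t b + u * s b \<le> 1" if "b \<in> B" for b
    using that s t u by (auto intro!: convex_bound_le add_nonneg_nonneg)
  ultimately show "(1 - u) *\<^sub>R x + u *\<^sub>R y \<in> par a B"
    unfolding par_def by (intro CollectI exI[of _ "\<lambda>b. (1-u) * t b + u * s b"]) auto
qed

text \<open>Coefficients are unique, and a proper convex combination of two numbers in [0,1] equals
  0 or 1 only if both numbers do.\<close>

lemma par_face:
  fixes B :: "'a::euclidean_space set"
  assumes ind: "independent B" and "S \<subseteq> B" "D \<subseteq> B" "S \<inter> D = {}"
  shows "par (a + \<Sum>S) D face_of par a B"
  unfolding face_of_def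
proof (intro conjI ballI impI convex_par)
  have fin: "finite B" using ind independent_imp_finite by blast
  note sub = par_subface[OF fin assms(2-4), of a]
  show "par (a + \<Sum>S) D \<subseteq> par a B"
  proof
    fix x assume "x \<in> par (a + \<Sum>S) D"
    then obtain t where "\<forall>b\<in>B. 0 \<le> t b \<and> t b \<le> (1::real)" "x = a + (\<Sum>b\<in>B. t b *\<^sub>R b)"
      unfolding sub by blast
    then show "x \<in> par a B" by (simp add: par_memI)
  qed
  have key: "p \<in> par (a + \<Sum>S) D" if H: "p \<in> par a B" "q \<in> par a B" "x \<in> par (a + \<Sum>S) D"
    "x = (1-u) *\<^sub>R p + u *\<^sub>R q" "0 < u" "u < 1" for p q x u
  proof -
    obtain t where t: "\<forall>b\<in>B. 0 \<le> t b \<and> t b \<le> (1::real)" "p = a + (\<Sum>b\<in>B. t b *\<^sub>R b)"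
      by (rule par_memE[OF H(1)])
    obtain s where s: "\<forall>b\<in>B. 0 \<le> s b \<and> s b \<le> (1::real)" "q = a + (\<Sum>b\<in>B. s b *\<^sub>R b)"
      by (rule par_memE[OF H(2)])
    obtain r where r: "\<forall>b\<in>B. 0 \<le> r b \<and> r b \<le> (1::real)" "\<forall>b\<in>S. r b = 1" "\<forall>b\<in>B-S-D. r b = 0"
      "x = a + (\<Sum>b\<in>B. r b *\<^sub>R b)" using H(3) unfolding sub by blast
    have "x = a + (\<Sum>b\<in>B. ((1-u) * t b + u * s b) *\<^sub>R b)"
      unfolding H(4) t(2) s(2)
      by (simp add: algebra_simps sum.distrib scaleR_sum_right sum_subtractf)
    then have "(\<Sum>b\<in>B. r b *\<^sub>R b) = (\<Sum>b\<in>B. ((1-u) * t b + u * s b) *\<^sub>R b)" using r(4) by simp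
    then have e: "r b = (1-u) * t b + u * s b" if "b \<in> B" for b
      using par_unique[OF ind, of r "\<lambda>b. (1-u) * t b + u * s b"] that by blast
    have "t b = 1" if "b \<in> S" for b
    proof (rule ccontr)
      assume "t b \<noteq> 1"
      moreover have b: "b \<in> B" using that assms by auto
      ultimately have "t b < 1" using t by force
      then have "(1-u) * t b < 1 - u" using H(6) by simp
      moreover have "u * s b \<le> u" using s b H(5) by (simp add: mult_left_le)
      ultimately show False using e[OF b] r(2) that by simp
    qed
    moreover have "t b = 0" if "b \<in> B - S - D" for b
    proof (rule ccontr)
      assume "t b \<noteq> 0"
      moreover have b: "b \<in> B" using that assms by auto
      ultimately have "t b > 0" using t by force
      then have "(1-u) * t b > 0" using H(6) by simp
      moreover have "u * s b \<ge> 0" using s b H(5) by simp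
      ultimately show False using e[OF b] r(3) that by simp
    qed
    ultimately show ?thesis unfolding sub using t by (intro CollectI exI[of _ t]) auto
  qed
  fix p q x assume pq: "p \<in> par a B" "q \<in> par a B" "x \<in> par (a + \<Sum>S) D" "x \<in> open_segment p q"
  then obtain u where u: "0 < u" "u < 1" "x = (1-u) *\<^sub>R p + u *\<^sub>R q" by (auto simp: in_segment)
  show "p \<in> par (a + \<Sum>S) D" using key[OF pq(1-3) u(3,1,2)] .
  show "q \<in> par (a + \<Sum>S) D" using key[OF pq(2,1,3), of "1-u"] u by (simp add: add.commute)
qed

text \<open>A relative interior point \<open>x\<close> of the face decides which face it is:
  \<open>S\<close> collects its coefficients equal to 1, \<open>D\<close> those strictly between 0
  and 1. One inclusion holds because the coordinate face contains \<open>x\<close>, the other is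
  obtained by prolonging segments through \<open>x\<close>.\<close>

lemma par_face_form:
  fixes B :: "'a::euclidean_space set"
  assumes ind: "independent B" and G: "G face_of par a B" "G \<noteq> {}"
  obtains S D where "S \<subseteq> B" "D \<subseteq> B" "S \<inter> D = {}" "G = par (a + \<Sum>S) D"
proof -
  have fin: "finite B" using ind independent_imp_finite by blast
  have "rel_interior G \<noteq> {}" using G face_of_imp_convex rel_interior_eq_empty by blast
  then obtain x where x: "x \<in> rel_interior G" by blast
  then have xG: "x \<in> G" using rel_interior_subset by blast
  then have "x \<in> par a B" using G face_of_imp_subset by blast
  then obtain t where t: "\<forall>b\<in>B. 0 \<le> t b \<and> t b \<le> (1::real)" "x = a + (\<Sum>b\<in>B. t b *\<^sub>R b)"
    unfolding par_def by blast
  define S where "S = {b\<in>B. t b = 1}"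
  define D where "D = {b\<in>B. 0 < t b \<and> t b < 1}"
  have SD: "S \<subseteq> B" "D \<subseteq> B" "S \<inter> D = {}" unfolding S_def D_def by auto
  note sub = par_subface[OF fin SD, of a]
  have xF: "x \<in> par (a + \<Sum>S) D" unfolding sub
    using t unfolding S_def D_def by (auto intro!: exI[of _ t])
  have "G \<subseteq> par (a + \<Sum>S) D"
    using subset_of_face_of[OF par_face[OF ind SD, of a] face_of_imp_subset[OF G(1)]] xF x by blast
  moreover have "par (a + \<Sum>S) D \<subseteq> G"
  proof
    fix y assume y: "y \<in> par (a + \<Sum>S) D"
    show "y \<in> G"
    proof (cases "y = x")
      case False
      obtain s where s: "\<forall>b\<in>B. 0 \<le> s b \<and> s b \<le> (1::real)" "\<forall>b\<in>S. s b = 1" "\<forall>b\<in>B-S-D. s b = 0"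
        "y = a + (\<Sum>b\<in>B. s b *\<^sub>R b)" using y unfolding sub by blast
      have "\<exists>e>0. \<forall>b\<in>D. e \<le> t b \<and> e \<le> 1 - t b"
      proof -
        define e where "e = Min (insert 1 ((\<lambda>b. min (t b) (1 - t b)) ` D))"
        have fD: "finite D" using SD fin finite_subset by blast
        have "e > 0" unfolding e_def using fD by (subst Min_gr_iff) (auto simp: D_def)
        moreover have "\<forall>b\<in>D. e \<le> min (t b) (1 - t b)" unfolding e_def using fD
          by (intro ballI Min_le finite.insertI finite_imageI insertI2 imageI)
        ultimately show ?thesis by auto
      qed
      then obtain e where e: "e > 0" "\<forall>b\<in>D. e \<le> t b \<and> e \<le> 1 - t b" by blast
      \<comment> \<open>The segment from \<open>y\<close> is prolonged past \<open>x\<close> by the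
        slack \<open>e\<close> of the free coefficients. It stays in the parallelotope and has
        \<open>x\<close> in its interior, so the face property yields \<open>y\<close>.\<close>
      define z where "z = x + e *\<^sub>R (x - y)"
      have z1: "z = a + (\<Sum>b\<in>B. (t b + e * (t b - s b)) *\<^sub>R b)"
        unfolding z_def t(2) s(4)
        by (simp add: algebra_simps sum.distrib scaleR_sum_right sum_subtractf)
      have "0 \<le> t b + e * (t b - s b) \<and> t b + e * (t b - s b) \<le> 1" if "b \<in> B" for b
      proof (cases "b \<in> D")
        case True
        have "t b - s b \<le> 1" "-1 \<le> t b - s b" using t(1) s(1) that by force+
        then have "e * (t b - s b) \<le> e * 1" "e * (-1) \<le> e * (t b - s b)"
          using e(1) mult_left_mono less_imp_le by blast+
        then show ?thesis using e(2) True by auto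
      next
        case False
        then have "t b = s b" using s t(1) that unfolding S_def D_def by force
        then show ?thesis using t that by auto
      qed
      then have zB: "z \<in> par a B" unfolding z1 by (rule par_memI)
      have yB: "y \<in> par a B" using y face_of_imp_subset[OF par_face[OF ind SD]] by blast
      have "x = (1 - 1/(1+e)) *\<^sub>R y + (1/(1+e)) *\<^sub>R z"
      proof -
        have u: "1/(1+e) + 1/(1+e) * e = 1" using e(1) by (simp add: field_simps)
        have "(1 - u) *\<^sub>R y + u *\<^sub>R z = (u + u * e) *\<^sub>R x + (1 - (u + u * e)) *\<^sub>R y" for u
          unfolding z_def by (simp add: algebra_simps)
        from this[of "1/(1+e)"] show ?thesis unfolding u by simp
      qed
      moreover have "y \<noteq> z"
      proof -
        have "z - y = (1 + e) *\<^sub>R (x - y)" unfolding z_def by (simp add: algebra_simps)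
        then show ?thesis using False e(1) by auto
      qed
      ultimately have "x \<in> open_segment y z" unfolding in_segment using e(1)
        by (intro conjI exI[of _ "1/(1+e)"]) auto
      then show ?thesis using G(1) yB zB xG unfolding face_of_def by blast
    qed (use xG in simp)
  qed
  ultimately show ?thesis using that[OF SD] by blast
qed

text \<open>The same parallelotope seen from the opposite end of \<open>w\<close>. Edge vectors of a
  class are known only up to sign, and this lets either sign be used; the last claim keeps two
  opposite vectors out of one basis.\<close>

lemma par_flip:
  fixes B :: "'a::euclidean_space set"
  assumes ind: "independent B" and w: "w \<in> B"
  shows "par a B = par (a + w) (insert (- w) (B - {w}))" "independent (insert (- w) (B - {w}))"
    "- w \<notin> B"
proof -
  have fin: "finite B" using ind independent_imp_finite by blast
  have nsp: "w \<notin> span (B - {w})" using ind w unfolding dependent_def by blast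
  then have nsp': "- w \<notin> span (B - {w})" using span_neg by fastforce
  have "w \<noteq> 0" using nsp span_zero by metis
  then have "- w \<noteq> w" by (metis add.inverse_inverse real_vector.scale_minus_left scaleR_one scaleR_right_imp_eq one_neq_neg_one)
  then show nB: "- w \<notin> B" using nsp' span_base[of "-w" "B - {w}"] by auto
  show "independent (insert (- w) (B - {w}))"
    using nsp' ind by (simp add: independent_insert independent_mono)
  have s1: "(\<Sum>b\<in>B. t b *\<^sub>R b) = t w *\<^sub>R w + (\<Sum>b\<in>B-{w}. t b *\<^sub>R b)" for t
    using fin w by (simp add: sum.remove)
  have s2: "(\<Sum>b\<in>insert (-w) (B-{w}). t b *\<^sub>R b) = - (t (-w) *\<^sub>R w) + (\<Sum>b\<in>B-{w}. t b *\<^sub>R b)" for t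
    using fin nB by simp
  show "par a B = par (a + w) (insert (- w) (B - {w}))"
  proof (intro equalityI subsetI)
    fix x assume "x \<in> par a B"
    then obtain t where t: "\<forall>b\<in>B. 0 \<le> t b \<and> t b \<le> (1::real)" "x = a + (\<Sum>b\<in>B. t b *\<^sub>R b)"
      unfolding par_def by blast
    let ?s = "t(-w := 1 - t w)"
    have "(\<Sum>b\<in>B-{w}. ?s b *\<^sub>R b) = (\<Sum>b\<in>B-{w}. t b *\<^sub>R b)"
      using nB by (intro sum.cong) auto
    then have "x = (a + w) + (\<Sum>b\<in>insert (-w) (B-{w}). ?s b *\<^sub>R b)"
      unfolding s2 t(2) s1 by (simp add: algebra_simps)
    moreover have "\<forall>b\<in>insert (-w) (B-{w}). 0 \<le> ?s b \<and> ?s b \<le> 1" using t(1) w by auto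
    ultimately show "x \<in> par (a + w) (insert (- w) (B - {w}))" unfolding par_def by blast
  next
    fix x assume "x \<in> par (a + w) (insert (- w) (B - {w}))"
    then obtain t where t: "\<forall>b\<in>insert (-w) (B-{w}). 0 \<le> t b \<and> t b \<le> (1::real)"
      "x = (a + w) + (\<Sum>b\<in>insert (-w) (B-{w}). t b *\<^sub>R b)"
      unfolding par_def by blast
    let ?s = "t(w := 1 - t (-w))"
    have "(\<Sum>b\<in>B-{w}. ?s b *\<^sub>R b) = (\<Sum>b\<in>B-{w}. t b *\<^sub>R b)"
      by (intro sum.cong) auto
    then have "x = a + (\<Sum>b\<in>B. ?s b *\<^sub>R b)"
      unfolding s1 t(2) s2 by (simp add: algebra_simps)
    moreover have "\<forall>b\<in>B. 0 \<le> ?s b \<and> ?s b \<le> 1" using t(1) w by auto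
    ultimately show "x \<in> par a B" unfolding par_def by blast
  qed
qed

lemma aff_dim_par:
  fixes B :: "'a::euclidean_space set"
  assumes ind: "independent B" shows "aff_dim (par a B) = int (card B)"
proof -
  have fin: "finite B" using ind independent_imp_finite by blast
  have "aff_dim (par a B) = aff_dim (par 0 B)"
    using par_translation[of a 0 B] aff_dim_translation_eq[of a "par 0 B"] by simp
  also have "\<dots> = int (dim (par 0 B))"
    by (rule aff_dim_zero) (simp add: par_base hull_inc)
  also have "dim (par 0 B) = card B"
  proof (rule dim_unique[OF _ _ ind refl])
    show "B \<subseteq> par 0 B" using par_add_mem[OF fin, of _ 0] by auto
    show "par 0 B \<subseteq> span B" using par_diff_span[OF _ par_base[of 0 B]] by fastforce
  qed
  finally show ?thesis .
qed

lemma independent_functional: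
  fixes B :: "'a::euclidean_space set"
  assumes ind: "independent B" and w: "w \<in> B"
  obtains g :: "'a \<Rightarrow> real" where "linear g" "g w = 1" "\<And>b. b \<in> B - {w} \<Longrightarrow> g b = 0"
proof -
  obtain g where "linear g" "\<forall>x\<in>B. g x = (if x = w then 1 else (0::real))"
    using linear_independent_extend[OF ind, of "\<lambda>x. if x = w then 1 else (0::real)"] by blast
  then show ?thesis using that w by auto
qed

text \<open>\<open>g x - g a\<close> is the coefficient of \<open>w\<close> in \<open>x\<close>, so
  the two displaced points are where the line through \<open>x\<close> in direction \<open>w\<close>
  enters and leaves the parallelotope.\<close>

lemma par_coordinate:
  fixes B :: "'a::euclidean_space set"
  assumes ind: "independent B" and w: "w \<in> B"
    and g: "linear g" "g w = 1" "\<And>b. b \<in> B - {w} \<Longrightarrow> g b = (0::real)" and x: "x \<in> par a B"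
  shows "0 \<le> g x - g a" "g x - g a \<le> 1"
    "x - (g x - g a) *\<^sub>R w \<in> par a (B - {w})" "x + (1 - (g x - g a)) *\<^sub>R w \<in> par (a + w) (B - {w})"
    "x - (g x - g a) *\<^sub>R w \<in> par a B" "x + (1 - (g x - g a)) *\<^sub>R w \<in> par a B"
proof -
  have fin: "finite B" using ind independent_imp_finite by blast
  obtain t where t: "\<forall>b\<in>B. 0 \<le> t b \<and> t b \<le> (1::real)" "x = a + (\<Sum>b\<in>B. t b *\<^sub>R b)"
    using x unfolding par_def by blast
  have s1: "(\<Sum>b\<in>B. t b *\<^sub>R b) = t w *\<^sub>R w + (\<Sum>b\<in>B-{w}. t b *\<^sub>R b)"
    using fin w by (simp add: sum.remove)
  have "g (\<Sum>b\<in>B-{w}. t b *\<^sub>R b) = 0" using g by (simp add: linear_sum linear_cmul)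
  then have e: "g x - g a = t w" unfolding t(2) s1 using g by (simp add: linear_add linear_cmul)
  show "0 \<le> g x - g a" "g x - g a \<le> 1" using e t w by auto
  have a: "x - (g x - g a) *\<^sub>R w = a + (\<Sum>b\<in>B-{w}. t b *\<^sub>R b)"
    unfolding e unfolding t(2) s1 by simp
  have b: "x + (1 - (g x - g a)) *\<^sub>R w = (a + w) + (\<Sum>b\<in>B-{w}. t b *\<^sub>R b)"
    unfolding e unfolding t(2) s1 by (simp add: algebra_simps)
  show 1: "x - (g x - g a) *\<^sub>R w \<in> par a (B - {w})" unfolding a par_def using t(1) by blast
  show 2: "x + (1 - (g x - g a)) *\<^sub>R w \<in> par (a + w) (B - {w})" unfolding b par_def using t(1) by blast
  have "par (a + \<Sum>{}) (B - {w}) face_of par a B" by (rule par_face[OF ind]) auto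
  then show "x - (g x - g a) *\<^sub>R w \<in> par a B" using 1 face_of_imp_subset by fastforce
  have "par (a + \<Sum>{w}) (B - {w}) face_of par a B" using w by (intro par_face[OF ind]) auto
  then show "x + (1 - (g x - g a)) *\<^sub>R w \<in> par a B" using 2 face_of_imp_subset by fastforce
qed

section \<open>Cubical complexes and edge classes\<close>

locale cubical =
  fixes C :: "'a::euclidean_space set set"
  assumes complex: "polyhedral_complex C" and nonempty: "C \<noteq> {}"
    and convex_support: "convex (\<Union>C)"
    and cells: "F \<in> C \<Longrightarrow> \<exists>a B. independent B \<and> F = par a B"
begin

lemma finite_C: "finite C" using complex unfolding polyhedral_complex_def by blast
lemma cell_nonempty: "F \<in> C \<Longrightarrow> F \<noteq> {}" using complex unfolding polyhedral_complex_def by blast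
lemma cell_polytope: "F \<in> C \<Longrightarrow> polytope F" using complex unfolding polyhedral_complex_def by blast
lemma cell_face: "F \<in> C \<Longrightarrow> G face_of F \<Longrightarrow> G \<noteq> {} \<Longrightarrow> G \<in> C"
  using complex unfolding polyhedral_complex_def by blast
lemma cell_Int: "F \<in> C \<Longrightarrow> G \<in> C \<Longrightarrow> (F \<inter> G) face_of F"
  using complex unfolding polyhedral_complex_def by blast
lemma cell_subset_face: "F \<in> C \<Longrightarrow> G \<in> C \<Longrightarrow> G \<subseteq> F \<Longrightarrow> G face_of F"
  using cell_Int[of F G] by (simp add: Int_absorb1)
lemma cell_convex: "F \<in> C \<Longrightarrow> convex F" using cell_polytope polytope_imp_convex by blast
lemma cell_closed: "F \<in> C \<Longrightarrow> closed F" using cell_polytope polytope_imp_closed by blast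
lemma cell_compact: "F \<in> C \<Longrightarrow> compact F" using cell_polytope polytope_imp_compact by blast

lemma cellE:
  assumes "F \<in> C" obtains a B where "independent B" "F = par a B"
  using cells[OF assms] by blast

lemma compact_support: "compact (\<Union>C)"
  using finite_C cell_compact by blast

lemma edge_cell: "e \<in> edges C \<Longrightarrow> e \<in> C"
  by (simp add: edges_def)

lemma edge_form:
  assumes "e \<in> edges C" obtains a b where "b \<noteq> 0" "e = closed_segment a (a + b)" "e = par a {b}"
proof -
  obtain a B where B: "independent B" "e = par a B" using cellE[OF edge_cell[OF assms]] .
  have "card B = 1" using aff_dim_par[OF B(1), of a] assms B(2) by (simp add: edges_def)
  then obtain b where b: "B = {b}" by (rule card_1_singletonE)
  then have "b \<noteq> 0" using B(1) dependent_zero by blast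
  then show ?thesis using that[of b a] B(2) b par_singleton by metis
qed

lemma par_edge:
  assumes "par a B \<in> C" "independent B" "b \<in> B" "S \<subseteq> B - {b}"
  shows "par (a + \<Sum>S) {b} \<in> edges C" "par (a + \<Sum>S) {b} \<subseteq> par a B"
proof -
  have f: "par (a + \<Sum>S) {b} face_of par a B"
    using assms by (intro par_face) auto
  then show "par (a + \<Sum>S) {b} \<subseteq> par a B" by (rule face_of_imp_subset)
  have "par (a + \<Sum>S) {b} \<in> C" using cell_face[OF assms(1) f] par_base by blast
  moreover have "aff_dim (par (a + \<Sum>S) {b}) = 1"
    using aff_dim_par[OF independent_mono[OF assms(2), of "{b}"], of "a + \<Sum>S"] assms(3) by simp
  ultimately show "par (a + \<Sum>S) {b} \<in> edges C" by (simp add: edges_def)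
qed

lemma edge_in_par:
  assumes e: "e \<in> edges C" and F: "par a B \<in> C" "independent B" and "e \<subseteq> par a B"
  obtains b S where "b \<in> B" "S \<subseteq> B - {b}" "e = par (a + \<Sum>S) {b}"
proof -
  have "e face_of par a B" using cell_subset_face[OF F(1) edge_cell[OF e] assms(4)] .
  then obtain S D where SD: "S \<subseteq> B" "D \<subseteq> B" "S \<inter> D = {}" "e = par (a + \<Sum>S) D"
    using par_face_form[OF F(2)] cell_nonempty[OF edge_cell[OF e]] by metis
  have "card D = 1" using aff_dim_par[OF independent_mono[OF F(2) SD(2)], of "a + \<Sum>S"] e SD(4)
    by (simp add: edges_def)
  then obtain b where b: "D = {b}" by (rule card_1_singletonE)
  show ?thesis using that[of b S] SD b by auto
qed

end

section \<open>Parallel edges of a common cell and the edge classes\<close>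

lemma segment_vector_eq:
  fixes p q u v :: "'a::euclidean_space"
  assumes "closed_segment p (p + u) = closed_segment q (q + v)"
  shows "(p = q \<and> u = v) \<or> (q = p + u \<and> u = - v)"
proof -
  have "{p, p + u} = {q, q + v}" using assms by simp
  then show ?thesis unfolding doubleton_eq_iff
    by (auto simp: eq_neg_iff_add_eq_0 add.commute)
qed

text \<open>Two edges are linked if they are parallel edges of a common cell of any dimension. This
  generates the same equivalence as opposite edges of parallelograms, without a dimension condition.\<close>

definition linked :: "'a::euclidean_space set set \<Rightarrow> ('a set \<times> 'a set) set" where
  "linked C = {(e, f). e \<in> edges C \<and> f \<in> edges C \<and> (\<exists>F\<in>C. e \<subseteq> F \<and> f \<subseteq> F) \<and> (\<exists>v. f = (+) v ` e)}"

lemma sym_opposite_edges: "sym (opposite_edges C)"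
  unfolding opposite_edges_def sym_def by (auto simp: Int_commute)

lemma sym_linked: "sym (linked C)"
proof (rule symI)
  fix e f assume "(e, f) \<in> linked C"
  moreover have "\<exists>w. e = (+) w ` f" if "f = (+) v ` e" for v
    using that by (intro exI[of _ "-v"]) (simp add: image_image)
  ultimately show "(f, e) \<in> linked C" unfolding linked_def by blast
qed

context cubical
begin

text \<open>Edges of a parallelogram in different directions share a vertex, so disjoint edges have
  the same direction and are translates of each other.\<close>

lemma opposite_edges_linked:
  assumes "(e, f) \<in> opposite_edges C" shows "(e, f) \<in> linked C"
proof -
  obtain Q where Q: "Q \<in> C" "aff_dim Q = 2" "e edge_of Q" "f edge_of Q" "e \<inter> f = {}"
    using assms unfolding opposite_edges_def by blast
  have ed: "e \<in> edges C" "f \<in> edges C" "e \<subseteq> Q" "f \<subseteq> Q"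
  proof -
    have "h \<in> edges C \<and> h \<subseteq> Q" if "h edge_of Q" for h
    proof -
      have h: "h face_of Q" "aff_dim h = 1" using that unfolding edge_of_def by auto
      then have "h \<noteq> {}" by auto
      then show ?thesis using cell_face[OF Q(1) h(1)] face_of_imp_subset[OF h(1)] h(2) by (simp add: edges_def)
    qed
    then show "e \<in> edges C" "f \<in> edges C" "e \<subseteq> Q" "f \<subseteq> Q" using Q by auto
  qed
  obtain a B where B: "independent B" "Q = par a B" using cellE[OF Q(1)] .
  have fin: "finite B" using B(1) independent_imp_finite by blast
  have c2: "card B = 2" using aff_dim_par[OF B(1), of a] Q(2) B(2) by simp
  obtain b S where b: "b \<in> B" "S \<subseteq> B - {b}" "e = par (a + \<Sum>S) {b}"
    using edge_in_par[OF ed(1) _ B(1), of a] ed(3) Q(1) B(2) by metis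
  obtain b' S' where b': "b' \<in> B" "S' \<subseteq> B - {b'}" "f = par (a + \<Sum>S') {b'}"
    using edge_in_par[OF ed(2) _ B(1), of a] ed(4) Q(1) B(2) by metis
  have "b = b'"
  proof (rule ccontr)
    assume ne: "b \<noteq> b'"
    then have BB: "B = {b, b'}" using b b' c2 fin
      by (metis card_2_iff card_subset_eq empty_subsetI insert_subset)
    \<comment> \<open>With two distinct directions, \<open>S\<close> and \<open>S'\<close> can only
      contain the vector of the other edge, so the vertex \<open>a + \<Sum>S + \<Sum>S'\<close> lies
      on both edges.\<close>
    have "S = {} \<or> S = {b'}" "S' = {} \<or> S' = {b}" using b(2) b'(2) BB ne by auto
    then have "(a + \<Sum>S) + \<Sum>S' \<in> e" "(a + \<Sum>S') + \<Sum>S \<in> f"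
      unfolding b(3) b'(3) using par_base par_add_mem[of "{b}" b] par_add_mem[of "{b'}" b'] by auto
    then show False using Q(5) by (metis add.assoc add.commute disjoint_iff)
  qed
  then have "f = (+) (\<Sum>S' - \<Sum>S) ` e" unfolding b(3) b'(3) par_translation by (simp add: algebra_simps)
  then show ?thesis unfolding linked_def using ed Q(1) by blast
qed

text \<open>Induction on \<open>S\<close>: each new vector \<open>c\<close> carries the edge across
  the two-dimensional face spanned by \<open>b\<close> and \<open>c\<close> to the opposite
  side.\<close>

lemma linked_par:
  assumes F: "par a B \<in> C" "independent B" and b: "b \<in> B" and S: "S \<subseteq> B - {b}"
  shows "(par a {b}, par (a + \<Sum>S) {b}) \<in> (opposite_edges C)\<^sup>*"
proof -
  have fin: "finite B" using F(2) independent_imp_finite by blast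
  have "finite S" using S fin finite_subset by blast
  then show ?thesis using S
  proof (induction S)
    case empty show ?case by simp
  next
    case (insert c S)
    have c: "c \<in> B" "c \<noteq> b" "c \<notin> S" using insert by auto
    have ibc: "independent {b, c}" using c b by (intro independent_mono[OF F(2)]) auto
    define Q where "Q = par (a + \<Sum>S) {b, c}"
    have fQ: "Q face_of par a B" unfolding Q_def using insert b by (intro par_face[OF F(2)]) auto
    have QC: "Q \<in> C" using cell_face[OF F(1) fQ] par_base unfolding Q_def by blast
    have aQ: "aff_dim Q = 2" unfolding Q_def aff_dim_par[OF ibc] using c by simp
    have ib: "independent {b}" by (rule independent_mono[OF ibc]) auto
    have e: "par (a + \<Sum>S) {b} edge_of Q"
      unfolding edge_of_def Q_def using par_face[OF ibc, of "{}" "{b}" "a + \<Sum>S"] aff_dim_par[OF ib] by simp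
    have s: "a + \<Sum>(insert c S) = a + \<Sum>S + c" using insert c by (simp add: algebra_simps)
    have f: "par (a + \<Sum>(insert c S)) {b} edge_of Q"
      unfolding edge_of_def Q_def s using par_face[OF ibc, of "{c}" "{b}" "a + \<Sum>S"] aff_dim_par[OF ib] c by simp
    have "par (a + \<Sum>S) {b} \<inter> par (a + \<Sum>(insert c S)) {b} = {}"
    proof (rule ccontr)
      assume "\<not> ?thesis"
      then obtain x where x: "x \<in> par (a + \<Sum>S) {b}" "x \<in> par (a + \<Sum>S + c) {b}" unfolding s by blast
      obtain t where t: "x = (a + \<Sum>S) + (\<Sum>b\<in>{b}. t b *\<^sub>R b)" by (rule par_memE[OF x(1)])
      obtain t' where t': "x = (a + \<Sum>S + c) + (\<Sum>b\<in>{b}. t' b *\<^sub>R b)" by (rule par_memE[OF x(2)])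
      have "c = (t b - t' b) *\<^sub>R b" using t t' by (simp add: algebra_simps)
      then have "c \<in> span {b}" by (simp add: span_scale span_base)
      moreover have "c \<notin> span {b}"
        using ibc c(2) unfolding dependent_def by (metis insert_Diff_if insertI1 insertI2 Diff_insert_absorb empty_iff insert_iff singletonD insert_commute)
      ultimately show False by blast
    qed
    then have "(par (a + \<Sum>S) {b}, par (a + \<Sum>(insert c S)) {b}) \<in> opposite_edges C"
      unfolding opposite_edges_def using QC aQ e f by blast
    moreover have "(par a {b}, par (a + \<Sum>S) {b}) \<in> (opposite_edges C)\<^sup>*" using insert by blast
    ultimately show ?case by (rule rtrancl.rtrancl_into_rtrancl[rotated])
  qed
qed

text \<open>Both edges are connected, through two-dimensional faces, to the edge of the same
  direction at the base vertex \<open>a\<close>.\<close>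

lemma linked_opposite_edges:
  assumes "(e, f) \<in> linked C" shows "(e, f) \<in> (opposite_edges C)\<^sup>*"
proof -
  obtain F v where F: "F \<in> C" "e \<in> edges C" "f \<in> edges C" "e \<subseteq> F" "f \<subseteq> F" "f = (+) v ` e"
    using assms unfolding linked_def by blast
  obtain a B where B: "independent B" "F = par a B" using cellE[OF F(1)] .
  obtain b S where b: "b \<in> B" "S \<subseteq> B - {b}" "e = par (a + \<Sum>S) {b}"
    using edge_in_par[OF F(2) _ B(1), of a] F B(2) by metis
  obtain b' S' where b': "b' \<in> B" "S' \<subseteq> B - {b'}" "f = par (a + \<Sum>S') {b'}"
    using edge_in_par[OF F(3) _ B(1), of a] F B(2) by metis
  have nz: "b \<noteq> 0" "b' \<noteq> 0" using B(1) b(1) b'(1) dependent_zero by blast+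
  have "par (v + (a + \<Sum>S)) {b} = par (a + \<Sum>S') {b'}"
    using F(6) unfolding b(3) b'(3) par_translation by (rule sym)
  then have "b = b' \<or> b = - b'" unfolding par_singleton[OF nz(1)] par_singleton[OF nz(2)]
    using segment_vector_eq by blast
  then have bb: "b' = b" using par_flip(3)[OF B(1) b'(1)] b(1) by auto
  have "(par a {b}, e) \<in> (opposite_edges C)\<^sup>*" "(par a {b}, f) \<in> (opposite_edges C)\<^sup>*"
    using linked_par[OF _ B(1) b(1,2), of a] linked_par[OF _ B(1) b(1) b'(2)[unfolded bb], of a] F(1)
    unfolding B(2) b(3) b'(3) bb by auto
  then show ?thesis using sym_rtrancl[OF sym_opposite_edges] by (meson rtrancl_trans symD)
qed

lemma rtrancl_linked: "(opposite_edges C)\<^sup>* = (linked C)\<^sup>*"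
proof
  show "(opposite_edges C)\<^sup>* \<subseteq> (linked C)\<^sup>*"
    by (rule rtrancl_mono) (use opposite_edges_linked in auto)
  show "(linked C)\<^sup>* \<subseteq> (opposite_edges C)\<^sup>*"
    by (rule rtrancl_subset_rtrancl) (use linked_opposite_edges in auto)
qed

lemma edge_classes_alt: "edge_classes C = {(linked C)\<^sup>* `` {e} | e. e \<in> edges C}"
  unfolding edge_classes_def quotient_def rtrancl_linked by blast

lemma linked_edges: "(e, f) \<in> (linked C)\<^sup>* \<Longrightarrow> e \<in> edges C \<Longrightarrow> f \<in> edges C"
  by (induction rule: rtrancl_induct) (auto simp: linked_def)

lemma linked_sym: "(e, f) \<in> (linked C)\<^sup>* \<Longrightarrow> (f, e) \<in> (linked C)\<^sup>*"
  using sym_rtrancl[OF sym_linked] by (meson symD)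

lemma class_edges: "c \<in> edge_classes C \<Longrightarrow> e \<in> c \<Longrightarrow> e \<in> edges C"
  unfolding edge_classes_alt using linked_edges by auto

lemma class_nonempty: "c \<in> edge_classes C \<Longrightarrow> \<exists>e. e \<in> c"
  unfolding edge_classes_alt by auto

lemma class_eq_image: "c \<in> edge_classes C \<Longrightarrow> e \<in> c \<Longrightarrow> c = (linked C)\<^sup>* `` {e}"
  unfolding edge_classes_alt using linked_sym by (auto intro: rtrancl_trans)

lemma class_connected: "c \<in> edge_classes C \<Longrightarrow> e \<in> c \<Longrightarrow> f \<in> c \<Longrightarrow> (e, f) \<in> (linked C)\<^sup>*"
  using class_eq_image by blast

lemma class_closed: "c \<in> edge_classes C \<Longrightarrow> e \<in> c \<Longrightarrow> (e, f) \<in> (linked C)\<^sup>* \<Longrightarrow> f \<in> c"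
  using class_eq_image by blast

lemma class_eq: "c \<in> edge_classes C \<Longrightarrow> d \<in> edge_classes C \<Longrightarrow> e \<in> c \<Longrightarrow> e \<in> d \<Longrightarrow> c = d"
  using class_eq_image by blast

lemma class_exists: "e \<in> edges C \<Longrightarrow> \<exists>c\<in>edge_classes C. e \<in> c"
  unfolding edge_classes_alt by blast

lemma finite_edge_classes: "finite (edge_classes C)"
proof (rule finite_subset)
  show "edge_classes C \<subseteq> Pow (edges C)" using class_edges by blast
  show "finite (Pow (edges C))" using finite_C by (simp add: edges_def)
qed

lemma class_segment:
  assumes c: "c \<in> edge_classes C" and w: "edge_vector c w" and e: "e \<in> c"
  shows "\<exists>a. e = closed_segment a (a + w)"
proof -
  obtain e0 a0 where e0: "e0 \<in> c" "e0 = closed_segment a0 (a0 + w)" using w unfolding edge_vector_def by blast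
  have "(e0, e) \<in> (linked C)\<^sup>*" using class_connected[OF c e0(1) e] .
  then show ?thesis
  proof (induction rule: rtrancl_induct)
    case base then show ?case using e0(2) by blast
  next
    case (step y z)
    then obtain a v where "y = closed_segment a (a + w)" "z = (+) v ` y" unfolding linked_def by blast
    then have "z = closed_segment (v + a) (v + a + w)"
      by (simp add: closed_segment_translation add.assoc)
    then show ?case by blast
  qed
qed

lemma class_vector_nonzero:
  assumes "c \<in> edge_classes C" "edge_vector c w" shows "w \<noteq> 0"
proof
  assume "w = 0"
  then obtain e a where "e \<in> c" "e = {a}" using assms(2) unfolding edge_vector_def by auto
  then show False using class_edges[OF assms(1)] by (force simp: edges_def)
qed

lemma class_vector_unique:
  assumes "c \<in> edge_classes C" "edge_vector c w" "edge_vector c u" shows "u = w \<or> u = - w"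
proof -
  obtain e where e: "e \<in> c" using class_nonempty assms(1) by blast
  obtain a b where "e = closed_segment a (a + w)" "e = closed_segment b (b + u)"
    using class_segment[OF assms(1) _ e] assms(2,3) by blast
  then show ?thesis using segment_vector_eq by (metis add.inverse_inverse)
qed

lemma class_vector_exists:
  assumes "c \<in> edge_classes C" shows "\<exists>w. edge_vector c w"
proof -
  obtain e where e: "e \<in> c" using class_nonempty[OF assms] by blast
  obtain a b where "e = closed_segment a (a + b)" using edge_form[OF class_edges[OF assms e]] by metis
  then show ?thesis unfolding edge_vector_def using e by blast
qed

end

lemma edge_vector_minus: "edge_vector c w \<Longrightarrow> edge_vector c (- w)"
  unfolding edge_vector_def
  by (metis add_minus_cancel closed_segment_commute minus_add_cancel add.commute)

definition has_edge :: "'a set set \<Rightarrow> 'a set \<Rightarrow> bool" where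
  "has_edge c F \<longleftrightarrow> (\<exists>e\<in>c. e \<subseteq> F)"

context cubical
begin

text \<open>The cell may list \<open>- w\<close> instead of \<open>w\<close>; moving the base vertex
  with \<open>par_flip\<close> corrects the sign.\<close>

lemma class_cell_form:
  assumes c: "c \<in> edge_classes C" "edge_vector c w" and F: "F \<in> C" "has_edge c F"
  obtains a B where "independent B" "w \<in> B" "F = par a B"
proof -
  obtain e where e: "e \<in> c" "e \<subseteq> F" using F(2) unfolding has_edge_def by blast
  obtain a B where B: "independent B" "F = par a B" using cellE[OF F(1)] .
  obtain b S where b: "b \<in> B" "S \<subseteq> B - {b}" "e = par (a + \<Sum>S) {b}"
    using edge_in_par[OF class_edges[OF c(1) e(1)] _ B(1), of a] e F(1) B(2) by metis
  have nz: "b \<noteq> 0" using B(1) b(1) dependent_zero by blast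
  obtain p where "e = closed_segment p (p + w)" using class_segment[OF c e(1)] by blast
  then have "w = b \<or> w = - b" using b(3) par_singleton[OF nz] segment_vector_eq by metis
  then show ?thesis
  proof
    assume "w = b" then show ?thesis using that B b by blast
  next
    assume "w = - b" then show ?thesis using that[OF par_flip(2)[OF B(1) b(1)]] par_flip(1)[OF B(1) b(1)] B(2) by blast
  qed
qed

lemma class_parallel:
  assumes c: "c \<in> edge_classes C" "edge_vector c w" and F: "F \<in> C" "has_edge c F"
    and f: "f \<in> edges C" "f \<subseteq> F" "f = closed_segment p (p + w)"
  shows "f \<in> c"
proof -
  obtain e where e: "e \<in> c" "e \<subseteq> F" using F(2) unfolding has_edge_def by blast
  obtain q where q: "e = closed_segment q (q + w)" using class_segment[OF c e(1)] by blast
  have "f = (+) (p - q) ` e" unfolding f(3) q by (simp add: closed_segment_translation[symmetric] add.assoc[symmetric])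
  then have "(e, f) \<in> linked C" unfolding linked_def using e f F(1) class_edges[OF c(1) e(1)] by blast
  then show ?thesis using class_closed[OF c(1) e(1)] by blast
qed

lemma par_has_edge:
  assumes c: "c \<in> edge_classes C" "edge_vector c w" and F: "F \<in> C" "has_edge c F"
    and G: "par a B \<in> C" "independent B" "w \<in> B" "par a B \<subseteq> F"
  shows "has_edge c (par a B)"
proof -
  have nz: "w \<noteq> 0" using G(2,3) dependent_zero by blast
  have e: "par a {w} \<in> edges C" "par a {w} \<subseteq> par a B" using par_edge[OF G(1-3), of "{}"] by auto
  have "par a {w} \<in> c"
    using class_parallel[OF c F e(1) _ par_singleton[OF nz]] e(2) G(4) by blast
  then show ?thesis unfolding has_edge_def using e(2) by blast
qed

text \<open>The difference of the two points puts \<open>w\<close> in the span of the edge vectors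
  \<open>D\<close> of the face, and independence of \<open>B\<close> then forces \<open>w\<close>
  into \<open>D\<close>.\<close>

lemma has_edge_face:
  assumes c: "c \<in> edge_classes C" "edge_vector c w" and F: "F \<in> C" "has_edge c F"
    and G: "G face_of F" "x \<in> G" "x + w \<in> G"
  shows "has_edge c G"
proof -
  obtain a B where B: "independent B" "w \<in> B" "F = par a B" using class_cell_form[OF c F] .
  obtain S D where D: "S \<subseteq> B" "D \<subseteq> B" "S \<inter> D = {}" "G = par (a + \<Sum>S) D"
    using par_face_form[OF B(1), of G a] G B(3) by blast
  have "w \<in> span D" using par_diff_span[OF G(3,2)[unfolded D(4)]] by simp
  have wD: "w \<in> D"
  proof (rule ccontr)
    assume "w \<notin> D"
    then have "D \<subseteq> B - {w}" using D(2) by blast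
    then have "w \<in> span (B - {w})" using \<open>w \<in> span D\<close> span_mono by blast
    then show False using B(1,2) unfolding dependent_def by blast
  qed
  have "par (a + \<Sum>S) D \<in> C" using cell_face[OF F(1) G(1)] G(2) D(4) by blast
  then show ?thesis unfolding D(4)
    using par_has_edge[OF c F _ independent_mono[OF B(1) D(2)] wD] face_of_imp_subset[OF G(1)] D(4) by blast
qed

text \<open>\<open>H\<close> is the smallest face of \<open>F\<close> that contains \<open>G\<close>
  and has \<open>w\<close> among its edge vectors. It has the same projection along \<open>w\<close>
  as \<open>G\<close>, and so lets an arbitrary face of a zone cell be replaced by a cell of the
  zone.\<close>

lemma prism_closure:
  assumes c: "c \<in> edge_classes C" "edge_vector c w" and F: "F \<in> C" "has_edge c F"
    and G: "G face_of F" "G \<noteq> {}"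
  obtains H where "H \<in> C" "H \<subseteq> F" "G \<subseteq> H" "has_edge c H" "\<And>x. x \<in> H \<Longrightarrow> \<exists>t. x + t *\<^sub>R w \<in> G"
proof -
  obtain a B where B: "independent B" "w \<in> B" "F = par a B" using class_cell_form[OF c F] .
  have fin: "finite B" using B(1) independent_imp_finite by blast
  obtain S D where D: "S \<subseteq> B" "D \<subseteq> B" "S \<inter> D = {}" "G = par (a + \<Sum>S) D"
    using par_face_form[OF B(1), of G a] G B(3) by blast
  have G': "G face_of par a B" using G B by simp
  show ?thesis
  proof (cases "w \<in> D")
    case True
    have "has_edge c G"
      using par_has_edge[OF c F, of "a + \<Sum>S" D] cell_face[OF F(1) G] D(4) G(1) True
        independent_mono[OF B(1) D(2)] face_of_imp_subset by blast
    moreover have "\<exists>t. x + t *\<^sub>R w \<in> G" if "x \<in> G" for x using that by (intro exI[of _ 0]) simp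
    ultimately show ?thesis using that[of G] cell_face[OF F(1) G] face_of_imp_subset[OF G(1)] by blast
  next
    case False
    define p where "p = a + \<Sum>(S - {w})"
    define H where "H = par p (insert w D)"
    have iD: "independent (insert w D)" using B D by (intro independent_mono[OF B(1)]) auto
    have fH: "H face_of F" unfolding H_def p_def B(3) using B D by (intro par_face[OF B(1)]) auto
    have HC: "H \<in> C" using cell_face[OF F(1) fH] par_base unfolding H_def by blast
    have HF: "H \<subseteq> F" using face_of_imp_subset[OF fH] .
    have hH: "has_edge c H" unfolding H_def
      using par_has_edge[OF c F HC[unfolded H_def] iD _ HF[unfolded H_def]] by blast
    have Gp: "G = par p D \<or> G = par (p + w) D"
    proof (cases "w \<in> S")
      case True
      have "\<Sum>S = w + \<Sum>(S - {w})" using True D fin finite_subset sum.remove[of S w "\<lambda>x. x"] by blast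
      then show ?thesis unfolding D(4) p_def by (simp add: algebra_simps)
    qed (simp add: D(4) p_def)
    have "G face_of H"
      using Gp
    proof
      assume "G = par p D"
      then show ?thesis unfolding H_def using par_face[OF iD, of "{}" D p] by auto
    next
      assume "G = par (p + w) D"
      then show ?thesis unfolding H_def using par_face[OF iD, of "{w}" D p] False by auto
    qed
    then have GH: "G \<subseteq> H" by (rule face_of_imp_subset)
    obtain g where g: "linear g" "g w = 1" "\<And>b. b \<in> insert w D - {w} \<Longrightarrow> g b = (0::real)"
      using independent_functional[OF iD, of w] by auto
    have DD: "insert w D - {w} = D" using False by auto
    have "\<exists>t. x + t *\<^sub>R w \<in> G" if x: "x \<in> H" for x
    proof -
      note pc = par_coordinate(3,4)[OF iD insertI1 g x[unfolded H_def], unfolded DD]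
      from Gp show ?thesis
      proof
        assume "G = par p D"
        then show ?thesis using pc(1) by (intro exI[of _ "- (g x - g p)"]) (simp only: scaleR_minus_left diff_conv_add_uminus[symmetric])
      next
        assume "G = par (p + w) D"
        then show ?thesis using pc(2) by (intro exI[of _ "1 - (g x - g p)"]) (simp only:)
      qed
    qed
    then show ?thesis using that HC HF GH hH by blast
  qed
qed

end

section \<open>Zone potentials\<close>

text \<open>A prism is the product of a base and a segment from \<open>0\<close> to \<open>w\<close>, and \<open>\<psi>\<close> is the affine
  coordinate along that segment.\<close>

definition prism :: "('a::euclidean_space \<Rightarrow> real) \<Rightarrow> 'a \<Rightarrow> 'a set \<Rightarrow> bool" where
  "prism \<psi> w F \<longleftrightarrow>
     (\<forall>x\<in>F. 0 \<le> \<psi> x \<and> \<psi> x \<le> 1 \<and> x - \<psi> x *\<^sub>R w \<in> F \<and> x + (1 - \<psi> x) *\<^sub>R w \<in> F) \<and>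
     (\<exists>g. linear g \<and> g w = (1::real) \<and> (\<forall>x\<in>F. \<forall>y\<in>F. \<psi> x - \<psi> y = g (x - y)))"

text \<open>No edge class is mentioned, so that a function obtained by other means, such as the one
  induced on a projection, can be recognised as a potential first and traced back to a single class
  afterwards.\<close>

definition potential :: "'a::euclidean_space set set \<Rightarrow> 'a \<Rightarrow> ('a \<Rightarrow> real) \<Rightarrow> bool" where
  "potential C w \<psi> \<longleftrightarrow> continuous_on (\<Union>C) \<psi> \<and>
     (\<forall>F\<in>C. prism \<psi> w F \<or> (\<forall>x\<in>F. \<psi> x = 0) \<or> (\<forall>x\<in>F. \<psi> x = 1))"

lemma prism_step:
  assumes "prism \<psi> w F" "x \<in> F" "x + t *\<^sub>R w \<in> F"
  shows "\<psi> (x + t *\<^sub>R w) = \<psi> x + t"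
proof -
  obtain g where g: "linear g" "g w = 1" "\<forall>x\<in>F. \<forall>y\<in>F. \<psi> x - \<psi> y = g (x - y)"
    using assms(1) unfolding prism_def by blast
  have "\<psi> (x + t *\<^sub>R w) - \<psi> x = g (t *\<^sub>R w)" using g(3) assms by force
  then show ?thesis using g(1,2) by (simp add: linear_cmul)
qed

lemma prism_slide:
  assumes p: "prism \<psi> w F" and "convex F" and x: "x \<in> F" and s: "0 \<le> s" "s \<le> 1"
  shows "x + (s - \<psi> x) *\<^sub>R w \<in> F" "\<psi> (x + (s - \<psi> x) *\<^sub>R w) = s"
proof -
  have e: "x - \<psi> x *\<^sub>R w \<in> F" "x + (1 - \<psi> x) *\<^sub>R w \<in> F" using p x unfolding prism_def by auto
  have "(1 - s) *\<^sub>R (x - \<psi> x *\<^sub>R w) + s *\<^sub>R (x + (1 - \<psi> x) *\<^sub>R w) \<in> F"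
    using convexD_alt[OF assms(2) e s] .
  also have "(1 - s) *\<^sub>R (x - \<psi> x *\<^sub>R w) + s *\<^sub>R (x + (1 - \<psi> x) *\<^sub>R w) = x + (s - \<psi> x) *\<^sub>R w"
    by (simp add: algebra_simps)
  finally show m: "x + (s - \<psi> x) *\<^sub>R w \<in> F" .
  show "\<psi> (x + (s - \<psi> x) *\<^sub>R w) = s" using prism_step[OF p x m] by simp
qed

text \<open>Reversing \<open>w\<close> exchanges bottom and top. Statements about entering the
  support thereby follow from those about leaving it.\<close>

lemma prism_reflect:
  assumes "prism \<psi> w F" shows "prism (\<lambda>x. 1 - \<psi> x) (- w) F"
proof -
  obtain g where g: "linear g" "g w = 1" "\<forall>x\<in>F. \<forall>y\<in>F. \<psi> x - \<psi> y = g (x - y)"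
    using assms(1) unfolding prism_def by blast
  have "linear (\<lambda>x. - g x)" using g(1) by (rule linear_compose_neg)
  moreover have "- g (- w) = 1" using g by (simp add: linear_neg)
  moreover have "\<forall>x\<in>F. \<forall>y\<in>F. (1 - \<psi> x) - (1 - \<psi> y) = - g (x - y)"
    using g(3) by (metis (no_types, opaque_lifting) add_diff_cancel_left diff_diff_eq2 diff_add_cancel minus_diff_eq diff_diff_eq)
  ultimately have "\<exists>g. linear g \<and> g (- w) = 1 \<and> (\<forall>x\<in>F. \<forall>y\<in>F. (1 - \<psi> x) - (1 - \<psi> y) = g (x - y))"
    by blast
  then show ?thesis using assms unfolding prism_def by simp
qed

lemma potential_reflect: "potential C w \<psi> \<Longrightarrow> potential C (- w) (\<lambda>x. 1 - \<psi> x)"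
  unfolding potential_def by (auto intro!: continuous_intros prism_reflect)

text \<open>Induction along the real line: the parameters at which both bounds hold form a compact
  set, and the one-sided step would move its largest element further unless that is
  \<open>t\<close>.\<close>

lemma slope_bound:
  fixes h :: "real \<Rightarrow> real"
  assumes h: "continuous_on {0..t} h" and t: "0 \<le> t"
    and step: "\<And>s. 0 \<le> s \<Longrightarrow> s < t \<Longrightarrow> \<exists>e>0. \<forall>d. 0 \<le> d \<and> d \<le> e \<longrightarrow> 0 \<le> h (s + d) - h s \<and> h (s + d) - h s \<le> d"
  shows "0 \<le> h t - h 0" "h t - h 0 \<le> t"
proof -
  define S where "S = {s\<in>{0..t}. h s - h 0 \<in> {0..}} \<inter> {s\<in>{0..t}. s - (h s - h 0) \<in> {0..}}"
  have "closed {s\<in>{0..t}. k s \<in> {0..}}" if "continuous_on {0..t} k" for k :: "real \<Rightarrow> real"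
    using continuous_closed_preimage[OF that, of "{0..}"] by (simp add: vimage_def Int_def)
  from this[of "\<lambda>s. h s - h 0"] this[of "\<lambda>s. s - (h s - h 0)"] have "closed S"
    unfolding S_def by (intro closed_Int) (simp_all add: h continuous_on_diff continuous_on_id)
  moreover have "bounded S" by (rule bounded_subset[of "{0..t}"]) (auto simp: S_def)
  ultimately have "compact S" by (simp add: compact_eq_bounded_closed)
  moreover have "0 \<in> S" using t by (auto simp: S_def)
  ultimately obtain m where m: "m \<in> S" "\<And>s. s \<in> S \<Longrightarrow> s \<le> m"
    using compact_attains_sup[of S] by auto
  have "m = t"
  proof (rule ccontr)
    assume "m \<noteq> t"
    then have mt: "0 \<le> m" "m < t" using m(1) by (auto simp: S_def)
    obtain e where e: "e > 0" "\<forall>d. 0 \<le> d \<and> d \<le> e \<longrightarrow> 0 \<le> h (m + d) - h m \<and> h (m + d) - h m \<le> d"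
      using step[OF mt] by blast
    define d where "d = min e (t - m)"
    have d: "0 < d" "d \<le> e" "m + d \<le> t" using e mt by (auto simp: d_def)
    have "m + d \<in> S" using e(2)[rule_format, of d] d mt m(1) unfolding S_def by auto
    then show False using m(2) d by force
  qed
  then show "0 \<le> h t - h 0" "h t - h 0 \<le> t" using m(1) by (auto simp: S_def)
qed

context cubical
begin

text \<open>The cells that miss \<open>u\<close> are finitely many closed sets, so near
  \<open>u\<close> the support consists of cells containing \<open>u\<close>; convexity keeps the
  short step towards \<open>z\<close> in the support.\<close>

lemma local_step:
  assumes u: "u \<in> \<Union>C" and z: "z \<in> \<Union>C"
  obtains F e where "F \<in> C" "0 < e" "e \<le> 1" "u \<in> F" "u + e *\<^sub>R (z - u) \<in> F"
proof -
  have "closed (\<Union>{F\<in>C. u \<notin> F})" using finite_C cell_closed by (intro closed_Union) auto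
  then have "open (- \<Union>{F\<in>C. u \<notin> F})" by (simp add: open_Compl)
  moreover have "u \<in> - \<Union>{F\<in>C. u \<notin> F}" by auto
  ultimately obtain r where r: "r > 0" "ball u r \<subseteq> - \<Union>{F\<in>C. u \<notin> F}"
    using open_contains_ball by metis
  define e where "e = min 1 (r / (2 * (1 + norm (z - u))))"
  have n: "1 + norm (z - u) > 0" by (simp add: add_pos_nonneg)
  have e: "0 < e" "e \<le> 1" unfolding e_def using r n by auto
  have "e * norm (z - u) \<le> r / (2 * (1 + norm (z - u))) * norm (z - u)"
    unfolding e_def by (intro mult_right_mono) auto
  also have "\<dots> < r"
  proof -
    have "r * norm (z - u) < r * (2 * (1 + norm (z - u)))"
    proof (rule mult_strict_left_mono[OF _ r(1)])
      show "norm (z - u) < 2 * (1 + norm (z - u))" using norm_ge_zero[of "z - u"] by argo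
    qed
    then show ?thesis using n by (simp add: divide_less_eq)
  qed
  finally have "u + e *\<^sub>R (z - u) \<in> ball u r" using e by (simp add: dist_norm)
  moreover have "u + e *\<^sub>R (z - u) \<in> \<Union>C"
  proof -
    have "u + e *\<^sub>R (z - u) = (1 - e) *\<^sub>R u + e *\<^sub>R z" by (simp add: algebra_simps)
    then show ?thesis using convexD_alt[OF convex_support u z] e by simp
  qed
  ultimately show ?thesis using r(2) that e by blast
qed

text \<open>Each cell is the hull of a finite set, and by convexity the support is the hull of all
  these sets together. This gives the support as a finite intersection of halfspaces, the form in
  which \<open>exit_halfspace\<close> examines it.\<close>

lemma polytope_support: "polytope (\<Union>C)"
proof -
  have "\<exists>v. finite v \<and> F = convex hull v" if "F \<in> C" for F
    using cell_polytope[OF that] unfolding polytope_def .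
  then obtain v where v: "\<And>F. F \<in> C \<Longrightarrow> finite (v F) \<and> F = convex hull (v F)" by metis
  have "\<Union>C = convex hull (\<Union>F\<in>C. v F)"
  proof
    show "\<Union>C \<subseteq> convex hull (\<Union>F\<in>C. v F)"
    proof
      fix x assume "x \<in> \<Union>C"
      then obtain F where "F \<in> C" "x \<in> convex hull (v F)" using v by blast
      then show "x \<in> convex hull (\<Union>F\<in>C. v F)" using hull_mono[of "v F" "\<Union>F\<in>C. v F" convex] by blast
    qed
    have "v F \<subseteq> F" if "F \<in> C" for F using v[OF that] hull_subset[of "v F" convex] by simp
    then have "(\<Union>F\<in>C. v F) \<subseteq> \<Union>C" by blast
    then show "convex hull (\<Union>F\<in>C. v F) \<subseteq> \<Union>C" by (rule hull_minimal) (rule convex_support)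
  qed
  moreover have "finite (\<Union>F\<in>C. v F)" using finite_C v by blast
  ultimately show ?thesis unfolding polytope_def by blast
qed

text \<open>Otherwise no defining halfspace whose normal increases along \<open>w\<close> is tight
  at \<open>x\<close>. Every halfspace then allows a positive step along \<open>w\<close>, and
  finitely many of them have a common one, against the second assumption.\<close>

lemma exit_halfspace:
  assumes x: "x \<in> \<Union>C" and w: "\<And>t. t > 0 \<Longrightarrow> x + t *\<^sub>R w \<notin> \<Union>C"
  obtains a where "a \<bullet> w > 0" "\<And>y. y \<in> \<Union>C \<Longrightarrow> a \<bullet> y \<le> a \<bullet> x"
proof (rule ccontr)
  note thesis = that
  assume "\<not> thesis"
  then have no: "\<exists>y\<in>\<Union>C. \<not> a \<bullet> y \<le> a \<bullet> x" if "a \<bullet> w > 0" for a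
    using that thesis by blast
  obtain H where H: "finite H" "\<Union>C = \<Inter>H" "\<And>h. h \<in> H \<Longrightarrow> \<exists>a b. h = {x. a \<bullet> x \<le> b}"
    using polytope_imp_polyhedron[OF polytope_support] unfolding polyhedron_def by metis
  have "\<exists>e>0. \<forall>t. 0 \<le> t \<and> t \<le> e \<longrightarrow> x + t *\<^sub>R w \<in> h" if h: "h \<in> H" for h
  proof -
    obtain a b where ab: "h = {x. a \<bullet> x \<le> b}" using H(3)[OF h] by blast
    have le: "a \<bullet> y \<le> b" if "y \<in> \<Union>C" for y using that h H(2) ab by auto
    show ?thesis
    proof (cases "a \<bullet> w > 0")
      case True
      have "a \<bullet> x \<noteq> b" using no[OF True] le by auto
      then have ax: "a \<bullet> x < b" using le[OF x] by simp
      show ?thesis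
      proof (intro exI[of _ "(b - a \<bullet> x) / (a \<bullet> w)"] conjI allI impI)
        show "(b - a \<bullet> x) / (a \<bullet> w) > 0" using ax True by simp
        fix t assume "0 \<le> t \<and> t \<le> (b - a \<bullet> x) / (a \<bullet> w)"
        then have "t * (a \<bullet> w) \<le> b - a \<bullet> x" using True by (simp add: pos_le_divide_eq)
        then show "x + t *\<^sub>R w \<in> h" unfolding ab by (simp add: inner_add_right)
      qed
    next
      case False
      then have "a \<bullet> (x + t *\<^sub>R w) \<le> b" if "0 \<le> t" for t
        using le[OF x] mult_nonneg_nonpos[OF that, of "a \<bullet> w"] by (simp add: inner_add_right)
      then show ?thesis unfolding ab by (intro exI[of _ 1]) auto
    qed
  qed
  then obtain e where e: "\<And>h. h \<in> H \<Longrightarrow> e h > 0 \<and> (\<forall>t. 0 \<le> t \<and> t \<le> e h \<longrightarrow> x + t *\<^sub>R w \<in> h)" by metis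
  define m where "m = Min (insert 1 (e ` H))"
  have "m > 0" unfolding m_def using H(1) e by (subst Min_gr_iff) auto
  moreover have "m \<le> e h" if "h \<in> H" for h unfolding m_def using H(1) that by (intro Min_le) auto
  ultimately have "x + m *\<^sub>R w \<in> \<Inter>H" using e by (auto intro: less_imp_le)
  then show False using w[OF \<open>m > 0\<close>] H(2) by simp
qed

end

text \<open>The constants 0 and 1 satisfy \<open>potential\<close> as well; a single prism excludes
  them and makes the function take both values.\<close>

locale zone_potential = cubical C for C :: "'a::euclidean_space set set" +
  fixes w :: 'a and \<psi> :: "'a \<Rightarrow> real"
  assumes potential: "potential C w \<psi>" and some_prism: "\<exists>F\<in>C. prism \<psi> w F"
begin

lemma continuous: "continuous_on (\<Union>C) \<psi>" using potential unfolding potential_def by blast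

lemma cell_cases:
  assumes "F \<in> C"
  obtains "prism \<psi> w F" | "\<And>x. x \<in> F \<Longrightarrow> \<psi> x = 0" | "\<And>x. x \<in> F \<Longrightarrow> \<psi> x = 1"
  using potential assms unfolding potential_def by blast

lemma direction_nonzero: "w \<noteq> 0"
proof -
  obtain g where "linear g" "g w = (1::real)" using some_prism unfolding prism_def by blast
  then show ?thesis using linear_0 by force
qed

lemma potential_range: assumes "x \<in> \<Union>C" shows "0 \<le> \<psi> x" "\<psi> x \<le> 1"
proof -
  obtain F where F: "F \<in> C" "x \<in> F" using assms by blast
  from F(1) show "0 \<le> \<psi> x" by (cases rule: cell_cases) (use F(2) in \<open>auto simp: prism_def\<close>)
  from F(1) show "\<psi> x \<le> 1" by (cases rule: cell_cases) (use F(2) in \<open>auto simp: prism_def\<close>)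
qed

lemma interior_prism: assumes "F \<in> C" "x \<in> F" "0 < \<psi> x" "\<psi> x < 1" shows "prism \<psi> w F"
  using assms(1) by (cases rule: cell_cases) (use assms in force)+

lemma reflect: "zone_potential C (- w) (\<lambda>x. 1 - \<psi> x)"
proof -
  have "\<exists>F\<in>C. prism (\<lambda>x. 1 - \<psi> x) (- w) F" using some_prism prism_reflect by blast
  then show ?thesis using potential_reflect[OF potential] cubical_axioms
    by (simp add: zone_potential_def zone_potential_axioms_def)
qed

lemma line_convex:
  assumes "x \<in> \<Union>C" "x + t *\<^sub>R w \<in> \<Union>C" "0 \<le> s" "s \<le> t" shows "x + s *\<^sub>R w \<in> \<Union>C"
proof (cases "t = 0")
  case False
  have "(1 - s / t) *\<^sub>R x + (s / t) *\<^sub>R (x + t *\<^sub>R w) \<in> \<Union>C"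
    using assms False by (intro convexD_alt[OF convex_support]) auto
  moreover have "(1 - s / t) *\<^sub>R x + (s / t) *\<^sub>R (x + t *\<^sub>R w) = x + s *\<^sub>R w"
    using False by (simp add: algebra_simps)
  ultimately show ?thesis by simp
qed (use assms in simp)

text \<open>Inside one cell the potential is constant or has slope 1 along \<open>w\<close>.
  \<open>local_step\<close> provides such a cell just after each point, and
  \<open>slope_bound\<close> passes from there to the whole segment.\<close>

lemma slope:
  assumes x: "x \<in> \<Union>C" and t: "x + t *\<^sub>R w \<in> \<Union>C" "0 \<le> t"
  shows "\<psi> x \<le> \<psi> (x + t *\<^sub>R w)" "\<psi> (x + t *\<^sub>R w) \<le> \<psi> x + t"
proof -
  define h where "h = (\<lambda>s. \<psi> (x + s *\<^sub>R w))"
  have cont: "continuous_on {0..t} h"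
    unfolding h_def
    by (rule continuous_on_compose2[OF continuous]) (auto intro!: continuous_intros line_convex[OF x t(1)] simp: image_subset_iff simp del: Union_iff)
  have step: "\<exists>e>0. \<forall>d. 0 \<le> d \<and> d \<le> e \<longrightarrow> 0 \<le> h (s + d) - h s \<and> h (s + d) - h s \<le> d"
    if s: "0 \<le> s" "s < t" for s
  proof -
    define u where "u = x + s *\<^sub>R w"
    have u: "u \<in> \<Union>C" unfolding u_def using line_convex[OF x t(1)] s by simp
    obtain F e where F: "F \<in> C" "0 < e" "e \<le> 1" "u \<in> F" "u + e *\<^sub>R (x + t *\<^sub>R w - u) \<in> F"
      using local_step[OF u t(1)] .
    define r where "r = e * (t - s)"
    have r: "r > 0" using F s by (simp add: r_def)
    have ur: "u + r *\<^sub>R w \<in> F" using F(5) unfolding u_def r_def by (simp add: algebra_simps)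
    have "0 \<le> \<psi> (u + d *\<^sub>R w) - \<psi> u \<and> \<psi> (u + d *\<^sub>R w) - \<psi> u \<le> d" if d: "0 \<le> d" "d \<le> r" for d
    proof -
      have "(1 - d / r) *\<^sub>R u + (d / r) *\<^sub>R (u + r *\<^sub>R w) \<in> F"
        using d r by (intro convexD_alt[OF cell_convex[OF F(1)] F(4) ur]) auto
      moreover have "(1 - d / r) *\<^sub>R u + (d / r) *\<^sub>R (u + r *\<^sub>R w) = u + d *\<^sub>R w"
        using r by (simp add: algebra_simps)
      ultimately have ud: "u + d *\<^sub>R w \<in> F" by simp
      from F(1) show ?thesis
      proof (cases rule: cell_cases)
        case 1 show ?thesis using prism_step[OF 1 F(4) ud] d by simp
      qed (use F(4) ud d in auto)
    qed
    then show ?thesis unfolding h_def using r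
      by (intro exI[of _ r]) (simp add: u_def scaleR_add_left add.assoc)
  qed
  show "\<psi> x \<le> \<psi> (x + t *\<^sub>R w)" "\<psi> (x + t *\<^sub>R w) \<le> \<psi> x + t"
    using slope_bound[OF cont t(2) step] by (auto simp: h_def)
qed

text \<open>A point maximising \<open>a\<close> over the top part \<open>{\<psi> = 1}\<close> maximises \<open>a\<close> globally: a
  step that increases \<open>a\<close> inside a prism can be slid up to the top without decreasing \<open>a\<close>. As no
  point of the maximal face can have potential strictly between 0 and 1, connectedness does the rest.\<close>

lemma maximal_face_top:
  assumes a: "a \<bullet> w > 0" and x: "x \<in> \<Union>C" and max: "\<And>y. y \<in> \<Union>C \<Longrightarrow> a \<bullet> y \<le> a \<bullet> x"
  shows "\<psi> x = 1"
proof -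
  define T where "T = \<Union>C \<inter> \<psi> -` {1}"
  have "closed T" unfolding T_def
    using continuous_closed_preimage[OF continuous compact_imp_closed[OF compact_support], of "{1}"] by simp
  then have "compact T" using compact_support unfolding T_def by (metis compact_Int_closed inf_left_idem)
  moreover have "T \<noteq> {}"
  proof -
    obtain F where F: "F \<in> C" "prism \<psi> w F" using some_prism by blast
    obtain p where p: "p \<in> F" using cell_nonempty[OF F(1)] by blast
    have "p + (1 - \<psi> p) *\<^sub>R w \<in> T"
      using prism_slide[OF F(2) cell_convex[OF F(1)] p, of 1] F(1) unfolding T_def by auto
    then show ?thesis by blast
  qed
  moreover have "continuous_on T (\<lambda>y. a \<bullet> y)" by (intro continuous_intros)
  ultimately obtain u where u: "u \<in> T" "\<And>y. y \<in> T \<Longrightarrow> a \<bullet> y \<le> a \<bullet> u"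
    using continuous_attains_sup by metis
  have uZ: "u \<in> \<Union>C" "\<psi> u = 1" using u(1) by (auto simp: T_def)
  have umax: "a \<bullet> u = a \<bullet> x"
  proof (rule ccontr)
    assume "a \<bullet> u \<noteq> a \<bullet> x"
    then have lt: "a \<bullet> u < a \<bullet> x" using max[OF uZ(1)] by simp
    obtain F e where F: "F \<in> C" "0 < e" "e \<le> 1" "u \<in> F" "u + e *\<^sub>R (x - u) \<in> F"
      using local_step[OF uZ(1) x] .
    define p where "p = u + e *\<^sub>R (x - u)"
    have pF: "p \<in> F" using F by (simp add: p_def)
    have ap: "a \<bullet> p > a \<bullet> u" unfolding p_def using lt F by (simp add: inner_add_right inner_diff_right)
    from F(1) show False
    proof (cases rule: cell_cases)
      case 1
      have "p + (1 - \<psi> p) *\<^sub>R w \<in> T"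
        using prism_slide[OF 1 cell_convex[OF F(1)] pF, of 1] F(1) unfolding T_def by auto
      from u(2)[OF this] have "a \<bullet> p + (1 - \<psi> p) * (a \<bullet> w) \<le> a \<bullet> u" by (simp add: inner_add_right)
      moreover have "(1 - \<psi> p) * (a \<bullet> w) \<ge> 0" using a potential_range[of p] pF F(1) by (intro mult_nonneg_nonneg) auto
      ultimately show False using ap by simp
    next
      case 2 then show False using uZ F(4) by force
    next
      case 3
      then have "p \<in> T" using pF F(1) unfolding T_def by auto
      then show False using u(2) ap by force
    qed
  qed
  define M where "M = \<Union>C \<inter> {y. a \<bullet> y = a \<bullet> x}"
  have "convex M" unfolding M_def by (intro convex_Int convex_support convex_hyperplane)
  then have con: "connected (\<psi> ` M)"
    using continuous_on_subset[OF continuous, of M] unfolding M_def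
    by (intro connected_continuous_image convex_connected) auto
  \<comment> \<open>A value strictly between 0 and 1 would place \<open>y\<close> in a prism, where
    sliding up along \<open>w\<close> increases \<open>a\<close> beyond its maximum.\<close>
  have val: "\<psi> y = 0 \<or> \<psi> y = 1" if y: "y \<in> M" for y
  proof (rule ccontr)
    assume "\<not> ?thesis"
    moreover have yC: "y \<in> \<Union>C" using y by (simp add: M_def)
    ultimately have y01: "0 < \<psi> y" "\<psi> y < 1" using potential_range[OF yC] by auto
    obtain F where F: "F \<in> C" "y \<in> F" using yC by blast
    have p: "prism \<psi> w F" using interior_prism[OF F y01] .
    have "y + (1 - \<psi> y) *\<^sub>R w \<in> \<Union>C" using prism_slide(1)[OF p cell_convex[OF F(1)] F(2), of 1] F(1) by auto
    from max[OF this] have "(1 - \<psi> y) * (a \<bullet> w) \<le> 0" using y by (simp add: M_def inner_add_right)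
    then show False using a y01 by (simp add: mult_le_0_iff)
  qed
  have "u \<in> M" "x \<in> M" using uZ umax x by (auto simp: M_def)
  show ?thesis
  proof (rule ccontr)
    assume "\<psi> x \<noteq> 1"
    then have "\<psi> x = 0" using val \<open>x \<in> M\<close> by blast
    then have "{0..1} \<subseteq> \<psi> ` M" using con \<open>u \<in> M\<close> \<open>x \<in> M\<close> uZ(2)
      by (intro connected_contains_Icc) (auto simp: image_iff intro: bexI[of _ x] bexI[of _ u])
    then have "1/2 \<in> \<psi> ` M" by auto
    then show False using val by force
  qed
qed

text \<open>\<open>m\<close> is the last parameter at which the line lies in the support. There
  \<open>exit_halfspace\<close> gives a functional that increases along \<open>w\<close> and is
  maximal, and \<open>maximal_face_top\<close> gives the value 1.\<close>

lemma exit_point: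
  assumes x: "x \<in> \<Union>C"
  obtains t where "0 \<le> t" "x + t *\<^sub>R w \<in> \<Union>C" "\<psi> (x + t *\<^sub>R w) = 1"
proof -
  define f where "f = (\<lambda>t. x + t *\<^sub>R w)"
  define T where "T = {0..} \<inter> f -` (\<Union>C)"
  have cf: "continuous_on {0..} f" unfolding f_def by (intro continuous_intros)
  have clo: "closed T" unfolding T_def
    using continuous_closed_preimage[OF cf _ compact_imp_closed[OF compact_support]] by simp
  obtain K where K: "\<And>y. y \<in> \<Union>C \<Longrightarrow> norm y \<le> K" using compact_imp_bounded[OF compact_support] unfolding bounded_iff by blast
  have "norm t \<le> 2 * K / norm w" if "t \<in> T" for t
  proof -
    have "norm (t *\<^sub>R w) = norm (f t - x)" by (simp add: f_def)
    also have "\<dots> \<le> norm (f t) + norm x" by (rule norm_triangle_ineq4)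
    also have "\<dots> \<le> 2 * K" using K[OF x] K[of "f t"] that by (auto simp: T_def)
    finally show ?thesis using direction_nonzero by (simp add: field_simps)
  qed
  then have "bounded T" unfolding bounded_iff by blast
  with clo have "compact T" by (simp add: compact_eq_bounded_closed)
  moreover have "0 \<in> T" using x by (simp add: T_def f_def)
  ultimately obtain m where m: "m \<in> T" "\<And>s. s \<in> T \<Longrightarrow> s \<le> m"
    using compact_attains_sup[of T] by auto
  have y: "f m \<in> \<Union>C" "0 \<le> m" using m(1) by (auto simp: T_def)
  have "f m + t *\<^sub>R w \<notin> \<Union>C" if "t > 0" for t
  proof
    assume "f m + t *\<^sub>R w \<in> \<Union>C"
    then have "m + t \<in> T" using y that by (simp add: T_def f_def algebra_simps)
    then show False using m(2) that by force
  qed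
  then obtain a where "a \<bullet> w > 0" "\<And>y. y \<in> \<Union>C \<Longrightarrow> a \<bullet> y \<le> a \<bullet> f m"
    using exit_halfspace[OF y(1)] by metis
  then have "\<psi> (f m) = 1" using maximal_face_top y(1) by blast
  then show ?thesis using that[OF y(2)] y(1) by (simp add: f_def)
qed

lemma entry_point:
  assumes x: "x \<in> \<Union>C"
  obtains t where "0 \<le> t" "x - t *\<^sub>R w \<in> \<Union>C" "\<psi> (x - t *\<^sub>R w) = 0"
proof -
  interpret r: zone_potential C "- w" "\<lambda>x. 1 - \<psi> x" by (rule reflect)
  obtain t where "0 \<le> t" "x + t *\<^sub>R (- w) \<in> \<Union>C" "1 - \<psi> (x + t *\<^sub>R (- w)) = 1"
    using r.exit_point[OF x] .
  then show ?thesis using that[of t] by simp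
qed

lemma line_value:
  assumes x: "x \<in> \<Union>C" and s: "0 \<le> s" "s \<le> 1"
  obtains t where "x + t *\<^sub>R w \<in> \<Union>C" "\<psi> (x + t *\<^sub>R w) = s"
proof -
  obtain p where p: "0 \<le> p" "x + p *\<^sub>R w \<in> \<Union>C" "\<psi> (x + p *\<^sub>R w) = 1" using exit_point[OF x] .
  obtain q where q: "0 \<le> q" "x - q *\<^sub>R w \<in> \<Union>C" "\<psi> (x - q *\<^sub>R w) = 0" using entry_point[OF x] .
  define S where "S = closed_segment (x - q *\<^sub>R w) (x + p *\<^sub>R w)"
  have SC: "S \<subseteq> \<Union>C" unfolding S_def by (rule closed_segment_subset[OF q(2) p(2) convex_support])
  have "connected (\<psi> ` S)"
    by (rule connected_continuous_image[OF continuous_on_subset[OF continuous SC]]) (simp add: S_def)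
  moreover have "x - q *\<^sub>R w \<in> S" "x + p *\<^sub>R w \<in> S" by (auto simp: S_def)
  then have "0 \<in> \<psi> ` S" "1 \<in> \<psi> ` S" using p(3) q(3) by (metis imageI)+
  ultimately have "{0..1} \<subseteq> \<psi> ` S" by (rule connected_contains_Icc)
  then obtain y where y: "y \<in> S" "\<psi> y = s" using s by auto
  then obtain u where "y = (1 - u) *\<^sub>R (x - q *\<^sub>R w) + u *\<^sub>R (x + p *\<^sub>R w)" unfolding S_def in_segment by blast
  then have "y = x + (u * p - (1 - u) * q) *\<^sub>R w" by (simp add: algebra_simps)
  then show ?thesis using that y SC by blast
qed

text \<open>At an intermediate value the point lies in a prism, so the potential strictly increases
  just after it and, being monotone along \<open>w\<close>, does not come back.\<close>

lemma line_value_unique: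
  assumes x: "x \<in> \<Union>C" and y: "x + t *\<^sub>R w \<in> \<Union>C" and e: "\<psi> (x + t *\<^sub>R w) = \<psi> x" and i: "0 < \<psi> x" "\<psi> x < 1"
  shows "t = 0"
proof -
  have key: False if x: "x \<in> \<Union>C" and y: "x + t *\<^sub>R w \<in> \<Union>C" and e: "\<psi> (x + t *\<^sub>R w) = \<psi> x"
    and i: "0 < \<psi> x" "\<psi> x < 1" and t: "t > 0" for x t
  proof -
    obtain F where F: "F \<in> C" "x \<in> F" using x by blast
    note p = interior_prism[OF F i]
    define d where "d = min t (1 - \<psi> x)"
    have d: "0 < d" "d \<le> t" "\<psi> x + d \<le> 1" using t i by (auto simp: d_def)
    have xd: "x + d *\<^sub>R w \<in> F" "\<psi> (x + d *\<^sub>R w) = \<psi> x + d"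
      using prism_slide[OF p cell_convex[OF F(1)] F(2), of "\<psi> x + d"] d i by auto
    have "\<psi> (x + d *\<^sub>R w) \<le> \<psi> (x + d *\<^sub>R w + (t - d) *\<^sub>R w)"
      using xd F y d by (intro slope) (auto simp: algebra_simps)
    then show False using xd(2) d e by (simp add: algebra_simps)
  qed
  show ?thesis
  proof (rule ccontr)
    assume "t \<noteq> 0"
    then consider "t > 0" | "t < 0" by linarith
    then show False
    proof cases
      case 1 then show False using key[OF x y e i] by blast
    next
      case 2
      have "x + t *\<^sub>R w + (- t) *\<^sub>R w = x" by (simp add: algebra_simps)
      then show False using key[OF y, of "- t"] x e i 2 by simp
    qed
  qed
qed

text \<open>With slope at most 1 it takes length at least 1 to climb from 0 to 1, so the exit point
  is not before \<open>x + w\<close>.\<close>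

lemma bottom_shift:
  assumes x: "x \<in> \<Union>C" "\<psi> x = 0" shows "x + w \<in> \<Union>C"
proof -
  obtain t where t: "0 \<le> t" "x + t *\<^sub>R w \<in> \<Union>C" "\<psi> (x + t *\<^sub>R w) = 1" using exit_point[OF x(1)] .
  then have "1 \<le> t" using slope(2)[OF x(1) t(2,1)] x(2) by simp
  then show ?thesis using line_convex[OF x(1) t(2), of 1] by simp
qed

lemma top_shift:
  assumes x: "x \<in> \<Union>C" "\<psi> x = 1" shows "x - w \<in> \<Union>C"
proof -
  interpret r: zone_potential C "- w" "\<lambda>x. 1 - \<psi> x" by (rule reflect)
  show ?thesis using r.bottom_shift[OF x(1)] x(2) by simp
qed

text \<open>Rising by 1 over length 1 with slope at most 1 forces the value 1/2 at the midpoint. A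
  cell containing the midpoint is a prism, and sliding by half of \<open>w\<close> both ways reaches
  the two ends.\<close>

lemma crossing_prism:
  assumes "x \<in> \<Union>C" "x + w \<in> \<Union>C" "\<psi> x = 0" "\<psi> (x + w) = 1"
  obtains H where "H \<in> C" "prism \<psi> w H" "x \<in> H" "x + w \<in> H"
proof -
  define m where "m = x + (1/2) *\<^sub>R w"
  have w2: "(1/2) *\<^sub>R w + (1/2) *\<^sub>R w = w" by (simp add: scaleR_add_left[symmetric])
  have m: "m \<in> \<Union>C" unfolding m_def using line_convex[OF assms(1), of 1 "1/2"] assms(2) by simp
  have "\<psi> m \<le> 1/2" using slope(2)[OF assms(1) m[unfolded m_def]] assms(3) by (simp add: m_def)
  moreover have "\<psi> (m + (1/2) *\<^sub>R w) \<le> \<psi> m + 1/2"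
    using slope(2)[OF m, of "1/2"] assms(2) w2 by (simp add: m_def add.assoc)
  ultimately have pm: "\<psi> m = 1/2" using assms(4) w2 by (simp add: m_def add.assoc)
  obtain H where H: "H \<in> C" "m \<in> H" using m by blast
  have p: "prism \<psi> w H" using interior_prism[OF H] pm by simp
  have "m - (1/2) *\<^sub>R w \<in> H" "m + (1/2) *\<^sub>R w \<in> H" using prism_slide(1)[OF p cell_convex[OF H(1)] H(2), of 0] prism_slide(1)[OF p cell_convex[OF H(1)] H(2), of 1] pm by auto
  then show ?thesis using that[OF H(1) p] w2 by (simp add: m_def add.assoc)
qed

end

section \<open>The potential of an edge class\<close>

context cubical
begin

lemma edge_has_edge:
  assumes c: "c \<in> edge_classes C" and e: "e \<in> edges C" "has_edge c e" shows "e \<in> c"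
proof -
  obtain e' where e': "e' \<in> c" "e' \<subseteq> e" using e(2) unfolding has_edge_def by blast
  obtain a b where b: "b \<noteq> 0" "e = par a {b}" using edge_form[OF e(1)] by metis
  have "independent {b}" using b(1) by simp
  then obtain b' S where "b' \<in> {b}" "S \<subseteq> {b} - {b'}" "e' = par (a + \<Sum>S) {b'}"
    using edge_in_par[OF class_edges[OF c e'(1)], of a "{b}"] e'(2) b(2) edge_cell[OF e(1)] by metis
  then have "e' = e" using b(2) by auto
  then show ?thesis using e'(1) by simp
qed

lemma has_edge_mono: "has_edge c F \<Longrightarrow> F \<subseteq> G \<Longrightarrow> has_edge c G"
  unfolding has_edge_def by blast

lemma class_cell_coordinate:
  assumes c: "c \<in> edge_classes C" "edge_vector c w" and F: "F \<in> C" "has_edge c F"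
  shows "\<exists>g k. linear g \<and> g w = (1::real) \<and> (\<forall>x\<in>F. 0 \<le> g x - k \<and> g x - k \<le> 1 \<and>
            x - (g x - k) *\<^sub>R w \<in> F \<and> x + (1 - (g x - k)) *\<^sub>R w \<in> F)"
proof -
  obtain a B where B: "independent B" "w \<in> B" "F = par a B" using class_cell_form[OF c F] .
  obtain g where g: "linear g" "g w = 1" "\<And>b. b \<in> B - {w} \<Longrightarrow> g b = (0::real)"
    using independent_functional[OF B(1,2)] by blast
  show ?thesis
    using par_coordinate(1,2,5,6)[OF B(1,2) g] g(1,2) unfolding B(3)
    by (intro exI[of _ g] exI[of _ "g a"]) blast
qed

text \<open>The coordinates of the cells of a zone are well defined modulo 1 on the whole support, and
  a continuous logarithm lifts them to a real function because the support is convex.\<close>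

theorem class_potential:
  assumes c: "c \<in> edge_classes C" "edge_vector c w"
  obtains \<psi> where "potential C w \<psi>" "\<And>F. F \<in> C \<Longrightarrow> has_edge c F \<Longrightarrow> prism \<psi> w F"
    "\<And>F. F \<in> C \<Longrightarrow> \<not> has_edge c F \<Longrightarrow> (\<forall>x\<in>F. \<psi> x = 0) \<or> (\<forall>x\<in>F. \<psi> x = 1)"
proof -
  have "\<forall>F. \<exists>g k. F \<in> C \<and> has_edge c F \<longrightarrow> linear g \<and> g w = (1::real) \<and> (\<forall>x\<in>F. 0 \<le> g x - k \<and> g x - k \<le> 1 \<and>
            x - (g x - k) *\<^sub>R w \<in> F \<and> x + (1 - (g x - k)) *\<^sub>R w \<in> F)"
    using class_cell_coordinate[OF c] by blast
  then obtain g k where gk: "\<And>F. F \<in> C \<Longrightarrow> has_edge c F \<Longrightarrow> linear (g F) \<and> g F w = (1::real) \<and>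
      (\<forall>x\<in>F. 0 \<le> g F x - k F \<and> g F x - k F \<le> 1 \<and>
            x - (g F x - k F) *\<^sub>R w \<in> F \<and> x + (1 - (g F x - k F)) *\<^sub>R w \<in> F)"
    by metis
  \<comment> \<open>Modulo 1 the value 0 outside the zone covers both constants 0 and 1; which of
    the two the lift takes on a given cell is settled only at the end.\<close>
  define \<tau> where "\<tau> F x = (if has_edge c F then g F x - k F else 0)" for F x
  have \<tau>_lin: "\<tau> F (x + t *\<^sub>R w) = \<tau> F x + t" if "F \<in> C" "has_edge c F" for F x t
    using gk[OF that] that(2) by (simp add: \<tau>_def linear_add linear_cmul)
  have \<tau>_range: "0 \<le> \<tau> F x \<and> \<tau> F x \<le> 1" if "F \<in> C" "x \<in> F" for F x
    using gk[OF that(1)] that(2) unfolding \<tau>_def by auto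
  have \<tau>_ends: "x - \<tau> F x *\<^sub>R w \<in> F \<and> x + (1 - \<tau> F x) *\<^sub>R w \<in> F" if "F \<in> C" "has_edge c F" "x \<in> F" for F x
    using gk[OF that(1,2)] that(2,3) unfolding \<tau>_def by auto
  have \<tau>_bottom: "\<tau> F p = 0" if "F \<in> C" "has_edge c F" "p \<in> F" "p + w \<in> F" for F p
    using \<tau>_lin[OF that(1,2), of p 1] \<tau>_range[OF that(1,3)] \<tau>_range[OF that(1,4)] by simp
  have w0: "w \<noteq> 0" using class_vector_nonzero[OF c] .
  \<comment> \<open>A point with fractional coordinate is inside a segment from \<open>p\<close> to
    \<open>p + w\<close> of its cell. Any other cell through it meets this cell in a face, which
    contains the whole segment; both coordinates are then measured from the same
    \<open>p\<close>.\<close>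
  have interior: "has_edge c G \<and> \<tau> G x = \<tau> F x"
    if F: "F \<in> C" "x \<in> F" and G: "G \<in> C" "x \<in> G" and i: "0 < \<tau> F x" "\<tau> F x < 1" for F G x
  proof -
    have hF: "has_edge c F" using i unfolding \<tau>_def by (auto split: if_splits)
    define p where "p = x - \<tau> F x *\<^sub>R w"
    define q where "q = x + (1 - \<tau> F x) *\<^sub>R w"
    have pq: "p \<in> F" "q \<in> F" using \<tau>_ends[OF F(1) hF F(2)] by (auto simp: p_def q_def)
    have qp: "q = p + w" by (simp add: p_def q_def algebra_simps)
    have "x = (1 - \<tau> F x) *\<^sub>R p + \<tau> F x *\<^sub>R q" by (simp add: p_def q_def algebra_simps)
    then have "x \<in> open_segment p q" unfolding in_segment using i w0 qp by auto
    then have H: "p \<in> F \<inter> G" "q \<in> F \<inter> G"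
      using cell_Int[OF F(1) G(1)] pq F(2) G(2) unfolding face_of_def by blast+
    have "has_edge c (F \<inter> G)"
      using has_edge_face[OF c F(1) hF cell_Int[OF F(1) G(1)] H(1)] H(2) qp by simp
    then have hG: "has_edge c G" using has_edge_mono[of c "F \<inter> G" G] by blast
    have "\<tau> G p = 0" using \<tau>_bottom[OF G(1) hG] H qp by auto
    then show ?thesis using \<tau>_lin[OF G(1) hG, of p "\<tau> F x"] hG by (simp add: p_def)
  qed
  have compat: "cis (2 * pi * \<tau> F x) = cis (2 * pi * \<tau> G x)"
    if F: "F \<in> C" "x \<in> F" and G: "G \<in> C" "x \<in> G" for F G x
  proof (cases "0 < \<tau> F x \<and> \<tau> F x < 1")
    case True then show ?thesis using interior[OF F G] by simp
  next
    case False
    then have 1: "\<tau> F x = 0 \<or> \<tau> F x = 1" using \<tau>_range[OF F] by linarith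
    have 2: "\<tau> G x = 0 \<or> \<tau> G x = 1"
    proof (rule ccontr)
      assume "\<not> ?thesis"
      then have "0 < \<tau> G x" "\<tau> G x < 1" using \<tau>_range[OF G] by linarith+
      then show False using interior[OF G F] False by simp
    qed
    have "cis (2 * pi) = 1" by (simp add: cis_2pi)
    then show ?thesis using 1 2 by auto
  qed
  \<comment> \<open>Any cell containing \<open>x\<close> gives the same value by
    \<open>compat\<close>; \<open>cis\<close> identifies the coordinates 0 and 1.\<close>
  define f where "f x = cis (2 * pi * \<tau> (SOME F. F \<in> C \<and> x \<in> F) x)" for x
  have f_eq: "f x = cis (2 * pi * \<tau> F x)" if "F \<in> C" "x \<in> F" for F x
  proof -
    have "(SOME F. F \<in> C \<and> x \<in> F) \<in> C \<and> x \<in> (SOME F. F \<in> C \<and> x \<in> F)"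
      by (rule someI[of "\<lambda>F. F \<in> C \<and> x \<in> F" F]) (use that in blast)
    then show ?thesis unfolding f_def using compat that by blast
  qed
  have cont\<tau>: "continuous_on F (\<tau> F)" if "F \<in> C" for F
  proof (cases "has_edge c F")
    case True
    have "continuous_on F (\<lambda>x. g F x - k F)"
      using gk[OF that True] by (intro continuous_intros linear_continuous_on) (simp add: linear_conv_bounded_linear)
    moreover have "\<tau> F = (\<lambda>x. g F x - k F)" using True by (auto simp: \<tau>_def)
    ultimately show ?thesis by simp
  next
    case False
    then have "\<tau> F = (\<lambda>x. 0)" by (auto simp: \<tau>_def)
    then show ?thesis by simp
  qed
  have "continuous_on F f" if "F \<in> C" for F
  proof -
    have "continuous_on F (\<lambda>x. cis (2 * pi * \<tau> F x))"
      using cont\<tau>[OF that] by (intro continuous_intros)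
    then show ?thesis using f_eq[OF that] by (simp cong: continuous_on_cong)
  qed
  then have "continuous_on (\<Union>F\<in>C. F) f"
    by (intro continuous_on_closed_Union finite_C) (auto intro: cell_closed)
  then have cf: "continuous_on (\<Union>C) f" by simp
  have "f x \<noteq> 0" for x unfolding f_def by (rule cis_neq_zero)
  then obtain G where G: "continuous_on (\<Union>C) G" "\<And>x. x \<in> \<Union>C \<Longrightarrow> f x = exp (G x)"
    using continuous_logarithm_on_contractible[OF cf convex_imp_contractible[OF convex_support]] by metis
  define \<phi> where "\<phi> x = Im (G x) / (2 * pi)" for x
  have c\<phi>: "continuous_on (\<Union>C) \<phi>" unfolding \<phi>_def by (intro continuous_intros G(1)) auto
  have int: "\<exists>n::int. \<phi> x - \<tau> F x = n" if "F \<in> C" "x \<in> F" for F x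
  proof -
    have "exp (G x) = exp (\<i> * complex_of_real (2 * pi * \<tau> F x))"
      using G(2)[OF UnionI[OF that]] f_eq[OF that] by (simp add: cis_conv_exp)
    then obtain n :: int where "G x = \<i> * complex_of_real (2 * pi * \<tau> F x) + (of_int (2 * n) * pi) * \<i>"
      unfolding exp_eq by blast
    then have "Im (G x) = 2 * pi * \<tau> F x + 2 * n * pi" by simp
    then have "\<phi> x - \<tau> F x = n" unfolding \<phi>_def by (simp add: field_simps)
    then show ?thesis by blast
  qed
  have "\<exists>n::int. \<forall>x\<in>F. \<phi> x = \<tau> F x + n" if F: "F \<in> C" for F
  proof -
    \<comment> \<open>The difference is continuous with integer values on a connected cell, and
      distinct integers are at least 1 apart.\<close>
    have "(\<lambda>x. \<phi> x - \<tau> F x) constant_on F"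
    proof (rule continuous_discrete_range_constant)
      show "connected F" using cell_convex[OF F] convex_connected by blast
      show "continuous_on F (\<lambda>x. \<phi> x - \<tau> F x)"
        using cont\<tau>[OF F] continuous_on_subset[OF c\<phi>, of F] F by (intro continuous_intros) auto
      fix x assume x: "x \<in> F"
      have "1 \<le> norm ((\<phi> y - \<tau> F y) - (\<phi> x - \<tau> F x))"
        if y: "y \<in> F" "\<phi> y - \<tau> F y \<noteq> \<phi> x - \<tau> F x" for y
      proof -
        obtain n m :: int where "\<phi> x - \<tau> F x = n" "\<phi> y - \<tau> F y = m" using int F x y(1) by metis
        then show ?thesis using y(2) by simp
      qed
      then show "\<exists>e>0. \<forall>y. y \<in> F \<and> \<phi> y - \<tau> F y \<noteq> \<phi> x - \<tau> F x \<longrightarrow>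
          e \<le> norm (\<phi> y - \<tau> F y - (\<phi> x - \<tau> F x))"
        by (intro exI[of _ 1]) simp
    qed
    then obtain r where r: "\<And>x. x \<in> F \<Longrightarrow> \<phi> x - \<tau> F x = r" unfolding constant_on_def by blast
    obtain x where "x \<in> F" using cell_nonempty[OF F] by blast
    then obtain n :: int where "r = n" using int[OF F] r by metis
    then show ?thesis using r by (metis add.commute diff_add_cancel)
  qed
  then obtain n :: "'a set \<Rightarrow> int" where n: "\<And>F x. F \<in> C \<Longrightarrow> x \<in> F \<Longrightarrow> \<phi> x = \<tau> F x + n F" by metis
  \<comment> \<open>At the end \<open>a\<close> of the edge the coordinates in \<open>e\<close> and
    in \<open>F\<close> are both 0, so the two integer offsets agree.\<close>
  have base: "n F = n e" if F: "F \<in> C" and e: "e \<in> c" "e \<subseteq> F" for F e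
  proof -
    obtain a where a: "e = closed_segment a (a + w)" using class_segment[OF c e(1)] by blast
    have eC: "e \<in> C" using edge_cell[OF class_edges[OF c(1) e(1)]] .
    have he: "has_edge c e" "has_edge c F" using e unfolding has_edge_def by blast+
    have m: "a \<in> e" "a + w \<in> e" using a by auto
    have "\<tau> e a = 0" using \<tau>_bottom[OF eC he(1) m] .
    moreover have "\<tau> F a = 0" using \<tau>_bottom[OF F he(2)] m e(2) by blast
    ultimately show ?thesis using n[OF eC m(1)] n[OF F, of a] m(1) e(2) by auto
  qed
  obtain e0 where e0: "e0 \<in> c" using class_nonempty[OF c(1)] by blast
  have same: "n e = n e0" if "e \<in> c" for e
  proof -
    have "(e0, e) \<in> (linked C)\<^sup>*" using class_connected[OF c(1) e0 that] .
    then have "e \<in> c \<and> n e = n e0"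
    proof (induction rule: rtrancl_induct)
      case base then show ?case using e0 by blast
    next
      case (step y z)
      then have z: "z \<in> c" using class_closed[OF c(1), of y z] by blast
      obtain F where "F \<in> C" "y \<subseteq> F" "z \<subseteq> F" using step(2) unfolding linked_def by blast
      then have "n y = n z" using base[of F y] base[of F z] step.IH z by metis
      then show ?case using z step.IH by simp
    qed
    then show ?thesis by blast
  qed
  \<comment> \<open>All zone cells share the offset of \<open>e0\<close>, because linked edges lie
    in a common cell; subtracting it makes \<psi> equal to the coordinate on the zone.\<close>
  define \<psi> where "\<psi> x = \<phi> x - n e0" for x
  have \<psi>_zone: "\<psi> x = \<tau> F x" if H: "F \<in> C" "has_edge c F" "x \<in> F" for F x
  proof -
    obtain e where e: "e \<in> c" "e \<subseteq> F" using H(2) unfolding has_edge_def by blast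
    have "n F = n e0" using base[OF H(1) e] same[OF e(1)] by simp
    then show ?thesis unfolding \<psi>_def using n[OF H(1,3)] by simp
  qed
  have P: "prism \<psi> w F" if F: "F \<in> C" "has_edge c F" for F
    unfolding prism_def
  proof (intro conjI ballI exI[of _ "g F"])
    show "linear (g F)" "g F w = 1" using gk[OF F] by auto
    fix x assume x: "x \<in> F"
    show "0 \<le> \<psi> x" "\<psi> x \<le> 1" "x - \<psi> x *\<^sub>R w \<in> F" "x + (1 - \<psi> x) *\<^sub>R w \<in> F"
      using \<psi>_zone[OF F x] \<tau>_range[OF F(1) x] \<tau>_ends[OF F x] by auto
    fix y assume y: "y \<in> F"
    show "\<psi> x - \<psi> y = g F (x - y)"
      unfolding \<psi>_zone[OF F x] \<psi>_zone[OF F y] using F(2) gk[OF F] by (simp add: \<tau>_def linear_diff)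
  qed
  have c\<psi>: "continuous_on (\<Union>C) \<psi>" unfolding \<psi>_def by (intro continuous_intros c\<phi>)
  have con: "connected (\<psi> ` \<Union>C)"
    using c\<psi> convex_support by (intro connected_continuous_image convex_connected)
  have vals: "0 \<le> \<psi> x \<and> \<psi> x \<le> 1 \<or> (\<exists>m::int. \<psi> x = m)" if "x \<in> \<Union>C" for x
  proof -
    obtain F where F: "F \<in> C" "x \<in> F" using \<open>x \<in> \<Union>C\<close> by blast
    show ?thesis
    proof (cases "has_edge c F")
      case True then show ?thesis using \<psi>_zone[OF F(1) True F(2)] \<tau>_range[OF F] by simp
    next
      case False
      then have "\<psi> x = of_int (n F - n e0)" unfolding \<psi>_def using n[OF F] by (simp add: \<tau>_def)
      then show ?thesis by blast
    qed
  qed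
  have e0C: "e0 \<in> C" using edge_cell[OF class_edges[OF c(1) e0]] .
  obtain a0 where a0: "e0 = closed_segment a0 (a0 + w)" using class_segment[OF c e0] by blast
  have he0: "has_edge c e0" using e0 unfolding has_edge_def by blast
  have z0: "\<psi> a0 = 0" using \<psi>_zone[OF e0C he0, of a0] \<tau>_bottom[OF e0C he0, of a0] a0 by simp
  have a0C: "a0 \<in> \<Union>C" using e0C a0 by auto
  \<comment> \<open>Outside [0,1] only integer values occur. Since \<psi> is 0 at \<open>a0\<close>
    and the image is connected, a value at most -1 or at least 2 would produce the value -1/2 or
    3/2.\<close>
  have range: "0 \<le> \<psi> x \<and> \<psi> x \<le> 1" if x: "x \<in> \<Union>C" for x
  proof (rule ccontr)
    assume ne: "\<not> ?thesis"
    then obtain m :: int where m: "\<psi> x = m" using vals[OF x] by blast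
    have hit: "y \<in> \<psi> ` \<Union>C" if "min 0 (\<psi> x) \<le> y" "y \<le> max 0 (\<psi> x)" for y
    proof -
      have "{min 0 (\<psi> x)..max 0 (\<psi> x)} \<subseteq> \<psi> ` \<Union>C"
        using x a0C z0 by (intro connected_contains_Icc[OF con]) (auto simp: min_def max_def image_iff simp del: Union_iff intro: bexI[of _ x] bexI[of _ a0])
      then show ?thesis using that by auto
    qed
    have no_half: "r \<notin> \<psi> ` \<Union>C" if r: "\<not> (0 \<le> r \<and> r \<le> 1)" "r = 3/2 \<or> r = - 1/2" for r
    proof
      assume "r \<in> \<psi> ` \<Union>C"
      then obtain y where "y \<in> \<Union>C" "\<psi> y = r" by blast
      then obtain m :: int where "r = m" using vals[of y] r(1) by auto
      then have "real_of_int (2 * m) = real_of_int 3 \<or> real_of_int (2 * m) = real_of_int (- 1)" using r(2) by auto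
      then have "2 * m = 3 \<or> 2 * m = - 1" by (simp only: of_int_eq_iff)
      then show False by presburger
    qed
    have "\<not> (0 \<le> m \<and> m \<le> 1)" using ne m by simp
    then have "m \<le> - 1 \<or> m \<ge> 2" by linarith
    then show False
    proof
      assume "m \<le> - 1"
      then have "\<psi> x \<le> - 1" using m by simp
      then show False using hit[of "- 1/2"] no_half[of "- 1/2"] by simp
    next
      assume "m \<ge> 2"
      then have "\<psi> x \<ge> 2" using m by simp
      then show False using hit[of "3/2"] no_half[of "3/2"] by simp
    qed
  qed
  have N: "(\<forall>x\<in>F. \<psi> x = 0) \<or> (\<forall>x\<in>F. \<psi> x = 1)" if F: "F \<in> C" "\<not> has_edge c F" for F
  proof -
    have e: "\<psi> x = of_int (n F - n e0)" if "x \<in> F" for x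
      unfolding \<psi>_def using n[OF F(1) that] F(2) by (simp add: \<tau>_def)
    obtain x where x: "x \<in> F" using cell_nonempty[OF F(1)] by blast
    have "0 \<le> real_of_int (n F - n e0) \<and> real_of_int (n F - n e0) \<le> 1" using range[of x] e[OF x] x F(1) by auto
    then have "n F - n e0 = 0 \<or> n F - n e0 = 1" by linarith
    then show ?thesis using e by (metis of_int_0 of_int_1)
  qed
  show ?thesis
  proof (rule that)
    show "potential C w \<psi>" unfolding potential_def using c\<psi> P N by blast
  qed (use P N in blast)+
qed

lemma class_zone_potential:
  assumes c: "c \<in> edge_classes C" "edge_vector c w"
  obtains \<psi> where "zone_potential C w \<psi>" "\<And>F. F \<in> C \<Longrightarrow> has_edge c F \<longleftrightarrow> prism \<psi> w F"
proof -
  obtain \<psi> where \<psi>: "potential C w \<psi>" "\<And>F. F \<in> C \<Longrightarrow> has_edge c F \<Longrightarrow> prism \<psi> w F"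
    "\<And>F. F \<in> C \<Longrightarrow> \<not> has_edge c F \<Longrightarrow> (\<forall>x\<in>F. \<psi> x = 0) \<or> (\<forall>x\<in>F. \<psi> x = 1)"
    using class_potential[OF c] by metis
  obtain e where e: "e \<in> c" using class_nonempty[OF c(1)] by blast
  have "prism \<psi> w e" using \<psi>(2)[OF edge_cell[OF class_edges[OF c(1) e]]] e unfolding has_edge_def by blast
  then have z: "zone_potential C w \<psi>"
    using \<psi>(1) cubical_axioms edge_cell[OF class_edges[OF c(1) e]]
    by (auto simp: zone_potential_def zone_potential_axioms_def)
  have "\<not> prism \<psi> w F" if F: "F \<in> C" "\<not> has_edge c F" for F
  proof
    assume p: "prism \<psi> w F"
    obtain x where x: "x \<in> F" using cell_nonempty[OF F(1)] by blast
    have "\<psi> (x + (0 - \<psi> x) *\<^sub>R w) = 0" "\<psi> (x + (1 - \<psi> x) *\<^sub>R w) = 1"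
      "x + (0 - \<psi> x) *\<^sub>R w \<in> F" "x + (1 - \<psi> x) *\<^sub>R w \<in> F"
      using prism_slide[OF p cell_convex[OF F(1)] x, of 0] prism_slide[OF p cell_convex[OF F(1)] x, of 1] by auto
    then show False using \<psi>(3)[OF F] by (metis zero_neq_one)
  qed
  then show ?thesis using that z \<psi>(2) by blast
qed

end

context zone_potential
begin

lemma prism_constant_contradiction:
  assumes "F \<in> C" "prism \<psi> w F" shows "\<not> (\<forall>x\<in>F. \<psi> x = 0)" "\<not> (\<forall>x\<in>F. \<psi> x = 1)"
proof -
  obtain x where x: "x \<in> F" using cell_nonempty[OF assms(1)] by blast
  have "\<psi> (x + (0 - \<psi> x) *\<^sub>R w) = 0" "\<psi> (x + (1 - \<psi> x) *\<^sub>R w) = 1"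
    "x + (0 - \<psi> x) *\<^sub>R w \<in> F" "x + (1 - \<psi> x) *\<^sub>R w \<in> F"
    using prism_slide[OF assms(2) cell_convex[OF assms(1)] x, of 0] prism_slide[OF assms(2) cell_convex[OF assms(1)] x, of 1] by auto
  then show "\<not> (\<forall>x\<in>F. \<psi> x = 0)" "\<not> (\<forall>x\<in>F. \<psi> x = 1)" by (metis zero_neq_one)+
qed

lemma prism_superset:
  assumes "F \<in> C" "G \<in> C" "prism \<psi> w F" "F \<subseteq> G" shows "prism \<psi> w G"
  using assms(2)
proof (cases rule: cell_cases)
  case 2 then show ?thesis using prism_constant_contradiction(1)[OF assms(1,3)] assms(4) by (simp add: subset_iff)
next
  case 3 then show ?thesis using prism_constant_contradiction(2)[OF assms(1,3)] assms(4) by (simp add: subset_iff)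
qed

lemma prism_of_step:
  assumes "F \<in> C" "prism \<psi> w F" "G \<in> C" "G \<subseteq> F" "p \<in> G" "p + w \<in> G" shows "prism \<psi> w G"
proof -
  have "\<psi> (p + w) = \<psi> p + 1" using prism_step[OF assms(2), of p 1] assms by auto
  with assms(3) show ?thesis by (cases rule: cell_cases) (use assms(5,6) in force)+
qed

lemma prism_bottom:
  assumes "F \<in> C" "prism \<psi> w F" "p \<in> F" "p + w \<in> F" shows "\<psi> p = 0"
proof -
  have "\<psi> (p + w) = \<psi> p + 1" using prism_step[OF assms(2), of p 1] assms by auto
  moreover have "p \<in> \<Union>C" "p + w \<in> \<Union>C" using assms by blast+
  then have "0 \<le> \<psi> p" "\<psi> (p + w) \<le> 1" using potential_range by blast+
  ultimately show ?thesis by linarith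
qed

text \<open>Sliding along \<open>w\<close> stays in the edge, so \<open>w\<close> is a multiple of
  its vector \<open>b\<close> by a factor of modulus at most 1. The potential changes by at most 1
  along \<open>b\<close> but by exactly 1 along \<open>w\<close>, so the modulus is 1.\<close>

lemma prism_edge_segment:
  assumes e: "e \<in> edges C" "prism \<psi> w e"
  obtains a where "e = closed_segment a (a + w)"
proof -
  obtain a b where b: "b \<noteq> 0" "e = closed_segment a (a + b)" using edge_form[OF e(1)] by metis
  have eC: "e \<in> C" using edge_cell[OF e(1)] .
  obtain g where g: "linear g" "g w = (1::real)" "\<forall>x\<in>e. \<forall>y\<in>e. \<psi> x - \<psi> y = g (x - y)"
    using e(2) unfolding prism_def by blast
  have ab: "a \<in> e" "a + b \<in> e" using b by auto
  have p: "a + (0 - \<psi> a) *\<^sub>R w \<in> e" "a + (1 - \<psi> a) *\<^sub>R w \<in> e"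
    using prism_slide[OF e(2) cell_convex[OF eC] ab(1), of 0] prism_slide[OF e(2) cell_convex[OF eC] ab(1), of 1] by auto
  obtain u where u: "0 \<le> u" "u \<le> 1" "a + (0 - \<psi> a) *\<^sub>R w = (1 - u) *\<^sub>R a + u *\<^sub>R (a + b)"
    using p(1)[unfolded b(2) in_segment] by blast
  obtain v where v: "0 \<le> v" "v \<le> 1" "a + (1 - \<psi> a) *\<^sub>R w = (1 - v) *\<^sub>R a + v *\<^sub>R (a + b)"
    using p(2)[unfolded b(2) in_segment] by blast
  have "w = (a + (1 - \<psi> a) *\<^sub>R w) - (a + (0 - \<psi> a) *\<^sub>R w)" by (simp add: algebra_simps)
  also have "\<dots> = (v - u) *\<^sub>R b" unfolding u(3) v(3) by (simp add: algebra_simps)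
  finally have w: "w = (v - u) *\<^sub>R b" .
  have "\<psi> (a + b) - \<psi> a = g b" using g(3) ab by force
  moreover have "0 \<le> \<psi> a" "\<psi> a \<le> 1" "0 \<le> \<psi> (a + b)" "\<psi> (a + b) \<le> 1"
    using potential_range[of a] potential_range[of "a + b"] ab eC by auto
  ultimately have gb: "\<bar>g b\<bar> \<le> 1" by linarith
  have "1 = (v - u) * g b" using g(1,2) w by (metis linear_cmul real_scaleR_def)
  then have 1: "1 = \<bar>v - u\<bar> * \<bar>g b\<bar>" by (metis abs_mult abs_one)
  have "\<bar>v - u\<bar> \<le> 1" using u v by linarith
  moreover have "\<bar>v - u\<bar> \<ge> 1" using 1 gb by (metis abs_ge_zero mult_left_le mult.commute)
  ultimately have "v - u = 1 \<or> v - u = - 1" by linarith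
  then have "w = b \<or> w = - b" using w by auto
  then show ?thesis
  proof
    assume "w = b" then show ?thesis using that b(2) by blast
  next
    assume w: "w = - b"
    then have "e = closed_segment (a + b) (a + b + w)" using b(2) by (simp add: closed_segment_commute)
    then show ?thesis using that by blast
  qed
qed

text \<open>The edges on which a potential varies form a single class: the potentials of two such
  classes both take the value 1/2 on any line parallel to \<open>w\<close>, at points where \<open>\<psi>\<close> is 1/2 as well,
  so at the same point, which then lies in a common cell of both zones.\<close>

lemma prism_edges_one_class:
  assumes d1: "d1 \<in> edge_classes C" "e1 \<in> d1" "prism \<psi> w e1"
    and d2: "d2 \<in> edge_classes C" "e2 \<in> d2" "prism \<psi> w e2"
  shows "d1 = d2"
proof -
  have half: "edge_vector d w \<and> (\<forall>x0\<in>\<Union>C. \<exists>t F. F \<in> C \<and> has_edge d F \<and> x0 + t *\<^sub>R w \<in> F \<and> \<psi> (x0 + t *\<^sub>R w) = 1/2)"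
    if d: "d \<in> edge_classes C" "e \<in> d" "prism \<psi> w e" for d e
  proof -
    have ed: "e \<in> edges C" using class_edges[OF d(1,2)] .
    obtain a where a: "e = closed_segment a (a + w)" using prism_edge_segment[OF ed d(3)] .
    have vec: "edge_vector d w" unfolding edge_vector_def using d(2) a by blast
    \<comment> \<open>Prisms propagate along links: a cell containing a prism is a prism, and so is
      every cell inside a prism that contains some \<open>q\<close> together with
      \<open>q + w\<close>.\<close>
    have all: "prism \<psi> w f" if "f \<in> d" for f
    proof -
      have "(e, f) \<in> (linked C)\<^sup>*" using class_connected[OF d(1,2) that] .
      then have "f \<in> d \<and> prism \<psi> w f"
      proof (induction rule: rtrancl_induct)
        case base then show ?case using d by blast
      next
        case (step y z)
        have z: "z \<in> d" using class_closed[OF d(1), of y z] step by blast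
        obtain F where F: "F \<in> C" "y \<subseteq> F" "z \<subseteq> F" "y \<in> edges C" "z \<in> edges C" using step(2) unfolding linked_def by blast
        have pF: "prism \<psi> w F" using prism_superset[OF edge_cell[OF F(4)] F(1) _ F(2)] step.IH by blast
        obtain q where "z = closed_segment q (q + w)" using class_segment[OF d(1) vec z] by blast
        then have "prism \<psi> w z" by (intro prism_of_step[OF F(1) pF edge_cell[OF F(5)] F(3), of q]) auto
        then show ?case using z by blast
      qed
      then show ?thesis by blast
    qed
    obtain \<phi> where \<phi>: "zone_potential C w \<phi>" "\<And>F. F \<in> C \<Longrightarrow> has_edge d F \<longleftrightarrow> prism \<phi> w F"
      using class_zone_potential[OF d(1) vec] by metis
    interpret z: zone_potential C w \<phi> by (rule \<phi>(1))
    have "\<exists>t F. F \<in> C \<and> has_edge d F \<and> x0 + t *\<^sub>R w \<in> F \<and> \<psi> (x0 + t *\<^sub>R w) = 1/2" if x0: "x0 \<in> \<Union>C" for x0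
    proof -
      obtain t where t: "x0 + t *\<^sub>R w \<in> \<Union>C" "\<phi> (x0 + t *\<^sub>R w) = 1/2" using z.line_value[OF x0, of "1/2"] by auto
      define y where "y = x0 + t *\<^sub>R w"
      obtain F where F: "F \<in> C" "y \<in> F" using t(1) y_def by blast
      have p\<phi>: "prism \<phi> w F" using z.interior_prism[OF F] t(2) y_def by simp
      then have h: "has_edge d F" using \<phi>(2)[OF F(1)] by blast
      then obtain f where f: "f \<in> d" "f \<subseteq> F" unfolding has_edge_def by blast
      have p\<psi>: "prism \<psi> w F" using prism_superset[OF edge_cell[OF class_edges[OF d(1) f(1)]] F(1) all[OF f(1)] f(2)] .
      \<comment> \<open>\<open>p\<close> and \<open>p + w\<close> both lie in \<open>F\<close>, a
        prism for both potentials, so each of them is 0 at \<open>p\<close> and 1/2 at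
        \<open>y\<close>.\<close>
      define p where "p = y - (1/2) *\<^sub>R w"
      have "y + (0 - \<phi> y) *\<^sub>R w \<in> F" "y + (1 - \<phi> y) *\<^sub>R w \<in> F"
        using prism_slide(1)[OF p\<phi> cell_convex[OF F(1)] F(2), of 0] prism_slide(1)[OF p\<phi> cell_convex[OF F(1)] F(2), of 1] by auto
      moreover have "w - (1/2) *\<^sub>R w = (1 - 1/2) *\<^sub>R w" by (simp only: scaleR_left_diff_distrib scaleR_one)
      then have pw: "p + w = y + (1/2) *\<^sub>R w" by (simp add: p_def)
      ultimately have "p \<in> F" "p + w \<in> F" using t(2) unfolding pw unfolding p_def y_def[symmetric] by simp_all
      then have "\<psi> p = 0" using prism_bottom[OF F(1) p\<psi>] by blast
      moreover have "p + (1/2) *\<^sub>R w = y" by (simp add: p_def)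
      ultimately have "\<psi> y = 1/2" using prism_step[OF p\<psi> \<open>p \<in> F\<close>, of "1/2"] F(2) by simp
      then show ?thesis using F h unfolding y_def by blast
    qed
    then show ?thesis using vec by blast
  qed
  obtain x0 where x0: "x0 \<in> \<Union>C" using nonempty cell_nonempty by blast
  note h1 = half[OF d1] and h2 = half[OF d2]
  obtain t1 F1 where 1: "F1 \<in> C" "has_edge d1 F1" "x0 + t1 *\<^sub>R w \<in> F1" "\<psi> (x0 + t1 *\<^sub>R w) = 1/2" using h1 x0 by blast
  obtain t2 F2 where 2: "F2 \<in> C" "has_edge d2 F2" "x0 + t2 *\<^sub>R w \<in> F2" "\<psi> (x0 + t2 *\<^sub>R w) = 1/2" using h2 x0 by blast
  have tt: "x0 + t1 *\<^sub>R w + (t2 - t1) *\<^sub>R w = x0 + t2 *\<^sub>R w" by (simp add: algebra_simps)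
  have "t2 - t1 = 0"
  proof (rule line_value_unique[of "x0 + t1 *\<^sub>R w"])
    show "x0 + t1 *\<^sub>R w \<in> \<Union>C" "0 < \<psi> (x0 + t1 *\<^sub>R w)" "\<psi> (x0 + t1 *\<^sub>R w) < 1" using 1 by auto
    show "x0 + t1 *\<^sub>R w + (t2 - t1) *\<^sub>R w \<in> \<Union>C" unfolding tt using 2 by auto
    show "\<psi> (x0 + t1 *\<^sub>R w + (t2 - t1) *\<^sub>R w) = \<psi> (x0 + t1 *\<^sub>R w)" unfolding tt using 1 2 by simp
  qed
  then have teq: "t2 = t1" by simp
  define y where "y = x0 + t1 *\<^sub>R w"
  define H where "H = F1 \<inter> F2"
  have yH: "y \<in> H" "\<psi> y = 1/2" using 1 2 teq by (auto simp: y_def H_def)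
  have fH: "H face_of F1" "H face_of F2" using cell_Int[OF 1(1) 2(1)] cell_Int[OF 2(1) 1(1)] by (auto simp: H_def Int_commute)
  have HC: "H \<in> C" using cell_face[OF 1(1) fH(1)] yH by blast
  have pH: "prism \<psi> w H" using interior_prism[OF HC yH(1)] yH(2) by simp
  define p where "p = y + (0 - \<psi> y) *\<^sub>R w"
  have "p \<in> H" "p + w \<in> H"
    using prism_slide(1)[OF pH cell_convex[OF HC] yH(1), of 0] prism_slide(1)[OF pH cell_convex[OF HC] yH(1), of 1]
    by (auto simp: p_def algebra_simps)
  then have he: "has_edge d1 H" "has_edge d2 H"
    using has_edge_face[OF d1(1) _ 1(1,2) fH(1)] has_edge_face[OF d2(1) _ 2(1,2) fH(2)] h1 h2 by blast+
  obtain f where f: "f \<in> d2" "f \<subseteq> H" using he(2) unfolding has_edge_def by blast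
  obtain q where q: "f = closed_segment q (q + w)" using class_segment[OF d2(1) _ f(1)] h2 by blast
  have "f \<in> d1" using class_parallel[OF d1(1) _ HC he(1) class_edges[OF d2(1) f(1)] f(2) q] h1 by blast
  then show ?thesis using class_eq[OF d1(1) d2(1)] f(1) by blast
qed

end

section \<open>Shrinking a zone\<close>

text \<open>The common frame for shrinking and projecting. \<open>\<rho>\<close> relates surviving
  edges to their images; it is partial and several edges may share an image, so only the induced map
  on classes is a bijection. \<open>E\<close> lists the surviving classes, and \<open>L\<close> says
  what becomes of their vectors.\<close>

lemma class_bijection:
  assumes "cubical C" "cubical C'" and E: "E \<subseteq> edge_classes C"
    and dom: "\<And>e e'. \<rho> e e' \<Longrightarrow> e \<in> edges C \<and> e' \<in> edges C'"
    and inE: "\<And>d e e'. \<rho> e e' \<Longrightarrow> d \<in> edge_classes C \<Longrightarrow> e \<in> d \<Longrightarrow> d \<in> E"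
    and sur: "\<And>e'. e' \<in> edges C' \<Longrightarrow> \<exists>e. \<rho> e e'"
    and ex: "\<And>d. d \<in> E \<Longrightarrow> \<exists>e\<in>d. \<exists>e'. \<rho> e e'"
    and iff: "\<And>e e' f f'. \<rho> e e' \<Longrightarrow> \<rho> f f' \<Longrightarrow> (e, f) \<in> (linked C)\<^sup>* \<longleftrightarrow> (e', f') \<in> (linked C')\<^sup>*"
    and vec: "\<And>e e' a u. \<rho> e e' \<Longrightarrow> e = closed_segment a (a + u) \<Longrightarrow> \<exists>a'. e' = closed_segment a' (a' + L u)"
  shows "\<exists>h. bij_betw h E (edge_classes C') \<and> (\<forall>d\<in>E. \<forall>u. edge_vector d u \<longrightarrow> edge_vector (h d) (L u))"
proof -
  interpret C: cubical C by fact
  interpret C': cubical C' by fact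
  have "\<exists>e e' k. e \<in> d \<and> \<rho> e e' \<and> k \<in> edge_classes C' \<and> e' \<in> k" if "d \<in> E" for d
    using ex[OF that] dom C'.class_exists by metis
  then obtain p q h where pqh: "\<And>d. d \<in> E \<Longrightarrow> p d \<in> d \<and> \<rho> (p d) (q d) \<and> h d \<in> edge_classes C' \<and> q d \<in> h d"
    by metis
  have "inj_on h E"
  proof (rule inj_onI)
    fix d1 d2 assume d: "d1 \<in> E" "d2 \<in> E" "h d1 = h d2"
    have "(q d1, q d2) \<in> (linked C')\<^sup>*" using C'.class_connected pqh d by metis
    then have "(p d1, p d2) \<in> (linked C)\<^sup>*" using iff pqh d by blast
    then have "p d2 \<in> d1" using C.class_closed pqh d E by blast
    then show "d1 = d2" using C.class_eq pqh d E by blast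
  qed
  moreover have "h ` E = edge_classes C'"
  proof
    show "h ` E \<subseteq> edge_classes C'" using pqh by blast
    show "edge_classes C' \<subseteq> h ` E"
    proof
      fix k assume k: "k \<in> edge_classes C'"
      obtain e' where e': "e' \<in> k" using C'.class_nonempty[OF k] by blast
      obtain e where e: "\<rho> e e'" using sur[OF C'.class_edges[OF k e']] by blast
      obtain d where d: "d \<in> edge_classes C" "e \<in> d" using C.class_exists dom[OF e] by blast
      have dE: "d \<in> E" using inE[OF e d] .
      have "(e, p d) \<in> (linked C)\<^sup>*" using C.class_connected[OF d] pqh[OF dE] by blast
      then have "(e', q d) \<in> (linked C')\<^sup>*" using iff[OF e, of "p d" "q d"] pqh[OF dE] by blast
      then have "q d \<in> k" using C'.class_closed[OF k e'] by blast
      then have "h d = k" using C'.class_eq[OF _ k] pqh[OF dE] by blast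
      then show "k \<in> h ` E" using dE by blast
    qed
  qed
  moreover have "edge_vector (h d) (L u)" if d: "d \<in> E" "edge_vector d u" for d u
  proof -
    obtain a where "p d = closed_segment a (a + u)" using C.class_segment[of d u "p d"] d pqh E by blast
    then show ?thesis using vec[of "p d" "q d" a u] pqh[OF d(1)] unfolding edge_vector_def by blast
  qed
  ultimately show ?thesis unfolding bij_betw_def by blast
qed

text \<open>One of the covering faces contains a relative interior point of \<open>S\<close> and
  therefore all of \<open>S\<close>. This reduces a global face condition to a check at each
  point.\<close>

lemma face_of_Union_convex:
  fixes S :: "'a::euclidean_space set"
  assumes "convex S" "S \<subseteq> F" and cover: "\<And>x. x \<in> S \<Longrightarrow> \<exists>A. A face_of F \<and> x \<in> A \<and> A \<subseteq> S"
  shows "S face_of F"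
proof (cases "S = {}")
  case False
  then obtain x where x: "x \<in> rel_interior S" using assms(1) rel_interior_eq_empty by blast
  then obtain A where A: "A face_of F" "x \<in> A" "A \<subseteq> S" using cover rel_interior_subset by blast
  have "S \<subseteq> A" using subset_of_face_of[OF A(1) assms(2)] A(2) x by blast
  then show ?thesis using A by (metis subset_antisym)
qed simp

lemma prism_affine:
  assumes p: "prism \<psi> w F" and F: "convex F" "a \<in> F" "b \<in> F" and u: "0 \<le> u" "u \<le> 1"
  shows "\<psi> ((1 - u) *\<^sub>R a + u *\<^sub>R b) = (1 - u) * \<psi> a + u * \<psi> b"
proof -
  obtain g where g: "linear g" "\<forall>x\<in>F. \<forall>y\<in>F. \<psi> x - \<psi> y = g (x - y)"
    using p unfolding prism_def by blast
  let ?x = "(1 - u) *\<^sub>R a + u *\<^sub>R b"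
  have "?x \<in> F" using convexD_alt[OF F u] .
  then have "\<psi> ?x - \<psi> a = g (?x - a)" "\<psi> b - \<psi> a = g (b - a)" using g(2) F by blast+
  moreover have "?x - a = u *\<^sub>R (b - a)" by (simp add: algebra_simps)
  ultimately have "\<psi> ?x - \<psi> a = u * (\<psi> b - \<psi> a)" using g(1) by (simp add: linear_cmul)
  then show ?thesis by (simp add: algebra_simps)
qed

text \<open>The coordinate is affine on the prism with 0 and 1 as bounds, and points where an affine
  function attains a bound form a face.\<close>

lemma prism_level_face:
  fixes F :: "'a::euclidean_space set"
  assumes p: "prism \<psi> w F" and F: "convex F" and v: "v = 0 \<or> v = 1"
  shows "{x\<in>F. \<psi> x = v} face_of F"
  unfolding face_of_def
proof (intro conjI ballI impI)
  have r: "0 \<le> \<psi> x \<and> \<psi> x \<le> 1" if "x \<in> F" for x using p that unfolding prism_def by blast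
  show "convex {x\<in>F. \<psi> x = v}"
    unfolding convex_alt
  proof (intro ballI allI impI)
    fix u :: real and x y assume xy: "x \<in> {x\<in>F. \<psi> x = v}" "y \<in> {x\<in>F. \<psi> x = v}" and u: "0 \<le> u \<and> u \<le> 1"
    have "\<psi> ((1 - u) *\<^sub>R x + u *\<^sub>R y) = (1 - u) * v + u * v" using prism_affine[OF p F, of x y u] xy u by simp
    then show "(1 - u) *\<^sub>R x + u *\<^sub>R y \<in> {x\<in>F. \<psi> x = v}"
      using convexD_alt[OF F, of x y u] xy u by (simp add: algebra_simps)
  qed
  have key: "\<psi> a = v" if a: "a \<in> F" "b \<in> F" and u: "0 < u" "u < 1" "\<psi> ((1 - u) *\<^sub>R a + u *\<^sub>R b) = v" for a b u
  proof -
    have e: "(1 - u) * \<psi> a + u * \<psi> b = v" using prism_affine[OF p F a, of u] u by simp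
    show ?thesis
    proof (cases "v = 0")
      case True
      have "0 \<le> (1 - u) * \<psi> a" "0 \<le> u * \<psi> b" using r a u by auto
      then have "(1 - u) * \<psi> a = 0" using e True by linarith
      then show ?thesis using u True by simp
    next
      case False
      then have v1: "v = 1" using v by simp
      have "0 \<le> (1 - u) * (1 - \<psi> a)" "0 \<le> u * (1 - \<psi> b)" using r a u by auto
      moreover have "(1 - u) * (1 - \<psi> a) + u * (1 - \<psi> b) = 0" using e v1 by (simp add: algebra_simps)
      ultimately have "(1 - u) * (1 - \<psi> a) = 0" by linarith
      then show ?thesis using u v1 by simp
    qed
  qed
  fix a b x assume ab: "a \<in> F" "b \<in> F" and x: "x \<in> {x\<in>F. \<psi> x = v}" "x \<in> open_segment a b"
  obtain u where u: "0 < u" "u < 1" "x = (1 - u) *\<^sub>R a + u *\<^sub>R b" using x(2) unfolding in_segment by blast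
  show "a \<in> {x\<in>F. \<psi> x = v}" using key[OF ab u(1,2)] u x ab by simp
  have "x = (1 - (1 - u)) *\<^sub>R b + (1 - u) *\<^sub>R a" using u(3) by (simp add: add.commute)
  then show "b \<in> {x\<in>F. \<psi> x = v}" using key[OF ab(2,1), of "1 - u"] u(1,2) x(1) ab(2) by simp
qed auto

locale zone_class = zone_potential C w \<psi> for C :: "'a::euclidean_space set set" and w \<psi> +
  fixes c :: "'a set set"
  assumes cls: "c \<in> edge_classes C" "edge_vector c w"
    and has_edge_iff: "\<And>F. F \<in> C \<Longrightarrow> has_edge c F \<longleftrightarrow> prism \<psi> w F"
begin

lemma edge_in_class_iff: "e \<in> edges C \<Longrightarrow> e \<in> c \<longleftrightarrow> prism \<psi> w e"
  using has_edge_iff[OF edge_cell] edge_has_edge[OF cls(1)] unfolding has_edge_def by blast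

lemma cell_in_tile: assumes "F \<in> C" obtains T where "T \<in> tiles C" "F \<subseteq> T"
proof -
  obtain T where "T \<in> C" "F \<subseteq> T" "\<forall>G\<in>C. T \<subseteq> G \<longrightarrow> T = G"
    using finite_has_maximal2[OF finite_C assms] by blast
  then show ?thesis using that unfolding tiles_def by blast
qed

lemma Union_zone: "\<Union>(zone C c) = \<Union>{F\<in>C. prism \<psi> w F}"
proof
  show "\<Union>(zone C c) \<subseteq> \<Union>{F\<in>C. prism \<psi> w F}"
    unfolding zone_def tiles_def using has_edge_iff unfolding has_edge_def by blast
  show "\<Union>{F\<in>C. prism \<psi> w F} \<subseteq> \<Union>(zone C c)"
  proof
    fix x assume "x \<in> \<Union>{F\<in>C. prism \<psi> w F}"
    then obtain F where F: "F \<in> C" "prism \<psi> w F" "x \<in> F" by blast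
    obtain T where T: "T \<in> tiles C" "F \<subseteq> T" using cell_in_tile[OF F(1)] .
    have "has_edge c T" using has_edge_iff[OF F(1)] F(2) T(2) has_edge_mono by blast
    then show "x \<in> \<Union>(zone C c)" using T F(3) unfolding zone_def has_edge_def by blast
  qed
qed

definition shift :: "'a \<Rightarrow> 'a" where "shift x = x - \<psi> x *\<^sub>R w"

lemma shift_bottom: "(\<And>x. x \<in> F \<Longrightarrow> \<psi> x = 0) \<Longrightarrow> shift ` F = F"
  unfolding shift_def by (auto simp: image_iff)

lemma shift_top: "(\<And>x. x \<in> F \<Longrightarrow> \<psi> x = 1) \<Longrightarrow> shift ` F = (+) (- w) ` F"
  unfolding shift_def by (auto simp: image_iff)

lemma nonprism_cases:
  assumes "F \<in> C" "\<not> prism \<psi> w F"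
  obtains "\<And>x. x \<in> F \<Longrightarrow> \<psi> x = 0" "shift ` F = F" | "\<And>x. x \<in> F \<Longrightarrow> \<psi> x = 1" "shift ` F = (+) (- w) ` F"
  using assms(1)
proof (cases rule: cell_cases)
  case 1 then show ?thesis using assms(2) by simp
next
  case 2 show ?thesis by (rule that(1)[OF 2 shift_bottom[OF 2]])
next
  case 3 show ?thesis by (rule that(2)[OF 3 shift_top[OF 3]])
qed

lemma constant_not_prism: "F \<in> C \<Longrightarrow> (\<And>x. x \<in> F \<Longrightarrow> \<psi> x = v) \<Longrightarrow> v = 0 \<or> v = 1 \<Longrightarrow> \<not> prism \<psi> w F"
  using prism_constant_contradiction by blast

text \<open>A point past a zone point by at least \<open>w\<close> is past the top of a prism, and
  monotonicity gives the value 1. Conversely the line through \<open>x\<close> runs through a prism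
  before \<open>x\<close>, and climbing from 0 at its bottom to 1 at \<open>x\<close> takes length
  at least 1.\<close>

lemma beyond_zone_iff:
  assumes F: "F \<in> C" "\<not> prism \<psi> w F"
  shows "F \<subseteq> beyond_zone C c w \<longleftrightarrow> (\<forall>x\<in>F. \<psi> x = 1)"
proof
  assume sub: "F \<subseteq> beyond_zone C c w"
  show "\<forall>x\<in>F. \<psi> x = 1"
  proof
    fix x assume x: "x \<in> F"
    then obtain z t where z: "x = z + t *\<^sub>R w" "z \<in> \<Union>(zone C c)" "1 \<le> t" using sub unfolding beyond_zone_def by blast
    obtain H where H: "H \<in> C" "prism \<psi> w H" "z \<in> H" using z(2) unfolding Union_zone by blast
    define y where "y = z + (1 - \<psi> z) *\<^sub>R w"
    have y: "y \<in> H" "\<psi> y = 1" using prism_slide[OF H(2) cell_convex[OF H(1)] H(3), of 1] by (auto simp: y_def)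
    have zr: "0 \<le> \<psi> z" using potential_range(1)[of z] H by blast
    have e: "x = y + (t - 1 + \<psi> z) *\<^sub>R w" unfolding z(1) y_def by (simp add: algebra_simps)
    have "\<psi> y \<le> \<psi> (y + (t - 1 + \<psi> z) *\<^sub>R w)"
      by (rule slope(1)) (use y H F x e z(3) zr in auto)
    then show "\<psi> x = 1" using e y potential_range(2)[of x] x F(1) by (metis UnionI order_antisym)
  qed
next
  assume top: "\<forall>x\<in>F. \<psi> x = 1"
  show "F \<subseteq> beyond_zone C c w"
  proof
    fix x assume x: "x \<in> F"
    have xC: "x \<in> \<Union>C" using x F by blast
    obtain t where t: "x + t *\<^sub>R w \<in> \<Union>C" "\<psi> (x + t *\<^sub>R w) = 1/2" using line_value[OF xC, of "1/2"] by auto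
    define y where "y = x + t *\<^sub>R w"
    have "t < 0"
    proof (rule ccontr)
      assume "\<not> t < 0"
      then show False using slope(1)[OF xC t(1)] t(2) top x by simp
    qed
    obtain H where H: "H \<in> C" "y \<in> H" using t(1) y_def by blast
    have p: "prism \<psi> w H" using interior_prism[OF H] t(2) y_def by simp
    define z where "z = y + (0 - \<psi> y) *\<^sub>R w"
    have z: "z \<in> H" "\<psi> z = 0" using prism_slide[OF p cell_convex[OF H(1)] H(2), of 0] by (auto simp: z_def)
    have e: "x = z + (1/2 - t) *\<^sub>R w" unfolding z_def using t(2) by (simp add: y_def algebra_simps)
    have "\<psi> (z + (1/2 - t) *\<^sub>R w) \<le> \<psi> z + (1/2 - t)"
      by (rule slope(2)) (use z H xC e \<open>t < 0\<close> in auto)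
    then have "1 \<le> 1/2 - t" using e z top x by simp
    then show "x \<in> beyond_zone C c w" unfolding beyond_zone_def Union_zone using e H(1) p z(1) by blast
  qed
qed

lemma prism_bottom_face:
  assumes F: "F \<in> C" "prism \<psi> w F"
  shows "{x\<in>F. \<psi> x = 0} \<in> C" "shift ` F = {x\<in>F. \<psi> x = 0}"
proof -
  have sh: "shift x \<in> F" "\<psi> (shift x) = 0" if "x \<in> F" for x
    using prism_slide[OF F(2) cell_convex[OF F(1)] that, of 0] by (auto simp: shift_def)
  obtain x where "x \<in> F" using cell_nonempty[OF F(1)] by blast
  then have "{x\<in>F. \<psi> x = 0} \<noteq> {}" using sh by blast
  then show "{x\<in>F. \<psi> x = 0} \<in> C"
    using cell_face[OF F(1) prism_level_face[OF F(2) cell_convex[OF F(1)]]] by simp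
  show "shift ` F = {x\<in>F. \<psi> x = 0}"
  proof
    show "shift ` F \<subseteq> {x\<in>F. \<psi> x = 0}" using sh by blast
    show "{x\<in>F. \<psi> x = 0} \<subseteq> shift ` F"
    proof
      fix x assume "x \<in> {x\<in>F. \<psi> x = 0}"
      then have "x = shift x" "x \<in> F" by (auto simp: shift_def)
      then show "x \<in> shift ` F" by (rule image_eqI)
    qed
  qed
qed

text \<open>Zone cells are mapped as well: a prism has the same image as its bottom face, so this
  adds no cells, and the union is simply the image of the support under
  \<open>shift\<close>.\<close>

definition shrunk :: "'a set set" where "shrunk = (\<lambda>F. shift ` F) ` C"

lemma shrunkE:
  assumes "G \<in> shrunk" obtains F where "F \<in> C" "\<not> prism \<psi> w F" "G = shift ` F"
proof -
  obtain F where F: "F \<in> C" "G = shift ` F" using assms unfolding shrunk_def by blast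
  show ?thesis
  proof (cases "prism \<psi> w F")
    case True
    define B where "B = {x\<in>F. \<psi> x = 0}"
    have B: "B \<in> C" "shift ` F = B" using prism_bottom_face[OF F(1) True] by (auto simp: B_def)
    have "\<not> prism \<psi> w B" by (rule constant_not_prism[OF B(1), of 0]) (auto simp: B_def)
    moreover have "shift ` B = B" by (rule shift_bottom) (auto simp: B_def)
    ultimately show ?thesis using that[OF B(1)] B(2) F(2) by simp
  qed (use that F in blast)
qed

lemma shrink_eq: "shrink C c w = shrunk"
proof -
  have 1: "(if F \<subseteq> beyond_zone C c w then (+) (- w) ` F else F) = shift ` F"
    if F: "F \<in> C" "\<not> prism \<psi> w F" for F
  proof (cases rule: nonprism_cases[OF F])
    case 1
    have "\<not> F \<subseteq> beyond_zone C c w" using beyond_zone_iff[OF F] 1 cell_nonempty[OF F(1)] by force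
    then show ?thesis using 1 by simp
  next
    case 2
    have "F \<subseteq> beyond_zone C c w" using beyond_zone_iff[OF F] 2 by blast
    then show ?thesis using 2 by simp
  qed
  have 2: "{F \<in> C. \<not> (\<exists>e\<in>c. e \<subseteq> F)} = {F\<in>C. \<not> prism \<psi> w F}"
    using has_edge_iff unfolding has_edge_def by blast
  have "shrink C c w = (\<lambda>F. shift ` F) ` {F\<in>C. \<not> prism \<psi> w F}"
    unfolding shrink_def 2 by (rule image_cong[OF refl]) (use 1 in blast)
  also have "\<dots> = shrunk"
  proof
    show "(\<lambda>F. shift ` F) ` {F\<in>C. \<not> prism \<psi> w F} \<subseteq> shrunk" unfolding shrunk_def by blast
    show "shrunk \<subseteq> (\<lambda>F. shift ` F) ` {F\<in>C. \<not> prism \<psi> w F}" by (rule subsetI, erule shrunkE) blast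
  qed
  finally show ?thesis .
qed

lemma Union_shrunk: "\<Union>shrunk = {x. x \<in> \<Union>C \<and> x + w \<in> \<Union>C}"
proof -
  have "\<Union>shrunk = shift ` \<Union>C" unfolding shrunk_def by blast
  also have "\<dots> = {x. x \<in> \<Union>C \<and> x + w \<in> \<Union>C}"
  proof (intro equalityI subsetI)
    fix y assume "y \<in> shift ` \<Union>C"
    then obtain F where F: "F \<in> C" "y \<in> shift ` F" by blast
    then have "shift ` F \<in> shrunk" unfolding shrunk_def by blast
    then obtain G where G: "G \<in> C" "\<not> prism \<psi> w G" "shift ` F = shift ` G" using shrunkE by metis
    have yG: "y \<in> shift ` G" using F G by simp
    show "y \<in> {x. x \<in> \<Union>C \<and> x + w \<in> \<Union>C}"
    proof (cases rule: nonprism_cases[OF G(1,2)])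
      case 1
      then have "y \<in> G" "\<psi> y = 0" using yG by auto
      then show ?thesis using bottom_shift[of y] G(1) by blast
    next
      case 2
      then obtain x where "x \<in> G" "y = - w + x" "\<psi> x = 1" using yG by blast
      then show ?thesis using top_shift[of x] G(1) by auto
    qed
  next
    fix x assume "x \<in> {x. x \<in> \<Union>C \<and> x + w \<in> \<Union>C}"
    then have x: "x \<in> \<Union>C" "x + w \<in> \<Union>C" by auto
    show "x \<in> shift ` \<Union>C"
    proof (cases "\<psi> x = 0")
      case True
      then have "x = shift x" by (simp add: shift_def)
      then show ?thesis using x(1) by (rule image_eqI)
    next
      case False
      then have p: "0 < \<psi> x" using potential_range(1)[OF x(1)] by simp
      \<comment> \<open>From a positive value the top level is reached no later than
        \<open>x + w\<close>, and the potential does not decrease afterwards.\<close>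
      have "\<psi> (x + w) = 1"
      proof -
        have "\<exists>y s. 0 \<le> s \<and> y \<in> \<Union>C \<and> \<psi> y = 1 \<and> x + w = y + s *\<^sub>R w"
        proof (cases "\<psi> x = 1")
          case True then show ?thesis using x by (intro exI[of _ x] exI[of _ 1]) simp
        next
          case False
          then have l: "\<psi> x < 1" using potential_range(2)[OF x(1)] by simp
          obtain H where H: "H \<in> C" "x \<in> H" using x(1) by blast
          note pr = interior_prism[OF H p l]
          have "x + (1 - \<psi> x) *\<^sub>R w \<in> H" "\<psi> (x + (1 - \<psi> x) *\<^sub>R w) = 1"
            using prism_slide[OF pr cell_convex[OF H(1)] H(2), of 1] by auto
          then show ?thesis using H(1) p
            by (intro exI[of _ "x + (1 - \<psi> x) *\<^sub>R w"] exI[of _ "\<psi> x"]) (auto simp: algebra_simps)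
        qed
        then obtain y s where y: "0 \<le> s" "y \<in> \<Union>C" "\<psi> y = 1" "x + w = y + s *\<^sub>R w" by blast
        have "\<psi> y \<le> \<psi> (y + s *\<^sub>R w)" using slope(1)[OF y(2) _ y(1)] x(2) y(4) by simp
        then show ?thesis using y potential_range(2)[OF x(2)] by simp
      qed
      then have "x = shift (x + w)" by (simp add: shift_def)
      then show ?thesis using x(2) by (rule image_eqI)
    qed
  qed
  finally show ?thesis .
qed

lemma convex_Union_shrunk: "convex (\<Union>shrunk)"
proof -
  have "{x. x \<in> \<Union>C \<and> x + w \<in> \<Union>C} = \<Union>C \<inter> (+) (- w) ` \<Union>C"
    by (auto simp: image_iff) (metis add.commute diff_add_cancel uminus_add_conv_diff add_minus_cancel minus_add_cancel)+
  then show ?thesis unfolding Union_shrunk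
    using convex_support by (metis convex_Int convex_translation)
qed

text \<open>The critical case of gluing: a cell below the zone against one above it. At each common
  point a prism \<open>H\<close> joins the two sides. Its bottom face is its translated top face,
  and both cells cut faces out of it; these meet in a common face.
  \<open>face_of_Union_convex\<close> then joins the local faces.\<close>

lemma mixed_intersection:
  assumes F: "F \<in> C" "\<And>x. x \<in> F \<Longrightarrow> \<psi> x = 0" and G: "G \<in> C" "\<And>x. x \<in> G \<Longrightarrow> \<psi> x = 1"
  shows "(F \<inter> (+) (- w) ` G) face_of F" "(F \<inter> (+) (- w) ` G) face_of ((+) (- w) ` G)"
proof -
  define S where "S = F \<inter> (+) (- w) ` G"
  have conv: "convex S" unfolding S_def using cell_convex F(1) G(1) by (intro convex_Int convex_translation) auto
  have cover: "\<exists>A. A face_of F \<and> A face_of ((+) (- w) ` G) \<and> x \<in> A \<and> A \<subseteq> S" if x: "x \<in> S" for x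
  proof -
    have xF: "x \<in> F" "x + w \<in> G" using x unfolding S_def by auto
    then have "\<psi> x = 0" "\<psi> (x + w) = 1" using F G by auto
    then obtain H where H: "H \<in> C" "prism \<psi> w H" "x \<in> H" "x + w \<in> H"
      using crossing_prism[of x] xF F(1) G(1) by blast
    define H0 where "H0 = {y\<in>H. \<psi> y = 0}"
    define H1 where "H1 = {y\<in>H. \<psi> y = 1}"
    have fH: "H0 face_of H" "H1 face_of H"
      using prism_level_face[OF H(2) cell_convex[OF H(1)]] by (auto simp: H0_def H1_def)
    have H01: "(+) (- w) ` H1 = H0"
    proof (intro equalityI subsetI)
      fix y assume "y \<in> (+) (- w) ` H1"
      then obtain z where z: "z \<in> H" "\<psi> z = 1" "y = z - w" by (auto simp: H1_def)
      then show "y \<in> H0" using prism_slide[OF H(2) cell_convex[OF H(1)] z(1), of 0] by (simp add: H0_def)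
    next
      fix y assume "y \<in> H0"
      then have y: "y \<in> H" "\<psi> y = 0" by (auto simp: H0_def)
      have "y + w \<in> H1" using prism_slide[OF H(2) cell_convex[OF H(1)] y(1), of 1] y(2) by (simp add: H1_def)
      then show "y \<in> (+) (- w) ` H1" by (intro image_eqI[of _ _ "y + w"]) simp_all
    qed
    define P where "P = F \<inter> H"
    define Q where "Q = (+) (- w) ` (G \<inter> H)"
    have PH: "P face_of H" unfolding P_def using cell_Int[OF H(1) F(1)] by (simp add: Int_commute)
    have "(G \<inter> H) face_of H1"
      by (rule face_of_subset[of _ H]) (use cell_Int[OF H(1) G(1)] G(2) in \<open>auto simp: Int_commute H1_def\<close>)
    then have "Q face_of H0" unfolding Q_def H01[symmetric] by (simp only: face_of_translation_eq)
    then have QH: "Q face_of H" using fH(1) face_of_trans by blast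
    have PQH: "(P \<inter> Q) face_of H" using face_of_Int[OF PH QH] .
    have "(P \<inter> Q) face_of P" by (rule face_of_subset[OF PQH]) (use face_of_imp_subset[OF PH] in auto)
    moreover have "P face_of F" unfolding P_def using cell_Int[OF F(1) H(1)] .
    ultimately have 1: "(P \<inter> Q) face_of F" by (rule face_of_trans)
    have "(P \<inter> Q) face_of Q" by (rule face_of_subset[OF PQH]) (use face_of_imp_subset[OF QH] in auto)
    moreover have "Q face_of ((+) (- w) ` G)" unfolding Q_def using cell_Int[OF G(1) H(1)] by (simp only: face_of_translation_eq)
    ultimately have 2: "(P \<inter> Q) face_of ((+) (- w) ` G)" by (rule face_of_trans)
    have "x \<in> Q" unfolding Q_def using xF H(4) by (intro image_eqI[of _ _ "x + w"]) auto
    then have "x \<in> P \<inter> Q" unfolding P_def using xF H by blast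
    moreover have "P \<inter> Q \<subseteq> S" unfolding P_def Q_def S_def by blast
    ultimately show ?thesis using 1 2 by blast
  qed
  have cover1: "\<exists>A. A face_of F \<and> x \<in> A \<and> A \<subseteq> S"
    and cover2: "\<exists>A. A face_of ((+) (- w) ` G) \<and> x \<in> A \<and> A \<subseteq> S" if "x \<in> S" for x
    using cover[OF that] by blast+
  show "(F \<inter> (+) (- w) ` G) face_of F"
    unfolding S_def[symmetric] by (rule face_of_Union_convex[OF conv _ cover1]) (simp add: S_def)
  show "(F \<inter> (+) (- w) ` G) face_of ((+) (- w) ` G)"
    unfolding S_def[symmetric] by (rule face_of_Union_convex[OF conv _ cover2]) (simp add: S_def)
qed

lemma shrunk_face:
  assumes F: "F \<in> C" "\<not> prism \<psi> w F" and G: "G face_of shift ` F" "G \<noteq> {}"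
  obtains G0 where "G0 \<in> C" "G0 \<subseteq> F" "\<not> prism \<psi> w G0" "G = shift ` G0" "\<exists>v. G0 = (+) v ` G"
proof (cases rule: nonprism_cases[OF F])
  case 1
  have fG: "G face_of F" using G 1(2) by simp
  have GC: "G \<in> C" using cell_face[OF F(1) fG G(2)] .
  have GF: "G \<subseteq> F" using face_of_imp_subset[OF fG] .
  have "\<not> prism \<psi> w G" by (rule constant_not_prism[OF GC, of 0]) (use 1 GF in auto)
  moreover have "shift ` G = G" by (rule shift_bottom) (use 1 GF in auto)
  moreover have "G = (+) 0 ` G" by simp
  ultimately show ?thesis using that[OF GC GF] by metis
next
  case 2
  define G0 where "G0 = (+) w ` G"
  have GG: "G = (+) (- w) ` G0" unfolding G0_def by (simp add: image_image)
  have "G0 face_of F" using G(1) unfolding 2(2) GG by (simp only: face_of_translation_eq)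
  moreover have "G0 \<noteq> {}" using G(2) unfolding G0_def by simp
  ultimately have G0: "G0 \<in> C" "G0 \<subseteq> F" using cell_face[OF F(1)] face_of_imp_subset by blast+
  have "\<not> prism \<psi> w G0" by (rule constant_not_prism[OF G0(1), of 1]) (use 2 G0 in auto)
  moreover have "shift ` G0 = G" unfolding GG by (rule shift_top) (use 2 G0 in auto)
  ultimately show ?thesis using that[OF G0] G0_def by metis
qed

theorem cubical_shrunk: "cubical shrunk"
proof
  show "shrunk \<noteq> {}" using nonempty unfolding shrunk_def by blast
  show "convex (\<Union>shrunk)" by (rule convex_Union_shrunk)
  show "\<exists>a B. independent B \<and> F = par a B" if "F \<in> shrunk" for F
    using that
  proof -
    assume "F \<in> shrunk"
    then obtain G where G: "G \<in> C" "\<not> prism \<psi> w G" "F = shift ` G" using shrunkE by metis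
    obtain a B where B: "independent B" "G = par a B" using cellE[OF G(1)] .
    show ?thesis using nonprism_cases[OF G(1,2)] B G(3) par_translation by metis
  qed
  show "polyhedral_complex shrunk"
    unfolding polyhedral_complex_def
  proof (intro conjI ballI allI impI)
    show "finite shrunk" unfolding shrunk_def using finite_C by simp
    fix F assume "F \<in> shrunk"
    then obtain F0 where F0: "F0 \<in> C" "\<not> prism \<psi> w F0" "F = shift ` F0" using shrunkE by metis
    show "polytope F"
      using nonprism_cases[OF F0(1,2)] cell_polytope[OF F0(1)] F0(3) polytope_translation_eq by metis
    show "F \<noteq> {}" using F0 cell_nonempty by blast
    { fix G assume "G face_of F \<and> G \<noteq> {}"
      then obtain G0 where "G0 \<in> C" "G = shift ` G0" using shrunk_face[OF F0(1,2)] F0(3) by metis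
      then show "G \<in> shrunk" unfolding shrunk_def by blast }
    fix G assume "G \<in> shrunk"
    then obtain G0 where G0: "G0 \<in> C" "\<not> prism \<psi> w G0" "G = shift ` G0" using shrunkE by metis
    have tr: "(+) (- w) ` F0 \<inter> (+) (- w) ` G0 = (+) (- w) ` (F0 \<inter> G0)" by auto
    have "F \<inter> G face_of F \<and> F \<inter> G face_of G"
    proof (cases rule: nonprism_cases[OF F0(1,2)])
      case F: 1
      show ?thesis
      proof (cases rule: nonprism_cases[OF G0(1,2)])
        case 1 then show ?thesis using F F0 G0 cell_Int[OF F0(1) G0(1)] cell_Int[OF G0(1) F0(1)] by (simp add: Int_commute)
      next
        case 2 then show ?thesis using mixed_intersection[OF F0(1) F(1) G0(1) 2(1)] F F0 G0 by simp
      qed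
    next
      case F: 2
      show ?thesis
      proof (cases rule: nonprism_cases[OF G0(1,2)])
        case 1 then show ?thesis using mixed_intersection[OF G0(1) 1(1) F0(1) F(1)] F F0 G0 by (simp add: Int_commute)
      next
        case 2 then have FG: "F = (+) (- w) ` F0" "G = (+) (- w) ` G0" using F F0 G0 by auto
        show ?thesis unfolding FG tr face_of_translation_eq
          using cell_Int[OF F0(1) G0(1)] cell_Int[OF G0(1) F0(1)] by (simp add: Int_commute)
      qed
    qed
    then show "F \<inter> G face_of F" "F \<inter> G face_of G" by auto
  qed
qed

lemma shift_translate:
  assumes "F \<in> C" "\<not> prism \<psi> w F" obtains v where "shift ` F = (+) v ` F"
proof (cases rule: nonprism_cases[OF assms])
  case 1 then show ?thesis using that[of 0] by simp
next
  case 2 then show ?thesis using that by blast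
qed

lemma edges_shrunk: "edges shrunk = (\<lambda>e. shift ` e) ` (edges C - c)"
proof (intro equalityI subsetI)
  fix e' assume e': "e' \<in> edges shrunk"
  then have "e' \<in> shrunk" by (simp add: edges_def)
  then obtain F where F: "F \<in> C" "\<not> prism \<psi> w F" "e' = shift ` F" using shrunkE by metis
  obtain v where "shift ` F = (+) v ` F" using shift_translate[OF F(1,2)] .
  then have "F \<in> edges C" using e' F by (simp add: edges_def aff_dim_translation_eq)
  then show "e' \<in> (\<lambda>e. shift ` e) ` (edges C - c)" using F edge_in_class_iff by blast
next
  fix e' assume "e' \<in> (\<lambda>e. shift ` e) ` (edges C - c)"
  then obtain e where e: "e \<in> edges C" "e \<notin> c" "e' = shift ` e" by blast
  have eC: "e \<in> C" "\<not> prism \<psi> w e" using e edge_cell edge_in_class_iff by blast+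
  obtain v where "shift ` e = (+) v ` e" using shift_translate[OF eC] .
  then have "aff_dim (shift ` e) = 1" using e(1) by (simp add: edges_def aff_dim_translation_eq)
  then show "e' \<in> edges shrunk" using e(3) eC unfolding edges_def shrunk_def by blast
qed

text \<open>Distinct edges that become equal lie on the two sides of the zone. The prism crossing
  the zone at a relative interior point contains both of them entirely, so they are parallel edges
  of one cell.\<close>

lemma glued_edges_linked:
  assumes e: "e \<in> edges C" "e \<notin> c" and f: "f \<in> edges C" "f \<notin> c" and eq: "shift ` e = shift ` f"
  shows "(e, f) \<in> (linked C)\<^sup>*"
proof -
  have mixed: "(e, f) \<in> linked C"
    if e: "e \<in> edges C" "\<And>x. x \<in> e \<Longrightarrow> \<psi> x = 0" and f: "f \<in> edges C" "\<And>x. x \<in> f \<Longrightarrow> \<psi> x = 1"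
      and eq: "e = (+) (- w) ` f" for e f
  proof -
    have eC: "e \<in> C" "f \<in> C" using edge_cell e f by auto
    have fe: "f = (+) w ` e" unfolding eq by (simp add: image_image)
    have "rel_interior e \<noteq> {}" using cell_convex[OF eC(1)] cell_nonempty[OF eC(1)] rel_interior_eq_empty by blast
    then obtain x where x: "x \<in> rel_interior e" by blast
    have xe: "x \<in> e" using x rel_interior_subset by blast
    have xf: "x + w \<in> rel_interior f" unfolding fe using x
      unfolding rel_interior_translation by (intro image_eqI[of _ _ x]) auto
    have xwf: "x + w \<in> f" using xf rel_interior_subset by blast
    have xw: "x \<in> \<Union>C" "x + w \<in> \<Union>C" "\<psi> x = 0" "\<psi> (x + w) = 1" using xe xwf e(2) f(2) eC by auto
    obtain H where H: "H \<in> C" "x \<in> H" "x + w \<in> H" using crossing_prism[OF xw] by metis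
    have "e \<subseteq> e \<inter> H" using subset_of_face_of[OF cell_Int[OF eC(1) H(1)], of e] x xe H(2) by blast
    moreover have "f \<subseteq> f \<inter> H" using subset_of_face_of[OF cell_Int[OF eC(2) H(1)], of f] xf xwf H(3) by blast
    ultimately show ?thesis unfolding linked_def using e f fe H(1) by blast
  qed
  have eC: "e \<in> C" "\<not> prism \<psi> w e" "f \<in> C" "\<not> prism \<psi> w f" using e f edge_cell edge_in_class_iff by blast+
  have tr: "e = f" if "(+) (- w) ` e = (+) (- w) ` f" using that by (simp add: inj_image_eq_iff)
  show ?thesis
  proof (cases rule: nonprism_cases[OF eC(1,2)])
    case E: 1
    show ?thesis
    proof (cases rule: nonprism_cases[OF eC(3,4)])
      case 1 then show ?thesis using E eq by simp
    next
      case 2 then show ?thesis using mixed[OF e(1) E(1) f(1) 2(1)] E eq by auto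
    qed
  next
    case E: 2
    show ?thesis
    proof (cases rule: nonprism_cases[OF eC(3,4)])
      case 1 then have "(f, e) \<in> linked C" using mixed[OF f(1) 1(1) e(1) E(1)] E eq by auto
      then show ?thesis using linked_sym by blast
    next
      case 2
      have "(+) (- w) ` e = (+) (- w) ` f" using E(2) 2(2) eq by (rule_tac trans[OF E(2)[symmetric]]) (simp only:)
      then have "e = f" by (rule tr)
      then show ?thesis by simp
    qed
  qed
qed

text \<open>\<open>shift\<close> carries links forward. Backward, each link lies in the image of one
  cell outside the zone and lifts to it; lifts of the same edge from consecutive links are joined by
  \<open>glued_edges_linked\<close>.\<close>

theorem shrunk_classes:
  "\<exists>h. bij_betw h (edge_classes C - {c}) (edge_classes shrunk) \<and>
     (\<forall>d\<in>edge_classes C - {c}. \<forall>u. edge_vector d u \<longrightarrow> edge_vector (h d) u)"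
proof -
  interpret S: cubical shrunk by (rule cubical_shrunk)
  define \<rho> where "\<rho> e e' \<longleftrightarrow> e \<in> edges C \<and> e \<notin> c \<and> e' = shift ` e" for e e'
  have nc: "f \<notin> c" if "(e, f) \<in> (linked C)\<^sup>*" "e \<notin> c" for e f
    using that class_closed[OF cls(1)] linked_sym by blast
  have fwd: "(shift ` e, shift ` f) \<in> (linked shrunk)\<^sup>*" if "(e, f) \<in> (linked C)\<^sup>*" "e \<notin> c" for e f
    using that(1)
  proof (induction rule: rtrancl_induct)
    case (step y z)
    have y: "y \<notin> c" "z \<notin> c" using nc[OF step(1) that(2)] nc[of y z] step(2) by blast+
    obtain F v where F: "F \<in> C" "y \<in> edges C" "z \<in> edges C" "y \<subseteq> F" "z \<subseteq> F" "z = (+) v ` y"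
      using step(2) unfolding linked_def by blast
    obtain v1 where v1: "shift ` y = (+) v1 ` y" using shift_translate[of y] edge_cell F edge_in_class_iff y by metis
    obtain v2 where v2: "shift ` z = (+) v2 ` z" using shift_translate[of z] edge_cell F edge_in_class_iff y by metis
    have "shift ` z = (+) (v2 + v - v1) ` shift ` y" unfolding v1 v2 unfolding F(6) image_image by (simp add: algebra_simps)
    moreover have "shift ` F \<in> shrunk" "shift ` y \<subseteq> shift ` F" "shift ` z \<subseteq> shift ` F"
      using F unfolding shrunk_def by blast+
    moreover have "shift ` y \<in> edges shrunk" "shift ` z \<in> edges shrunk" unfolding edges_shrunk using F y by blast+
    ultimately have "(shift ` y, shift ` z) \<in> linked shrunk" unfolding linked_def by blast
    then show ?case using step.IH by (rule rtrancl.rtrancl_into_rtrancl[rotated])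
  qed simp
  have bwd1: "\<exists>e f. \<rho> e e' \<and> \<rho> f f' \<and> (e, f) \<in> linked C" if l: "(e', f') \<in> linked shrunk" for e' f'
  proof -
    obtain G' v where G': "G' \<in> shrunk" "e' \<in> edges shrunk" "f' \<in> edges shrunk" "e' \<subseteq> G'" "f' \<subseteq> G'" "f' = (+) v ` e'"
      using l unfolding linked_def by blast
    obtain G where G: "G \<in> C" "\<not> prism \<psi> w G" "G' = shift ` G" using shrunkE[OF G'(1)] .
    have lift: "\<exists>e. \<rho> e h \<and> e \<subseteq> G \<and> (\<exists>u. e = (+) u ` h)" if h: "h \<in> edges shrunk" "h \<subseteq> G'" for h
    proof -
      have "h face_of shift ` G" using S.cell_subset_face[OF G'(1) S.edge_cell[OF h(1)] h(2)] G(3) by simp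
      then obtain e where e: "e \<in> C" "e \<subseteq> G" "\<not> prism \<psi> w e" "h = shift ` e" "\<exists>v. e = (+) v ` h"
        using shrunk_face[OF G(1,2)] S.cell_nonempty[OF S.edge_cell[OF h(1)]] by metis
      have "e \<in> edges C" using e(1,5) h(1) by (auto simp: edges_def aff_dim_translation_eq)
      then show ?thesis unfolding \<rho>_def using e edge_in_class_iff by blast
    qed
    obtain e u where e: "\<rho> e e'" "e \<subseteq> G" "e = (+) u ` e'" using lift G' by metis
    obtain f u' where f: "\<rho> f f'" "f \<subseteq> G" "f = (+) u' ` f'" using lift G' by metis
    have "f = (+) (u' + v - u) ` e" unfolding f(3) e(3) G'(6) image_image by (simp add: algebra_simps)
    then have "(e, f) \<in> linked C" unfolding linked_def using e f G(1) unfolding \<rho>_def by blast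
    then show ?thesis using e f by blast
  qed
  have glue: "(e, f) \<in> (linked C)\<^sup>*" if "\<rho> e h" "\<rho> f h" for e f h
    using glued_edges_linked that unfolding \<rho>_def by blast
  have bwd: "(e, f) \<in> (linked C)\<^sup>*" if "(e', f') \<in> (linked shrunk)\<^sup>*" "\<rho> e e'" "\<rho> f f'" for e f e' f'
    using that(1,3)
  proof (induction arbitrary: f rule: rtrancl_induct)
    case base then show ?case using glue that(2) by blast
  next
    case (step y z)
    obtain y0 z0 where "\<rho> y0 y" "\<rho> z0 z" "(y0, z0) \<in> linked C" using bwd1[OF step(2)] by blast
    then show ?case using step.IH glue[OF _ step.prems] by (meson rtrancl.rtrancl_into_rtrancl rtrancl_trans)
  qed
  show ?thesis
  proof (rule class_bijection[OF cubical_axioms cubical_shrunk, of _ \<rho> "\<lambda>u. u"])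
    show "edge_classes C - {c} \<subseteq> edge_classes C" by blast
    show "e \<in> edges C \<and> e' \<in> edges shrunk" if "\<rho> e e'" for e e' using that unfolding \<rho>_def edges_shrunk by blast
    show "d \<in> edge_classes C - {c}" if "\<rho> e e'" "d \<in> edge_classes C" "e \<in> d" for d e e'
      using that unfolding \<rho>_def by blast
    show "\<exists>e. \<rho> e e'" if "e' \<in> edges shrunk" for e' using that unfolding \<rho>_def edges_shrunk by blast
    show "\<exists>e\<in>d. \<exists>e'. \<rho> e e'" if d: "d \<in> edge_classes C - {c}" for d
    proof -
      obtain e where e: "e \<in> d" using class_nonempty d by blast
      then have "e \<notin> c" using class_eq[OF _ cls(1)] d by blast
      then show ?thesis unfolding \<rho>_def using e class_edges d by blast
    qed
    show "(e, f) \<in> (linked C)\<^sup>* \<longleftrightarrow> (e', f') \<in> (linked shrunk)\<^sup>*" if "\<rho> e e'" "\<rho> f f'" for e e' f f'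
      using that fwd bwd unfolding \<rho>_def by blast
    show "\<exists>a'. e' = closed_segment a' (a' + u)" if r: "\<rho> e e'" "e = closed_segment a (a + u)" for e e' a u
    proof -
      obtain v where "shift ` e = (+) v ` e" using shift_translate[of e] r(1) edge_cell edge_in_class_iff unfolding \<rho>_def by metis
      then have "e' = closed_segment (v + a) (v + a + u)" using r
        unfolding \<rho>_def by (simp add: closed_segment_translation add.assoc)
      then show ?thesis by blast
    qed
  qed
qed

end

section \<open>Projecting a zone\<close>

lemma linear_quotient_map: "linear (quotient_map w)"
proof -
  have "linear (\<lambda>x. x - ((x \<bullet> w) / (w \<bullet> w)) *\<^sub>R w)"
    by (rule linearI) (simp_all add: inner_add_left algebra_simps add_divide_distrib)
  then show ?thesis by (simp add: quotient_map_def[abs_def])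
qed

lemma quotient_map_self: "quotient_map w w = 0"
  by (cases "w = 0") (simp_all add: quotient_map_def)

lemma quotient_map_add: "quotient_map w (x + t *\<^sub>R w) = quotient_map w x"
  using linear_quotient_map[of w] by (simp add: linear_add linear_cmul quotient_map_self)

lemma quotient_map_eqD: assumes "quotient_map w x = quotient_map w y" obtains t where "y = x + t *\<^sub>R w"
proof -
  have "y = x + ((y \<bullet> w) / (w \<bullet> w) - (x \<bullet> w) / (w \<bullet> w)) *\<^sub>R w"
    using assms unfolding quotient_map_def by (simp add: algebra_simps)
  then show ?thesis using that by blast
qed

lemma quotient_map_inj_span:
  assumes "w \<notin> span S" shows "inj_on (quotient_map w) (span S)"
proof (rule inj_onI)
  fix x y assume xy: "x \<in> span S" "y \<in> span S" "quotient_map w x = quotient_map w y"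
  obtain t where t: "y = x + t *\<^sub>R w" using quotient_map_eqD[OF xy(3)] .
  have "t *\<^sub>R w \<in> span S" using span_diff[OF xy(2,1)] t by simp
  then have "t = 0" using assms span_scale[of "t *\<^sub>R w" S "1/t"] by (cases "t = 0") auto
  then show "x = y" using t by simp
qed

lemma quotient_map_independent:
  assumes "independent B" "w \<in> B"
  shows "inj_on (quotient_map w) (B - {w})" "independent (quotient_map w ` (B - {w}))"
proof -
  have "w \<notin> span (B - {w})" using assms unfolding dependent_def by blast
  then have i: "inj_on (quotient_map w) (span (B - {w}))" by (rule quotient_map_inj_span)
  show "inj_on (quotient_map w) (B - {w})" using i by (rule inj_on_subset) (rule span_superset)
  show "independent (quotient_map w ` (B - {w}))"
    using linear_independent_injective_image[OF linear_quotient_map _ i] independent_mono[OF assms(1)] by blast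
qed

text \<open>Sliding a point to the bottom facet does not change its image, and on the remaining edge
  vectors the quotient is injective.\<close>

lemma quotient_map_par:
  assumes B: "independent B" "w \<in> B"
  shows "quotient_map w ` par a B = par (quotient_map w a) (quotient_map w ` (B - {w}))"
proof -
  obtain g where g: "linear g" "g w = 1" "\<And>b. b \<in> B - {w} \<Longrightarrow> g b = (0::real)"
    using independent_functional[OF B] by blast
  have "quotient_map w ` par a B = quotient_map w ` par a (B - {w})"
  proof (intro equalityI subsetI)
    fix y assume "y \<in> quotient_map w ` par a B"
    then obtain x where x: "x \<in> par a B" "y = quotient_map w x" by blast
    have "x + (- (g x - g a)) *\<^sub>R w \<in> par a (B - {w})"
      using par_coordinate(3)[OF B g x(1)] by (simp only: scaleR_minus_left diff_conv_add_uminus[symmetric])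
    moreover have "y = quotient_map w (x + (- (g x - g a)) *\<^sub>R w)" unfolding quotient_map_add by (rule x(2))
    ultimately show "y \<in> quotient_map w ` par a (B - {w})" by (rule_tac image_eqI)
  next
    have "par (a + \<Sum>{}) (B - {w}) \<subseteq> par a B" by (rule face_of_imp_subset[OF par_face[OF B(1)]]) auto
    then show "y \<in> quotient_map w ` par a B" if "y \<in> quotient_map w ` par a (B - {w})" for y using that by auto
  qed
  then show ?thesis using par_linear_image[OF linear_quotient_map quotient_map_independent(1)[OF B]] by simp
qed

section \<open>Cells of the projection and the level 1/2\<close>

context zone_class
begin

abbreviation q where "q \<equiv> quotient_map w"

definition projected :: "'a set set" where "projected = (\<lambda>F. q ` F) ` {F\<in>C. prism \<psi> w F}"

lemma projectedE: assumes "G \<in> projected" obtains F where "F \<in> C" "prism \<psi> w F" "G = q ` F"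
  using assms unfolding projected_def by blast

lemma middle_in_cell:
  assumes F: "F \<in> C" "prism \<psi> w F" and x: "x \<in> F"
  obtains y t where "y \<in> F" "\<psi> y = 1/2" "q y = q x" "x = y + t *\<^sub>R w"
proof -
  have y: "x + (1/2 - \<psi> x) *\<^sub>R w \<in> F" "\<psi> (x + (1/2 - \<psi> x) *\<^sub>R w) = 1/2"
    using prism_slide[OF F(2) cell_convex[OF F(1)] x, of "1/2"] by auto
  moreover have "x = x + (1/2 - \<psi> x) *\<^sub>R w + (\<psi> x - 1/2) *\<^sub>R w" by (simp add: algebra_simps)
  ultimately show ?thesis using that quotient_map_add by blast
qed

lemma middle_unique:
  assumes "x \<in> \<Union>C" "y \<in> \<Union>C" "\<psi> x = 1/2" "\<psi> y = 1/2" "q x = q y" shows "x = y"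
proof -
  obtain t where t: "y = x + t *\<^sub>R w" using quotient_map_eqD[OF assms(5)] .
  have "t = 0" by (rule line_value_unique[of x]) (use assms t in auto)
  then show ?thesis using t by simp
qed

text \<open>A prism is determined by its projection: its points slide to the level 1/2, where the
  projection is injective, and from there back within the other prism.\<close>

lemma prism_subset_of_image:
  assumes F: "F \<in> C" "prism \<psi> w F" and G: "G \<in> C" "prism \<psi> w G" and sub: "q ` F \<subseteq> q ` G"
  shows "F \<subseteq> G"
proof
  fix x assume x: "x \<in> F"
  obtain y t where y: "y \<in> F" "\<psi> y = 1/2" "q y = q x" "x = y + t *\<^sub>R w" using middle_in_cell[OF F x] .
  obtain x' where x': "x' \<in> G" "q x' = q x" using x sub by (metis (no_types, lifting) imageE image_eqI subsetD)
  obtain y' t' where y': "y' \<in> G" "\<psi> y' = 1/2" "q y' = q x'" using middle_in_cell[OF G x'(1)] by metis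
  have "y = y'" by (rule middle_unique) (use y y' x' F G in auto)
  then have yG: "y \<in> G" using y' by simp
  have "\<psi> x = 1/2 + t" using prism_step[OF F(2) y(1), of t] y x by simp
  moreover have "0 \<le> \<psi> x" "\<psi> x \<le> 1" using potential_range[of x] x F(1) by blast+
  ultimately have "y + (\<psi> x - \<psi> y) *\<^sub>R w \<in> G" using prism_slide(1)[OF G(2) cell_convex[OF G(1)] yG, of "\<psi> x"] by simp
  then show "x \<in> G" using y \<open>\<psi> x = 1/2 + t\<close> by simp
qed

text \<open>Everything is lifted to the level 1/2. There the projection is injective, and the part
  of the level in a single prism is convex, so the open segment lifts to one in \<open>F\<close>
  through a point of \<open>H\<close>.\<close>

lemma projected_face:
  assumes F: "F \<in> C" "prism \<psi> w F" and H: "H \<in> C" "prism \<psi> w H" "H face_of F"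
  shows "q ` H face_of q ` F"
  unfolding face_of_def
proof (intro conjI ballI impI)
  show "q ` H \<subseteq> q ` F" using face_of_imp_subset[OF H(3)] by blast
  show "convex (q ` H)" by (rule convex_linear_image[OF linear_quotient_map cell_convex[OF H(1)]])
  fix a b x assume a: "a \<in> q ` F" and b: "b \<in> q ` F" and x: "x \<in> q ` H" "x \<in> open_segment a b"
  obtain a0 where a0: "a0 \<in> F" "\<psi> a0 = 1/2" "a = q a0" using a middle_in_cell[OF F] by (metis imageE)
  obtain b0 where b0: "b0 \<in> F" "\<psi> b0 = 1/2" "b = q b0" using b middle_in_cell[OF F] by (metis imageE)
  obtain x0 where x0: "x0 \<in> H" "\<psi> x0 = 1/2" "x = q x0" using x(1) middle_in_cell[OF H(1,2)] by (metis imageE)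
  obtain u where u: "a \<noteq> b" "0 < u" "u < 1" "x = (1 - u) *\<^sub>R a + u *\<^sub>R b" using x(2) unfolding in_segment by blast
  define m where "m = (1 - u) *\<^sub>R a0 + u *\<^sub>R b0"
  have m: "m \<in> F" unfolding m_def using convexD_alt[OF cell_convex[OF F(1)] a0(1) b0(1)] u by simp
  have pm: "\<psi> m = 1/2" unfolding m_def using prism_affine[OF F(2) cell_convex[OF F(1)] a0(1) b0(1), of u] u a0 b0
    by (simp add: field_simps)
  have "q m = x" unfolding m_def u(4) a0(3) b0(3) using linear_quotient_map[of w] by (simp add: linear_add linear_cmul)
  then have qxm: "q x0 = q m" using x0(3) by simp
  have "x0 \<in> \<Union>C" "m \<in> \<Union>C" using x0(1) H(1) m F(1) by blast+
  then have "x0 = m" using middle_unique x0(2) pm qxm by blast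
  moreover have "a0 \<noteq> b0" using u(1) a0(3) b0(3) by blast
  then have "m \<in> open_segment a0 b0" unfolding in_segment m_def using u(2,3) by blast
  ultimately have "a0 \<in> H \<and> b0 \<in> H" using H(3) a0(1) b0(1) x0(1) unfolding face_of_def by blast
  then show "a \<in> q ` H" "b \<in> q ` H" using a0 b0 by auto
qed

text \<open>The preimage of \<open>G\<close> in \<open>F\<close> is a face, and sliding along
  \<open>w\<close> within \<open>F\<close> does not leave it. So it contains some \<open>p\<close>
  together with \<open>p + w\<close> and is itself a prism.\<close>

lemma face_of_projected:
  assumes F: "F \<in> C" "prism \<psi> w F" and G: "G face_of q ` F" "G \<noteq> {}"
  obtains H where "H \<in> C" "prism \<psi> w H" "H face_of F" "G = q ` H"
proof -
  define H where "H = F \<inter> q -` G"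
  have GF: "G \<subseteq> q ` F" using face_of_imp_subset[OF G(1)] .
  have qH: "q ` H = G" unfolding H_def using GF by blast
  have "H face_of F"
    unfolding face_of_def
  proof (intro conjI ballI impI)
    show "H \<subseteq> F" by (auto simp: H_def)
    show "convex H" unfolding H_def
      by (intro convex_Int cell_convex F(1) convex_linear_vimage linear_quotient_map face_of_imp_convex[OF G(1)])
    fix a b x assume ab: "a \<in> F" "b \<in> F" and x: "x \<in> H" "x \<in> open_segment a b"
    obtain u where u: "0 < u" "u < 1" "x = (1 - u) *\<^sub>R a + u *\<^sub>R b" using x(2) unfolding in_segment by blast
    have qx: "q x = (1 - u) *\<^sub>R q a + u *\<^sub>R q b"
      unfolding u(3) using linear_quotient_map[of w] by (simp add: linear_add linear_cmul)
    have qG: "q x \<in> G" using x(1) by (simp add: H_def)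
    have "q a \<in> G \<and> q b \<in> G"
    proof (cases "q a = q b")
      case True
      then have "q x = q b" using qx by (simp add: algebra_simps)
      then show ?thesis using qG True by simp
    next
      case False
      then have "q x \<in> open_segment (q a) (q b)" unfolding in_segment using u qx by blast
      then show ?thesis using G(1) ab qG unfolding face_of_def by blast
    qed
    then show "a \<in> H" "b \<in> H" using ab by (auto simp: H_def)
  qed
  moreover have ne: "H \<noteq> {}" using qH G(2) by blast
  ultimately have HC: "H \<in> C" using cell_face[OF F(1)] by blast
  obtain x where x: "x \<in> H" using ne by blast
  then have xF: "x \<in> F" "q x \<in> G" by (auto simp: H_def)
  define p where "p = x + (0 - \<psi> x) *\<^sub>R w"
  have "p \<in> F" "p + w \<in> F"
    using prism_slide(1)[OF F(2) cell_convex[OF F(1)] xF(1), of 0] prism_slide(1)[OF F(2) cell_convex[OF F(1)] xF(1), of 1]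
    by (auto simp: p_def algebra_simps)
  moreover have "q p = q x" unfolding p_def by (rule quotient_map_add)
  moreover have "q (p + w) = q p" using quotient_map_add[of w p 1] by simp
  ultimately have "p \<in> H" "p + w \<in> H" using xF by (auto simp: H_def)
  then have "prism \<psi> w H" by (intro prism_of_step[OF F HC]) (auto simp: H_def)
  then show ?thesis using that[OF HC] \<open>H face_of F\<close> qH by blast
qed

lemma project_eq: "project C c w = projected"
proof (intro equalityI subsetI)
  fix G assume "G \<in> project C c w"
  then obtain T where T: "G \<noteq> {}" "T \<in> zone C c" "G face_of q ` T" unfolding project_def by blast
  have TC: "T \<in> C" "prism \<psi> w T" using T(2) has_edge_iff unfolding zone_def tiles_def has_edge_def by blast+
  show "G \<in> projected" using face_of_projected[OF TC T(3,1)] unfolding projected_def by blast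
next
  fix G assume "G \<in> projected"
  then obtain F where F: "F \<in> C" "prism \<psi> w F" "G = q ` F" using projectedE by metis
  obtain T where T: "T \<in> tiles C" "F \<subseteq> T" using cell_in_tile[OF F(1)] .
  have TC: "T \<in> C" using T by (simp add: tiles_def)
  have pT: "prism \<psi> w T" using prism_superset[OF F(1) TC F(2) T(2)] .
  have "T \<in> zone C c" using T(1) has_edge_iff[OF TC] pT unfolding zone_def has_edge_def by blast
  moreover have "G face_of q ` T" unfolding F(3) by (rule projected_face[OF TC pT F(1,2) cell_subset_face[OF TC F(1) T(2)]])
  moreover have "G \<noteq> {}" using F cell_nonempty by blast
  ultimately show "G \<in> project C c w" unfolding project_def by blast
qed

lemma Union_projected: "\<Union>projected = q ` \<Union>C"
proof
  show "\<Union>projected \<subseteq> q ` \<Union>C" unfolding projected_def by blast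
  show "q ` \<Union>C \<subseteq> \<Union>projected"
  proof
    fix y assume "y \<in> q ` \<Union>C"
    then obtain x where x: "x \<in> \<Union>C" "y = q x" by blast
    obtain t where t: "x + t *\<^sub>R w \<in> \<Union>C" "\<psi> (x + t *\<^sub>R w) = 1/2" using line_value[OF x(1), of "1/2"] by auto
    then obtain F where F: "F \<in> C" "x + t *\<^sub>R w \<in> F" by blast
    have "prism \<psi> w F" using interior_prism[OF F] t(2) by simp
    moreover have "y = q (x + t *\<^sub>R w)" unfolding quotient_map_add by (rule x(2))
    ultimately show "y \<in> \<Union>projected" unfolding projected_def using F by blast
  qed
qed

text \<open>Points of \<open>F\<close> and \<open>G\<close> with the same projection slide to one
  and the same point at level 1/2, which lies in both. Hence projecting commutes with intersecting,
  and the intersection is again a prism.\<close>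

lemma projected_Int:
  assumes F: "F \<in> C" "prism \<psi> w F" and G: "G \<in> C" "prism \<psi> w G"
  shows "(q ` F \<inter> q ` G) face_of q ` F"
proof (cases "q ` F \<inter> q ` G = {}")
  case False
  have common: "\<exists>x\<in>F \<inter> G. \<psi> x = 1/2 \<and> q x = y" if y: "y \<in> q ` F" "y \<in> q ` G" for y
  proof -
    obtain x where x: "x \<in> F" "\<psi> x = 1/2" "y = q x" using y(1) middle_in_cell[OF F] by (metis imageE)
    obtain x' where x': "x' \<in> G" "\<psi> x' = 1/2" "y = q x'" using y(2) middle_in_cell[OF G] by (metis imageE)
    have "x = x'" by (rule middle_unique) (use x x' F G in auto)
    then show ?thesis using x x' by blast
  qed
  have eq: "q ` F \<inter> q ` G = q ` (F \<inter> G)"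
  proof
    show "q ` F \<inter> q ` G \<subseteq> q ` (F \<inter> G)"
    proof
      fix y assume "y \<in> q ` F \<inter> q ` G"
      then obtain x where "x \<in> F \<inter> G" "q x = y" using common[of y] by blast
      then show "y \<in> q ` (F \<inter> G)" by (rule_tac image_eqI[of _ _ x]) auto
    qed
  qed auto
  obtain y where "y \<in> q ` F" "y \<in> q ` G" using False by blast
  then obtain x where x: "x \<in> F \<inter> G" "\<psi> x = 1/2" using common[of y] by blast
  have H: "F \<inter> G \<in> C" using cell_face[OF F(1) cell_Int[OF F(1) G(1)]] x by blast
  have "prism \<psi> w (F \<inter> G)" using interior_prism[OF H x(1)] x(2) by simp
  then show ?thesis unfolding eq by (rule projected_face[OF F H _ cell_Int[OF F(1) G(1)]])
qed simp

theorem cubical_projected: "cubical projected"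
proof
  show "projected \<noteq> {}" using some_prism unfolding projected_def by blast
  show "convex (\<Union>projected)" unfolding Union_projected
    by (rule convex_linear_image[OF linear_quotient_map convex_support])
  show "\<exists>a B. independent B \<and> G = par a B" if "G \<in> projected" for G
    using that
  proof -
    assume "G \<in> projected"
    then obtain F where F: "F \<in> C" "prism \<psi> w F" "G = q ` F" using projectedE by metis
    obtain a B where B: "independent B" "w \<in> B" "F = par a B"
      using class_cell_form[OF cls F(1)] has_edge_iff[OF F(1)] F(2) by metis
    show ?thesis unfolding F(3) B(3) quotient_map_par[OF B(1,2)] using quotient_map_independent(2)[OF B(1,2)] by blast
  qed
  show "polyhedral_complex projected"
    unfolding polyhedral_complex_def
  proof (intro conjI ballI allI impI)
    show "finite projected" unfolding projected_def using finite_C by simp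
    fix F' assume "F' \<in> projected"
    then obtain F where F: "F \<in> C" "prism \<psi> w F" "F' = q ` F" using projectedE by metis
    show "polytope F'" unfolding F(3) by (rule polytope_linear_image[OF linear_quotient_map cell_polytope[OF F(1)]])
    show "F' \<noteq> {}" using F cell_nonempty by blast
    { fix G assume G: "G face_of F' \<and> G \<noteq> {}"
      then obtain H where "H \<in> C" "prism \<psi> w H" "G = q ` H" using face_of_projected[OF F(1,2)] F(3) by metis
      then show "G \<in> projected" unfolding projected_def by blast }
    fix G' assume "G' \<in> projected"
    then obtain G where G: "G \<in> C" "prism \<psi> w G" "G' = q ` G" using projectedE by metis
    show "F' \<inter> G' face_of F'" unfolding F(3) G(3) by (rule projected_Int[OF F(1,2) G(1,2)])
    show "F' \<inter> G' face_of G'" unfolding F(3) G(3) using projected_Int[OF G(1,2) F(1,2)] by (simp add: Int_commute)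
  qed
qed

definition mid :: "'a set" where "mid = {x\<in>\<Union>C. \<psi> x = 1/2}"

lemma inj_on_mid: "inj_on q mid"
  using middle_unique unfolding mid_def inj_on_def by simp

lemma q_mid: "q ` mid = \<Union>projected"
  unfolding Union_projected
proof
  show "q ` mid \<subseteq> q ` \<Union>C" unfolding mid_def by blast
  show "q ` \<Union>C \<subseteq> q ` mid"
  proof
    fix y assume "y \<in> q ` \<Union>C"
    then obtain x where x: "x \<in> \<Union>C" "y = q x" by blast
    obtain t where t: "x + t *\<^sub>R w \<in> \<Union>C" "\<psi> (x + t *\<^sub>R w) = 1/2" using line_value[OF x(1), of "1/2"] by auto
    then have "x + t *\<^sub>R w \<in> mid" by (simp add: mid_def)
    moreover have "y = q (x + t *\<^sub>R w)" unfolding quotient_map_add by (rule x(2))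
    ultimately show "y \<in> q ` mid" by (rule_tac image_eqI)
  qed
qed

lemma compact_mid: "compact mid"
proof -
  have "closed (\<Union>C \<inter> \<psi> -` {1/2})"
    using continuous_closed_preimage[OF continuous compact_imp_closed[OF compact_support], of "{1/2}"] by simp
  then have "compact (\<Union>C \<inter> (\<Union>C \<inter> \<psi> -` {1/2}))" using compact_support by (rule_tac compact_Int_closed)
  moreover have "\<Union>C \<inter> (\<Union>C \<inter> \<psi> -` {1/2}) = mid" unfolding mid_def by auto
  ultimately show ?thesis by simp
qed

text \<open>Functions on the support, in particular potentials of other zones, are transported to
  the projection by composing with this section.\<close>

definition lift_mid :: "'a \<Rightarrow> 'a" where "lift_mid = inv_into mid q"

lemma continuous_lift_mid: "continuous_on (\<Union>projected) lift_mid"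
proof -
  have "continuous_on mid q" using linear_quotient_map linear_conv_bounded_linear linear_continuous_on by blast
  then show ?thesis unfolding lift_mid_def q_mid[symmetric]
    by (rule continuous_on_inv[OF _ compact_mid]) (simp add: inj_on_mid)
qed

lemma lift_mid: assumes "y \<in> \<Union>projected" shows "lift_mid y \<in> mid" "q (lift_mid y) = y"
  using assms unfolding lift_mid_def q_mid[symmetric] by (simp_all add: inv_into_into f_inv_into_f)

lemma lift_mid_q: "x \<in> mid \<Longrightarrow> lift_mid (q x) = x"
  unfolding lift_mid_def using inj_on_mid by simp

lemma lift_mid_cell:
  assumes F: "F \<in> C" "prism \<psi> w F" and y: "y \<in> q ` F" shows "lift_mid y \<in> F"
proof -
  obtain x where x: "x \<in> F" "\<psi> x = 1/2" "y = q x" using y middle_in_cell[OF F] by (metis imageE)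
  then have "x \<in> mid" using F(1) unfolding mid_def by blast
  then show ?thesis using lift_mid_q x by simp
qed

text \<open>The middle section is bent and in general not convex; it is connected as a continuous
  image of the convex projection.\<close>

lemma connected_mid: "connected mid"
proof -
  interpret P: cubical projected by (rule cubical_projected)
  have "lift_mid ` \<Union>projected = mid" unfolding q_mid[symmetric] image_image using lift_mid_q by simp
  moreover have "connected (lift_mid ` \<Union>projected)"
    by (rule connected_continuous_image[OF continuous_lift_mid convex_connected[OF P.convex_support]])
  ultimately show ?thesis by simp
qed

text \<open>Nonparallel zones cross: the potential \<open>\<phi>\<close> of the second zone takes both values 0 and 1 on
  the middle section of the first one, at points extremal in a direction orthogonal to \<open>w\<close>.\<close>

lemma zones_cross:
  assumes \<phi>: "zone_potential C v \<phi>" and v: "q v \<noteq> 0"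
  obtains F where "F \<in> C" "prism \<psi> w F" "prism \<phi> v F"
proof -
  interpret v: zone_potential C v \<phi> by (rule \<phi>)
  interpret v': zone_potential C "- v" "\<lambda>x. 1 - \<phi> x" by (rule v.reflect)
  define a where "a = q v"
  have aw: "a \<bullet> w = 0" unfolding a_def quotient_map_def using direction_nonzero by (simp add: inner_diff_left)
  have "v = a + ((v \<bullet> w) / (w \<bullet> w)) *\<^sub>R w" unfolding a_def quotient_map_def by simp
  then have "a \<bullet> v = a \<bullet> a" using aw by (metis add_cancel_left_right inner_add_right inner_scaleR_right mult_zero_right)
  then have av: "a \<bullet> v > 0" using v unfolding a_def by simp
  \<comment> \<open>Adding a multiple of \<open>w\<close> does not change the inner product with
    \<open>b\<close>, so a maximum over the support can be moved to the level 1/2.\<close>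
  have ext: "\<exists>y\<in>mid. \<forall>z\<in>\<Union>C. b \<bullet> z \<le> b \<bullet> y" if b: "b \<bullet> w = 0" for b
  proof -
    have "continuous_on (\<Union>C) (\<lambda>y. b \<bullet> y)" by (intro continuous_intros)
    moreover have "\<Union>C \<noteq> {}" using nonempty cell_nonempty by blast
    ultimately obtain x where x: "x \<in> \<Union>C" "\<forall>z\<in>\<Union>C. b \<bullet> z \<le> b \<bullet> x"
      using continuous_attains_sup[OF compact_support] by metis
    obtain t where t: "x + t *\<^sub>R w \<in> \<Union>C" "\<psi> (x + t *\<^sub>R w) = 1/2" using line_value[OF x(1), of "1/2"] by auto
    have "b \<bullet> (x + t *\<^sub>R w) = b \<bullet> x" using b by (simp add: inner_add_right)
    then show ?thesis using x t unfolding mid_def by (intro bexI[of _ "x + t *\<^sub>R w"]) auto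
  qed
  obtain y1 where y1: "y1 \<in> mid" "\<forall>z\<in>\<Union>C. a \<bullet> z \<le> a \<bullet> y1" using ext aw by blast
  obtain y0 where y0: "y0 \<in> mid" "\<forall>z\<in>\<Union>C. (- a) \<bullet> z \<le> (- a) \<bullet> y0" using ext[of "- a"] aw by auto
  have "\<phi> y1 = 1" using v.maximal_face_top[OF av, of y1] y1 unfolding mid_def by blast
  moreover have "1 - \<phi> y0 = 1" using v'.maximal_face_top[of "- a" y0] av y0 unfolding mid_def by auto
  then have "\<phi> y0 = 0" by simp
  moreover have "connected (\<phi> ` mid)"
    by (rule connected_continuous_image[OF continuous_on_subset[OF v.continuous] connected_mid]) (auto simp: mid_def)
  ultimately have "{0..1} \<subseteq> \<phi> ` mid" using y0(1) y1(1) by (intro connected_contains_Icc) (metis imageI)+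
  then have "1/2 \<in> \<phi> ` mid" by (rule subsetD) simp
  then obtain y where y: "y \<in> mid" "\<phi> y = 1/2" by force
  then obtain F where F: "F \<in> C" "y \<in> F" unfolding mid_def by blast
  have "prism \<psi> w F" using interior_prism[OF F] y(1) by (simp add: mid_def)
  moreover have "prism \<phi> v F" using v.interior_prism[OF F] y(2) by simp
  ultimately show ?thesis using that F(1) by blast
qed

text \<open>At level 1/2 of a prism the inverse of the projection is affine with linear part sending
  \<open>z\<close> to \<open>z - g z *\<^sub>R w\<close>. On a prism of both zones \<phi> is affine
  with linear part \<open>k\<close>, and composing the two gives \<open>h\<close>.\<close>

lemma projected_potential:
  assumes d: "d \<in> edge_classes C" "edge_vector d v" "d \<noteq> c" and v: "q v \<noteq> 0"
    and \<phi>: "zone_potential C v \<phi>" "\<And>F. F \<in> C \<Longrightarrow> has_edge d F \<longleftrightarrow> prism \<phi> v F"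
  shows "zone_potential projected (q v) (\<phi> \<circ> lift_mid)"
    "\<And>F. F \<in> C \<Longrightarrow> prism \<psi> w F \<Longrightarrow> prism \<phi> v F \<Longrightarrow> prism (\<phi> \<circ> lift_mid) (q v) (q ` F)"
proof -
  interpret v: zone_potential C v \<phi> by (rule \<phi>(1))
  show P: "prism (\<phi> \<circ> lift_mid) (q v) (q ` F)" if F: "F \<in> C" "prism \<psi> w F" "prism \<phi> v F" for F
  proof -
    obtain g where g: "linear g" "g w = 1" "\<And>x y. x \<in> F \<Longrightarrow> y \<in> F \<Longrightarrow> \<psi> x - \<psi> y = g (x - y)"
      using F(2) unfolding prism_def by blast
    obtain k where k: "linear k" "k v = 1" "\<And>x y. x \<in> F \<Longrightarrow> y \<in> F \<Longrightarrow> \<phi> x - \<phi> y = k (x - y)"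
      using F(3) unfolding prism_def by blast
    \<comment> \<open>An edge of \<open>d\<close> is outside \<open>c\<close>, so \<psi> is constant
      along it and the coordinate \<open>g\<close> vanishes on \<open>v\<close>. This keeps the
      slope along \<open>q v\<close> equal to 1.\<close>
    have gv: "g v = 0"
    proof -
      obtain e where e: "e \<in> d" "e \<subseteq> F" using \<phi>(2)[OF F(1)] F(3) unfolding has_edge_def by blast
      have eE: "e \<in> edges C" using class_edges[OF d(1) e(1)] .
      obtain p where p: "e = closed_segment p (p + v)" using class_segment[OF d(1,2) e(1)] by blast
      have pe: "p \<in> e" "p + v \<in> e" using p by auto
      have "e \<notin> c" using class_eq[OF d(1) cls(1) e(1)] d(3) by blast
      then have np: "\<not> prism \<psi> w e" using edge_in_class_iff[OF eE] by blast
      have "\<psi> (p + v) = \<psi> p" using edge_cell[OF eE] by (cases rule: cell_cases) (use np pe in auto)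
      moreover have "\<psi> (p + v) - \<psi> p = g (p + v - p)" by (rule g(3)) (use pe e in auto)
      ultimately show ?thesis by simp
    qed
    have diff: "x - y = (q x - q y) - g (q x - q y) *\<^sub>R w" if "x \<in> F" "y \<in> F" "\<psi> x = 1/2" "\<psi> y = 1/2" for x y
    proof -
      have "g (x - y) = 0" using g(3)[OF that(1,2)] that(3,4) by simp
      define s where "s = ((x - y) \<bullet> w) / (w \<bullet> w)"
      have e: "q x - q y = x - y - s *\<^sub>R w"
        unfolding s_def quotient_map_def by (simp add: inner_diff_left diff_divide_distrib algebra_simps)
      have "g (q x - q y) = - s" unfolding e using g(1,2) \<open>g (x - y) = 0\<close> by (simp add: linear_diff linear_cmul)
      then show ?thesis using e by simp
    qed
    define h where "h z = k (z - g z *\<^sub>R w)" for z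
    have lh: "linear h" unfolding h_def
      using g(1) k(1) by (intro linearI) (simp_all add: linear_add linear_cmul linear_diff algebra_simps)
    have hv: "h (q v) = 1"
    proof -
      define s where "s = (v \<bullet> w) / (w \<bullet> w)"
      have e: "q v = v - s *\<^sub>R w" unfolding s_def quotient_map_def by simp
      have "g (q v) = - s" unfolding e using g gv by (simp add: linear_diff linear_cmul)
      then have "q v - g (q v) *\<^sub>R w = v" using e by simp
      then show ?thesis unfolding h_def using k by simp
    qed
    have L: "lift_mid y \<in> F" "\<psi> (lift_mid y) = 1/2" "q (lift_mid y) = y" if "y \<in> q ` F" for y
      using lift_mid_cell[OF F(1,2) that] lift_mid[of y] that F unfolding projected_def mid_def by blast+
    show ?thesis
      unfolding prism_def
    proof (intro conjI ballI exI[of _ h] lh hv)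
      fix y assume y: "y \<in> q ` F"
      let ?x = "lift_mid y"
      have x: "0 \<le> \<phi> ?x" "\<phi> ?x \<le> 1" "?x - \<phi> ?x *\<^sub>R v \<in> F" "?x + (1 - \<phi> ?x) *\<^sub>R v \<in> F"
        using F(3) L(1)[OF y] unfolding prism_def by blast+
      show "0 \<le> (\<phi> \<circ> lift_mid) y" "(\<phi> \<circ> lift_mid) y \<le> 1" using x by auto
      have "q (?x - \<phi> ?x *\<^sub>R v) \<in> q ` F" "q (?x + (1 - \<phi> ?x) *\<^sub>R v) \<in> q ` F" using x(3,4) by blast+
      moreover have "q (?x - \<phi> ?x *\<^sub>R v) = y - \<phi> ?x *\<^sub>R q v"
        using linear_quotient_map[of w] L(3)[OF y] by (simp add: linear_diff linear_cmul)
      moreover have "q (?x + (1 - \<phi> ?x) *\<^sub>R v) = y + (1 - \<phi> ?x) *\<^sub>R q v"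
        using linear_quotient_map[of w] L(3)[OF y] by (simp add: linear_add linear_cmul)
      ultimately show "y - (\<phi> \<circ> lift_mid) y *\<^sub>R q v \<in> q ` F" "y + (1 - (\<phi> \<circ> lift_mid) y) *\<^sub>R q v \<in> q ` F" by simp_all
      fix z assume z: "z \<in> q ` F"
      have "\<phi> (lift_mid y) - \<phi> (lift_mid z) = k (lift_mid y - lift_mid z)" using k(3) L(1) y z by blast
      also have "\<dots> = h (y - z)" unfolding h_def using diff[of "lift_mid y" "lift_mid z"] L y z by simp
      finally show "(\<phi> \<circ> lift_mid) y - (\<phi> \<circ> lift_mid) z = h (y - z)" by simp
    qed
  qed
  have pot: "potential projected (q v) (\<phi> \<circ> lift_mid)"
    unfolding potential_def
  proof (intro conjI ballI)
    have "lift_mid ` \<Union>projected \<subseteq> \<Union>C" using lift_mid(1) unfolding mid_def by blast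
    then show "continuous_on (\<Union>projected) (\<phi> \<circ> lift_mid)"
      by (intro continuous_on_compose continuous_lift_mid continuous_on_subset[OF v.continuous])
    fix G assume "G \<in> projected"
    then obtain F where F: "F \<in> C" "prism \<psi> w F" "G = q ` F" using projectedE by metis
    from F(1) show "prism (\<phi> \<circ> lift_mid) (q v) G \<or> (\<forall>x\<in>G. (\<phi> \<circ> lift_mid) x = 0) \<or> (\<forall>x\<in>G. (\<phi> \<circ> lift_mid) x = 1)"
    proof (cases rule: v.cell_cases)
      case 1 then show ?thesis using P[OF F(1,2)] F(3) by blast
    qed (use lift_mid_cell[OF F(1,2)] F(3) in auto)
  qed
  obtain F where F: "F \<in> C" "prism \<psi> w F" "prism \<phi> v F" using zones_cross[OF \<phi>(1) v] .
  have "\<exists>G\<in>projected. prism (\<phi> \<circ> lift_mid) (q v) G" using P[OF F] F(1,2) unfolding projected_def by blast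
  then show "zone_potential projected (q v) (\<phi> \<circ> lift_mid)"
    using pot cubical_projected by (simp add: zone_potential_def zone_potential_axioms_def)
qed

lemma closure_over_cell:
  assumes G: "G \<in> C" "G \<subseteq> F" and F: "F \<in> C" "prism \<psi> w F"
  obtains H where "H \<in> C" "prism \<psi> w H" "G \<subseteq> H" "H \<subseteq> F" "q ` H = q ` G"
proof -
  have hF: "has_edge c F" using has_edge_iff[OF F(1)] F(2) by blast
  obtain H where H: "H \<in> C" "H \<subseteq> F" "G \<subseteq> H" "has_edge c H" "\<And>x. x \<in> H \<Longrightarrow> \<exists>t. x + t *\<^sub>R w \<in> G"
    using prism_closure[OF cls F(1) hF cell_subset_face[OF F(1) G] cell_nonempty[OF G(1)]] by metis
  have "q ` H \<subseteq> q ` G"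
  proof
    fix y assume "y \<in> q ` H"
    then obtain x t where x: "y = q x" "x + t *\<^sub>R w \<in> G" using H(5) by blast
    have "y = q (x + t *\<^sub>R w)" unfolding quotient_map_add by (rule x(1))
    then show "y \<in> q ` G" using x(2) by (rule image_eqI)
  qed
  then show ?thesis using that[OF H(1) _ H(3,2)] H(3,4) has_edge_iff[OF H(1)] by blast
qed

lemma q_segment: "q ` closed_segment a (a + u) = closed_segment (q a) (q a + q u)"
  using closed_segment_linear_image[OF linear_quotient_map[of w], of a "a + u"] linear_add[OF linear_quotient_map[of w]] by simp

lemma projected_edge:
  assumes e: "e \<in> edges C" "e \<subseteq> F" "e = closed_segment a (a + u)" and F: "F \<in> C" "prism \<psi> w F" and u: "q u \<noteq> 0"
  shows "q ` e \<in> edges projected"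
proof -
  obtain H where H: "H \<in> C" "prism \<psi> w H" "q ` H = q ` e" using closure_over_cell[OF edge_cell[OF e(1)] e(2) F] .
  then have "q ` e \<in> projected" unfolding projected_def by (metis (mono_tags, lifting) image_eqI mem_Collect_eq)
  moreover have "q ` e = par (q a) {q u}" unfolding e(3) q_segment par_singleton[OF u] ..
  then have "aff_dim (q ` e) = 1" using aff_dim_par[of "{q u}" "q a"] u by simp
  ultimately show ?thesis by (simp add: edges_def)
qed

text \<open>A chain of links in \<open>C\<close> may leave the zone and cannot be projected link by
  link. Instead the potential of the class is transported, and \<open>prism_edges_one_class\<close>
  shows that the edges on which it varies form one class. Backward, a link lies in one projected
  cell and lifts to the prism above it.\<close>

theorem projected_classes:
  "\<exists>h. bij_betw h {d \<in> edge_classes C. \<exists>u. edge_vector d u \<and> q u \<noteq> 0} (edge_classes projected) \<and>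
     (\<forall>d\<in>{d \<in> edge_classes C. \<exists>u. edge_vector d u \<and> q u \<noteq> 0}. \<forall>u. edge_vector d u \<longrightarrow> edge_vector (h d) (q u))"
proof -
  interpret P: cubical projected by (rule cubical_projected)
  define \<rho> where "\<rho> e e' \<longleftrightarrow> e \<in> edges C \<and> e' \<in> edges projected \<and> (\<exists>F\<in>C. prism \<psi> w F \<and> e \<subseteq> F) \<and> e' = q ` e" for e e'
  have nz: "q u \<noteq> 0" if "\<rho> e e'" "e = closed_segment a (a + u)" for e e' a u
  proof
    assume "q u = 0"
    then have "e' = {q a}" using that q_segment[of a u] unfolding \<rho>_def by simp
    then have "aff_dim e' = 0" by simp
    moreover have "aff_dim e' = 1" using that(1) unfolding \<rho>_def edges_def by blast
    ultimately show False by simp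
  qed
  have fwd: "(e', f') \<in> (linked projected)\<^sup>*" if r: "\<rho> e e'" "\<rho> f f'" and l: "(e, f) \<in> (linked C)\<^sup>*" for e e' f f'
  proof -
    have eE: "e \<in> edges C" using r(1) unfolding \<rho>_def by blast
    obtain d where d: "d \<in> edge_classes C" "e \<in> d" using class_exists[OF eE] by blast
    have fd: "f \<in> d" using class_closed[OF d l] .
    obtain v where v: "edge_vector d v" using class_vector_exists[OF d(1)] by blast
    obtain a where a: "e = closed_segment a (a + v)" using class_segment[OF d(1) v d(2)] by blast
    have qv: "q v \<noteq> 0" using nz[OF r(1) a] .
    have dc: "d \<noteq> c"
    proof
      assume "d = c"
      then have "v = w \<or> v = - w" using class_vector_unique[OF cls] v by blast
      then show False using qv quotient_map_self[of w] linear_neg[OF linear_quotient_map[of w], of w] by auto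
    qed
    obtain \<phi> where \<phi>: "zone_potential C v \<phi>" "\<And>F. F \<in> C \<Longrightarrow> has_edge d F \<longleftrightarrow> prism \<phi> v F"
      using class_zone_potential[OF d(1) v] by metis
    have pp: "prism (\<phi> \<circ> lift_mid) (q v) (q ` F)" if "F \<in> C" "prism \<psi> w F" "prism \<phi> v F" for F
      by (rule projected_potential(2)[OF d(1) v dc qv \<phi>(1) _ that]) (rule \<phi>(2))
    interpret X: zone_potential projected "q v" "\<phi> \<circ> lift_mid"
      by (rule projected_potential(1)[OF d(1) v dc qv \<phi>(1)]) (rule \<phi>(2))
    have pr: "prism (\<phi> \<circ> lift_mid) (q v) h'" if h: "\<rho> h h'" "h \<in> d" for h h'
    proof -
      obtain F where F: "F \<in> C" "prism \<psi> w F" "h \<subseteq> F" using h(1) unfolding \<rho>_def by blast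
      have hE: "h \<in> edges C" "h' = q ` h" using h(1) unfolding \<rho>_def by blast+
      obtain H where H: "H \<in> C" "prism \<psi> w H" "h \<subseteq> H" "q ` H = q ` h" using closure_over_cell[OF edge_cell[OF hE(1)] F(3,1,2)] .
      have "prism \<phi> v H" using \<phi>(2)[OF H(1)] H(3) h(2) unfolding has_edge_def by blast
      then show ?thesis using pp[OF H(1,2)] H(4) hE(2) by simp
    qed
    obtain k1 where k1: "k1 \<in> edge_classes projected" "e' \<in> k1" using P.class_exists r(1) unfolding \<rho>_def by blast
    obtain k2 where k2: "k2 \<in> edge_classes projected" "f' \<in> k2" using P.class_exists r(2) unfolding \<rho>_def by blast
    have "k1 = k2" using X.prism_edges_one_class[OF k1 pr[OF r(1) d(2)] k2 pr[OF r(2) fd]] .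
    then show ?thesis using P.class_connected[OF k1] k2 by blast
  qed
  have bwd1: "(e, f) \<in> (linked C)\<^sup>*" if r: "\<rho> e e'" "\<rho> f f'" and l: "(e', f') \<in> linked projected" for e e' f f'
  proof -
    obtain G v where G: "G \<in> projected" "e' \<subseteq> G" "f' \<subseteq> G" "f' = (+) v ` e'" using l unfolding linked_def by blast
    obtain F where F: "F \<in> C" "prism \<psi> w F" "G = q ` F" using projectedE[OF G(1)] .
    \<comment> \<open>The edge \<open>h\<close> comes with some prism of its own. The prism closure
      of \<open>h\<close> has its projection inside that of \<open>F\<close> and hence lies in
      \<open>F\<close>.\<close>
    have inF: "h \<subseteq> F" if h: "\<rho> h h'" "h' \<subseteq> G" for h h'
    proof -
      obtain F1 where F1: "F1 \<in> C" "prism \<psi> w F1" "h \<subseteq> F1" using h(1) unfolding \<rho>_def by blast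
      have hE: "h \<in> edges C" "h' = q ` h" using h(1) unfolding \<rho>_def by blast+
      obtain H where H: "H \<in> C" "prism \<psi> w H" "h \<subseteq> H" "q ` H = q ` h" using closure_over_cell[OF edge_cell[OF hE(1)] F1(3,1,2)] .
      have "H \<subseteq> F" by (rule prism_subset_of_image[OF H(1,2) F(1,2)]) (use H(4) hE(2) h(2) F(3) in simp)
      then show ?thesis using H(3) by blast
    qed
    have eF: "e \<subseteq> F" "f \<subseteq> F" using inF r G by blast+
    have E: "e \<in> edges C" "f \<in> edges C" "e' = q ` e" "f' = q ` f" using r unfolding \<rho>_def by blast+
    obtain a B where B: "independent B" "w \<in> B" "F = par a B"
      using class_cell_form[OF cls F(1)] has_edge_iff[OF F(1)] F(2) by metis
    obtain b S where b: "b \<in> B" "S \<subseteq> B - {b}" "e = par (a + \<Sum>S) {b}"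
      using edge_in_par[OF E(1) _ B(1), of a] eF F(1) B(3) by metis
    obtain b' S' where b': "b' \<in> B" "S' \<subseteq> B - {b'}" "f = par (a + \<Sum>S') {b'}"
      using edge_in_par[OF E(2) _ B(1), of a] eF F(1) B(3) by metis
    have n: "b \<noteq> 0" "b' \<noteq> 0" using B(1) b(1) b'(1) dependent_zero by blast+
    have es: "e = closed_segment (a + \<Sum>S) (a + \<Sum>S + b)" "f = closed_segment (a + \<Sum>S') (a + \<Sum>S' + b')"
      unfolding b(3) b'(3) using n by (simp_all add: par_singleton)
    have qb: "q b \<noteq> 0" "q b' \<noteq> 0" using nz[OF r(1) es(1)] nz[OF r(2) es(2)] .
    have "closed_segment (q (a + \<Sum>S')) (q (a + \<Sum>S') + q b') = (+) v ` closed_segment (q (a + \<Sum>S)) (q (a + \<Sum>S) + q b)"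
      using G(4) unfolding E(3,4) es q_segment .
    also have "\<dots> = closed_segment (v + q (a + \<Sum>S)) ((v + q (a + \<Sum>S)) + q b)"
      unfolding closed_segment_translation[symmetric] by (simp add: add.assoc)
    finally have pm: "q b' = q b \<or> q b' = - q b" using segment_vector_eq by blast
    have bw: "b \<in> B - {w}" "b' \<in> B - {w}" using qb b(1) b'(1) quotient_map_self[of w] by auto
    \<comment> \<open>Opposite vectors cannot both occur among the independent edge vectors of the
      projected cell, which excludes the minus sign.\<close>
    have "- q b \<notin> q ` (B - {w})" by (rule par_flip(3)[OF quotient_map_independent(2)[OF B(1,2)]]) (use bw in blast)
    then have "q b' = q b" using pm bw(2) by (metis imageI)
    then have "b' = b" using quotient_map_independent(1)[OF B(1,2)] bw by (simp add: inj_on_eq_iff)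
    then have "f = (+) (\<Sum>S' - \<Sum>S) ` e" unfolding b(3) b'(3) par_translation by (simp add: algebra_simps)
    then have "(e, f) \<in> linked C" unfolding linked_def using E eF F(1) by blast
    then show ?thesis by blast
  qed
  \<comment> \<open>Edges of the zone with the same image are treated as lifts of a link from that
    image to itself; this starts the induction on chains.\<close>
  have self_linked: "(h, h) \<in> linked projected" if "h \<in> edges projected" for h
    unfolding linked_def using that P.edge_cell[OF that] by (auto intro!: exI[of _ 0])
  have sur: "\<exists>e. \<rho> e e'" if e': "e' \<in> edges projected" for e'
  proof -
    obtain H where H: "H \<in> C" "prism \<psi> w H" "e' = q ` H" using projectedE[OF P.edge_cell[OF e']] .
    obtain a B where B: "independent B" "w \<in> B" "H = par a B"
      using class_cell_form[OF cls H(1)] has_edge_iff[OF H(1)] H(2) by metis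
    have qi: "independent (q ` (B - {w}))" using quotient_map_independent(2)[OF B(1,2)] .
    have e2: "e' = par (q a) (q ` (B - {w}))" unfolding H(3) B(3) quotient_map_par[OF B(1,2)] ..
    have "card (q ` (B - {w})) = 1" using aff_dim_par[OF qi, of "q a"] e' e2 by (simp add: edges_def)
    then have "card (B - {w}) = 1" using card_image[OF quotient_map_independent(1)[OF B(1,2)]] by simp
    then obtain b where b: "B - {w} = {b}" by (rule card_1_singletonE)
    have bB: "b \<in> B" using b by blast
    have e: "par a {b} \<in> edges C" "par a {b} \<subseteq> par a B" using par_edge[OF _ B(1) bB, of a "{}"] H(1) B(3) by auto
    have "q ` par a {b} = e'" unfolding e2 b using par_linear_image[OF linear_quotient_map, where B = "{b}"] by simp
    then show ?thesis unfolding \<rho>_def using e e' H(1,2) B(3) by blast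
  qed
  have bwd: "(e, f) \<in> (linked C)\<^sup>*" if l: "(e', f') \<in> (linked projected)\<^sup>*" and r: "\<rho> e e'" "\<rho> f f'" for e e' f f'
    using l r(2)
  proof (induction arbitrary: f rule: rtrancl_induct)
    case base
    have "e' \<in> edges projected" using r(1) unfolding \<rho>_def by blast
    from bwd1[OF r(1) base self_linked[OF this]] show ?case .
  next
    case (step y z)
    have "y \<in> edges projected" using step(2) unfolding linked_def by blast
    then obtain y0 where y0: "\<rho> y0 y" using sur by blast
    show ?case using step.IH[OF y0] bwd1[OF y0 step.prems step(2)] by (rule rtrancl_trans)
  qed
  show ?thesis
  proof (rule class_bijection[OF cubical_axioms cubical_projected, of _ \<rho> q])
    show "{d \<in> edge_classes C. \<exists>u. edge_vector d u \<and> q u \<noteq> 0} \<subseteq> edge_classes C" by blast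
    show "e \<in> edges C \<and> e' \<in> edges projected" if "\<rho> e e'" for e e' using that unfolding \<rho>_def by blast
    show "d \<in> {d \<in> edge_classes C. \<exists>u. edge_vector d u \<and> q u \<noteq> 0}" if r: "\<rho> e e'" and d: "d \<in> edge_classes C" "e \<in> d" for d e e'
    proof -
      obtain u where u: "edge_vector d u" using class_vector_exists[OF d(1)] by blast
      obtain a where "e = closed_segment a (a + u)" using class_segment[OF d(1) u d(2)] by blast
      then show ?thesis using nz[OF r] u d(1) by blast
    qed
    show "\<exists>e. \<rho> e e'" if "e' \<in> edges projected" for e' using sur[OF that] .
    show "\<exists>e\<in>d. \<exists>e'. \<rho> e e'" if dd: "d \<in> {d \<in> edge_classes C. \<exists>u. edge_vector d u \<and> q u \<noteq> 0}" for d
    proof -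
      obtain v where d: "d \<in> edge_classes C" "edge_vector d v" "q v \<noteq> 0" using dd by blast
      obtain \<phi> where \<phi>: "zone_potential C v \<phi>" "\<And>F. F \<in> C \<Longrightarrow> has_edge d F \<longleftrightarrow> prism \<phi> v F"
        using class_zone_potential[OF d(1,2)] by metis
      \<comment> \<open>A prism of both zones contains an edge of \<open>d\<close> inside the zone
        of \<open>c\<close>, so no nonparallel class is lost.\<close>
      obtain F where F: "F \<in> C" "prism \<psi> w F" "prism \<phi> v F" using zones_cross[OF \<phi>(1) d(3)] .
      obtain e where e: "e \<in> d" "e \<subseteq> F" using \<phi>(2)[OF F(1)] F(3) unfolding has_edge_def by blast
      have eE: "e \<in> edges C" using class_edges[OF d(1) e(1)] .
      obtain a where a: "e = closed_segment a (a + v)" using class_segment[OF d(1,2) e(1)] by blast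
      have "q ` e \<in> edges projected" using projected_edge[OF eE e(2) a F(1,2) d(3)] .
      then show ?thesis unfolding \<rho>_def using e eE F by blast
    qed
    show "(e, f) \<in> (linked C)\<^sup>* \<longleftrightarrow> (e', f') \<in> (linked projected)\<^sup>*" if "\<rho> e e'" "\<rho> f f'" for e e' f f'
      using fwd[OF that] bwd[OF _ that] by blast
    show "\<exists>a'. e' = closed_segment a' (a' + q u)" if r: "\<rho> e e'" "e = closed_segment a (a + u)" for e e' a u
      using r q_segment unfolding \<rho>_def by blast
  qed
qed

end

section \<open>The Tutte polynomial of the dual matroid\<close>

definition rk :: "('i \<Rightarrow> 'a::euclidean_space) \<Rightarrow> 'i set \<Rightarrow> nat" where "rk V A = dim (V ` A)"

text \<open>The Tutte polynomial of the linear matroid of \<open>V\<close> with the two variables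
  exchanged. In this form the recursion deals with ranks of vectors only.\<close>

definition corank_sum :: "'i set \<Rightarrow> ('i \<Rightarrow> 'a::euclidean_space) \<Rightarrow> int poly poly" where
  "corank_sum E V = (\<Sum>A\<in>Pow E. (var_x - 1) ^ (card A - rk V A) * (var_y - 1) ^ (rk V E - rk V A))"

lemma rk_mono: "A \<subseteq> B \<Longrightarrow> rk V A \<le> rk V B"
  unfolding rk_def by (intro dim_subset image_mono)

lemma rk_le_card: "finite A \<Longrightarrow> rk V A \<le> card A"
  unfolding rk_def by (meson card_image_le dim_le_card' finite_imageI le_trans)

lemma card_linear_basis: "B \<in> linear_bases E V \<Longrightarrow> card B = rk V E"
  unfolding linear_bases_def rk_def
  by (metis (mono_tags, lifting) card_image dim_eq_card_independent dim_span mem_Collect_eq)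

lemma card_linear_basis_Int:
  fixes V :: "'i \<Rightarrow> 'a::euclidean_space"
  assumes "B \<in> linear_bases E V" shows "card (B \<inter> X) \<le> rk V X"
proof -
  have B: "inj_on V B" "independent (V ` B)" using assms by (auto simp: linear_bases_def)
  have "card (B \<inter> X) = card (V ` (B \<inter> X))" using B(1) by (metis Int_lower1 card_image inj_on_subset)
  also have "\<dots> \<le> dim (V ` X)"
    by (rule independent_card_le_dim[OF image_mono[OF Int_lower2] independent_mono[OF B(2) image_mono[OF Int_lower1]]])
  finally show ?thesis by (simp add: rk_def)
qed

text \<open>A basis chosen from the vectors of \<open>X\<close> is extended to one of all vectors;
  injective choices of indices pick each of its vectors once, even when several indices carry the
  same vector.\<close>

lemma linear_basis_exists:
  fixes V :: "'i \<Rightarrow> 'a::euclidean_space"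
  assumes E: "finite E" and X: "X \<subseteq> E"
  obtains B where "B \<in> linear_bases E V" "card (B \<inter> X) = rk V X"
proof -
  obtain S where S: "S \<subseteq> V ` X" "independent S" "V ` X \<subseteq> span S" "card S = dim (V ` X)"
    using basis_exists[of "V ` X"] by blast
  obtain I where I: "I \<subseteq> X" "inj_on V I" "S = V ` I" using S(1) unfolding subset_image_inj by blast
  have "S \<subseteq> V ` E" using S(1) X by blast
  then obtain T where T: "S \<subseteq> T" "T \<subseteq> V ` E" "independent T" "V ` E \<subseteq> span T"
    using maximal_independent_subset_extend[OF _ S(2)] by metis
  have "T - S \<subseteq> V ` E" using T(2) by blast
  then obtain J where J: "J \<subseteq> E" "inj_on V J" "T - S = V ` J" unfolding subset_image_inj by blast
  define B where "B = I \<union> J"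
  have VB: "V ` B = T" unfolding B_def image_Un I(3)[symmetric] J(3)[symmetric] using T(1) by blast
  have inj: "inj_on V B" unfolding B_def inj_on_Un using I J by blast
  have "span T = span (V ` E)" using T(2,4) by (metis span_mono span_span subset_antisym)
  then have B: "B \<in> linear_bases E V" unfolding linear_bases_def using I(1) J(1) X inj VB T(3) by (auto simp: B_def)
  have "finite B" using I(1) J(1) X E unfolding B_def by (metis finite_Un finite_subset)
  moreover have "I \<subseteq> B \<inter> X" using I(1) by (auto simp: B_def)
  ultimately have "card I \<le> card (B \<inter> X)" by (simp add: card_mono)
  moreover have "card I = rk V X" using I(2,3) S(4) by (simp add: card_image rk_def)
  ultimately have "card (B \<inter> X) = rk V X" using card_linear_basis_Int[OF B, of X] by linarith
  then show ?thesis using that B by blast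
qed

text \<open>Keeps the subtraction of natural numbers in \<open>dual_rank\<close> from being cut off
  at 0.\<close>

lemma rank_bounds:
  assumes "finite E" "A \<subseteq> E"
  shows "rk V E \<le> card A + rk V (E - A)"
proof -
  obtain B where B: "B \<in> linear_bases E V" "card (B \<inter> E) = rk V E" using linear_basis_exists[OF assms(1) subset_refl] .
  have BE: "B \<subseteq> E" using B(1) by (simp add: linear_bases_def)
  have fB: "finite B" using BE assms(1) finite_subset by blast
  have "B \<inter> E = (B \<inter> A) \<union> (B \<inter> (E - A))" using assms(2) by blast
  then have "rk V E \<le> card (B \<inter> A) + card (B \<inter> (E - A))" using B(2) card_Un_le by metis
  also have "\<dots> \<le> card A + rk V (E - A)"
    using card_linear_basis_Int[OF B(1), of "E - A"] assms finite_subset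
    by (intro add_mono card_mono) auto
  finally show ?thesis .
qed

text \<open>For a basis \<open>B\<close> the size of \<open>A - B\<close> is
  \<open>card A + card (B \<inter> (E - A)) - card B\<close>, so it is largest for a basis that
  contains a basis of \<open>E - A\<close>.\<close>

lemma dual_rank:
  assumes E: "finite E" and A: "A \<subseteq> E"
  shows "matroid_rank (dual_bases E V) A = card A + rk V (E - A) - rk V E"
proof -
  have fb: "finite (linear_bases E V)"
    by (rule finite_subset[of _ "Pow E"]) (use E in \<open>auto simp: linear_bases_def\<close>)
  have val: "card (A \<inter> (E - B)) = card A + card (B \<inter> (E - A)) - rk V E" if B: "B \<in> linear_bases E V" for B
  proof -
    have BE: "B \<subseteq> E" using B by (simp add: linear_bases_def)
    have fA: "finite A" and fB: "finite B" using A BE E finite_subset by blast+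
    have "A \<inter> (E - B) = A - B" using A by blast
    then have 1: "card (A \<inter> (E - B)) + card (A \<inter> B) = card A"
      using fA by (metis card_Diff_subset_Int card_mono finite_Int inf_le1 le_add_diff_inverse2)
    have "B = (A \<inter> B) \<union> (B \<inter> (E - A))" using BE by blast
    then have "card B = card (A \<inter> B) + card (B \<inter> (E - A))"
      using fB by (metis Diff_disjoint Int_commute Int_left_commute Int_empty_right card_Un_disjoint finite_Int inf_assoc)
    then show ?thesis using 1 card_linear_basis[OF B] by linarith
  qed
  show ?thesis unfolding matroid_rank_def dual_bases_def image_image
  proof (rule Max_eqI)
    show "finite ((\<lambda>B. card (A \<inter> (E - B))) ` linear_bases E V)" using fb by simp
    fix y assume "y \<in> (\<lambda>B. card (A \<inter> (E - B))) ` linear_bases E V"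
    then obtain B where B: "B \<in> linear_bases E V" "y = card (A \<inter> (E - B))" by blast
    show "y \<le> card A + rk V (E - A) - rk V E"
      unfolding B(2) val[OF B(1)] using card_linear_basis_Int[OF B(1), of "E - A"] by simp
  next
    obtain B where B: "B \<in> linear_bases E V" "card (B \<inter> (E - A)) = rk V (E - A)"
      using linear_basis_exists[OF E, of "E - A" V] by blast
    show "card A + rk V (E - A) - rk V E \<in> (\<lambda>B. card (A \<inter> (E - B))) ` linear_bases E V"
      using val[OF B(1)] B by (metis imageI)
  qed
qed

text \<open>Passing to complements turns corank in the dual into nullity in the linear matroid, and
  nullity into corank.\<close>

lemma tutte_dual_corank_sum:
  assumes E: "finite E" shows "tutte_polynomial E (dual_bases E V) = corank_sum E V"
proof -
  have rE: "matroid_rank (dual_bases E V) E = card E - rk V E"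
    using dual_rank[OF E subset_refl, of V] by (simp add: rk_def)
  have "tutte_polynomial E (dual_bases E V) =
     (\<Sum>A\<in>Pow E. (var_x - 1) ^ (card (E - A) - rk V (E - A)) * (var_y - 1) ^ (rk V E - rk V (E - A)))"
    unfolding tutte_polynomial_def
  proof (rule sum.cong[OF refl])
    fix A assume "A \<in> Pow E"
    then have A: "A \<subseteq> E" by simp
    have c: "card E = card A + card (E - A)" using A E by (metis card_Diff_subset card_mono finite_subset le_add_diff_inverse)
    have 1: "rk V E \<le> card A + rk V (E - A)" using rank_bounds[OF E A] .
    have 2: "rk V (E - A) \<le> card (E - A)" using rk_le_card E by blast
    have 3: "rk V (E - A) \<le> rk V E" by (rule rk_mono) blast
    have "card E - rk V E - (card A + rk V (E - A) - rk V E) = card (E - A) - rk V (E - A)"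
      "card A - (card A + rk V (E - A) - rk V E) = rk V E - rk V (E - A)" using c 1 2 3 by linarith+
    then show "(var_x - 1) ^ (matroid_rank (dual_bases E V) E - matroid_rank (dual_bases E V) A) *
          (var_y - 1) ^ (card A - matroid_rank (dual_bases E V) A) =
          (var_x - 1) ^ (card (E - A) - rk V (E - A)) * (var_y - 1) ^ (rk V E - rk V (E - A))"
      unfolding rE dual_rank[OF E A] by simp
  qed
  also have "\<dots> = corank_sum E V"
    unfolding corank_sum_def
    by (rule sum.reindex_bij_witness[of _ "\<lambda>A. E - A" "\<lambda>A. E - A"]) (auto simp: double_diff)
  finally show ?thesis .
qed

section \<open>Loops, contraction and coloops in the corank sum\<close>

lemma corank_sum_bij:
  assumes h: "bij_betw h E E'" and rk: "\<And>A. A \<subseteq> E \<Longrightarrow> rk V' (h ` A) = rk V A"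
  shows "corank_sum E' V' = corank_sum E V"
proof -
  have b: "bij_betw ((`) h) (Pow E) (Pow E')" using h by (rule bij_betw_Pow)
  have hE: "h ` E = E'" "inj_on h E" using h by (auto simp: bij_betw_def)
  have "corank_sum E V = (\<Sum>A\<in>Pow E. (var_x - 1) ^ (card (h ` A) - rk V' (h ` A)) * (var_y - 1) ^ (rk V' E' - rk V' (h ` A)))"
    unfolding corank_sum_def
  proof (rule sum.cong[OF refl])
    fix A assume "A \<in> Pow E"
    then have A: "A \<subseteq> E" by simp
    have "card (h ` A) = card A" using hE(2) A by (meson card_image inj_on_subset)
    then show "(var_x - 1) ^ (card A - rk V A) * (var_y - 1) ^ (rk V E - rk V A) =
      (var_x - 1) ^ (card (h ` A) - rk V' (h ` A)) * (var_y - 1) ^ (rk V' E' - rk V' (h ` A))"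
      using rk[OF A] rk[OF subset_refl] hE(1) by simp
  qed
  also have "\<dots> = corank_sum E' V'" unfolding corank_sum_def by (rule sum.reindex_bij_betw[OF b])
  finally show ?thesis by simp
qed

lemma sum_Pow_insert:
  fixes f :: "'i set \<Rightarrow> 'b::comm_monoid_add"
  assumes "finite E" "c \<in> E"
  shows "sum f (Pow E) = (\<Sum>A\<in>Pow (E - {c}). f A) + (\<Sum>A\<in>Pow (E - {c}). f (insert c A))"
proof -
  have "Pow E = Pow (E - {c}) \<union> insert c ` Pow (E - {c})"
    using assms(2) Pow_insert[of c "E - {c}"] by (simp add: insert_absorb)
  moreover have "Pow (E - {c}) \<inter> insert c ` Pow (E - {c}) = {}" by blast
  moreover have "inj_on (insert c) (Pow (E - {c}))" by (auto simp: inj_on_def)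
  ultimately show ?thesis using assms(1) by (simp add: sum.union_disjoint sum.reindex)
qed

text \<open>Adding a loop keeps the rank and raises the nullity by 1. Sets containing
  \<open>c\<close> therefore contribute x - 1 times what the others do, which makes the factor x in
  total.\<close>

lemma corank_sum_zero:
  assumes E: "finite E" and c: "c \<in> E" "V c = 0"
  shows "corank_sum E V = var_x * corank_sum (E - {c}) V"
proof -
  have r: "rk V (insert c A) = rk V A" for A using c(2) by (simp add: rk_def dim_insert span_zero)
  have rE: "rk V E = rk V (E - {c})" using r[of "E - {c}"] c(1) by (simp add: insert_absorb)
  have "(var_x - 1) ^ (card (insert c A) - rk V (insert c A)) * (var_y - 1) ^ (rk V E - rk V (insert c A)) =
     (var_x - 1) * ((var_x - 1) ^ (card A - rk V A) * (var_y - 1) ^ (rk V (E - {c}) - rk V A))" if A: "A \<in> Pow (E - {c})" for A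
  proof -
    have f: "finite A" "c \<notin> A" using A E by (auto intro: finite_subset)
    have "card (insert c A) - rk V (insert c A) = Suc (card A - rk V A)"
      using f rk_le_card[OF f(1), of V] by (simp add: r Suc_diff_le)
    then show ?thesis by (simp only: r rE power_Suc mult.assoc)
  qed
  then have "corank_sum E V = corank_sum (E - {c}) V + (var_x - 1) * corank_sum (E - {c}) V"
    unfolding corank_sum_def sum_Pow_insert[OF E c(1)] sum_distrib_left by (intro arg_cong2[where f = "(+)"] sum.cong) (simp_all add: rE)
  then show ?thesis by (simp add: algebra_simps)
qed

lemma corank_sum_zeros:
  assumes E: "finite E" and Z: "Z \<subseteq> E" "\<And>c. c \<in> Z \<Longrightarrow> V c = 0"
  shows "corank_sum E V = var_x ^ card Z * corank_sum (E - Z) V"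
proof -
  have "finite Z" using E Z(1) finite_subset by blast
  then show ?thesis using Z
  proof (induction Z)
    case (insert c Z)
    have "corank_sum (E - Z) V = var_x * corank_sum (E - Z - {c}) V"
      by (rule corank_sum_zero) (use E insert in auto)
    moreover have "E - Z - {c} = E - insert c Z" by blast
    ultimately show ?case using insert by (simp add: mult.assoc mult.left_commute)
  qed simp
qed

text \<open>A basis of the span that contains \<open>w\<close> loses exactly the vector
  \<open>w\<close> in the quotient.\<close>

lemma dim_insert_quotient:
  fixes w :: "'a::euclidean_space"
  assumes w: "w \<noteq> 0" shows "dim (insert w S) = Suc (dim (quotient_map w ` S))"
proof -
  let ?q = "quotient_map w"
  have "independent {w}" using w by simp
  then obtain T where T: "{w} \<subseteq> T" "T \<subseteq> insert w S" "independent T" "insert w S \<subseteq> span T"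
    using maximal_independent_subset_extend[of "{w}" "insert w S"] by auto
  have wT: "w \<in> T" using T(1) by blast
  have fT: "finite T" using T(3) independent_imp_finite by blast
  note qi = quotient_map_independent[OF T(3) wT]
  have "dim (insert w S) = card T" using dim_unique[OF T(2,4,3) refl] .
  moreover have "dim (?q ` S) = card (?q ` (T - {w}))"
  proof (rule dim_unique[OF _ _ qi(2) refl])
    show "?q ` (T - {w}) \<subseteq> ?q ` S" using T(2) by blast
    have "?q ` S \<subseteq> ?q ` span T" using T(4) by blast
    also have "\<dots> = span (?q ` T)" using linear_span_image[OF linear_quotient_map, of w T] by simp
    also have "?q ` T = insert 0 (?q ` (T - {w}))" using wT quotient_map_self[of w] by (metis image_insert insert_Diff)
    also have "span (insert 0 (?q ` (T - {w}))) = span (?q ` (T - {w}))" by (rule span_insert_0)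
    finally show "?q ` S \<subseteq> span (?q ` (T - {w}))" .
  qed
  moreover have "card (?q ` (T - {w})) = card T - 1" using card_image[OF qi(1)] wT fT by simp
  moreover have "card T > 0" using wT fT card_gt_0_iff by blast
  ultimately show ?thesis by simp
qed

text \<open>Contracting \<open>V c\<close> lowers the rank of every set containing \<open>c\<close>
  by exactly 1, so nullity and corank of these sets survive. For the other sets the corank survives
  because deleting \<open>c\<close> keeps the total rank.\<close>

lemma corank_sum_split:
  assumes E: "finite E" and c: "c \<in> E" "V c \<noteq> 0" and r: "rk V (E - {c}) = rk V E"
  shows "corank_sum E V = corank_sum (E - {c}) (quotient_map (V c) \<circ> V) + corank_sum (E - {c}) V"
proof -
  let ?Q = "quotient_map (V c) \<circ> V"
  have ins: "rk V (insert c A) = Suc (rk ?Q A)" for A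
    unfolding rk_def using dim_insert_quotient[OF c(2), of "V ` A"] by (simp add: image_comp)
  have rE: "rk V E = Suc (rk ?Q (E - {c}))" using ins[of "E - {c}"] c(1) by (simp add: insert_absorb)
  have "(var_x - 1) ^ (card (insert c A) - rk V (insert c A)) * (var_y - 1) ^ (rk V E - rk V (insert c A)) =
     (var_x - 1) ^ (card A - rk ?Q A) * (var_y - 1) ^ (rk ?Q (E - {c}) - rk ?Q A)" if A: "A \<in> Pow (E - {c})" for A
  proof -
    have f: "finite A" "c \<notin> A" using A E by (auto intro: finite_subset)
    show ?thesis using f by (simp add: ins rE del: comp_apply)
  qed
  then show ?thesis
    unfolding corank_sum_def sum_Pow_insert[OF E c(1)] by (subst add.commute, intro arg_cong2[where f = "(+)"] sum.cong) (simp_all add: r)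
qed

text \<open>A coloop raises the rank of every set that lacks it. Relative to the deletion, sets with
  \<open>c\<close> keep both exponents and sets without \<open>c\<close> gain one in the corank,
  which gives the factor 1 + (y - 1).\<close>

lemma corank_sum_coloop:
  assumes E: "finite E" and c: "c \<in> E" "V c \<notin> span (V ` (E - {c}))"
  shows "corank_sum E V = var_y * corank_sum (E - {c}) V"
proof -
  have ins: "rk V (insert c A) = Suc (rk V A)" if "A \<subseteq> E - {c}" for A
  proof -
    have "V c \<notin> span (V ` A)" using c(2) span_mono[of "V ` A" "V ` (E - {c})"] that by blast
    then show ?thesis by (simp add: rk_def dim_insert)
  qed
  have rE: "rk V E = Suc (rk V (E - {c}))" using ins[of "E - {c}"] c(1) by (simp add: insert_absorb)
  have 1: "(var_x - 1) ^ (card (insert c A) - rk V (insert c A)) * (var_y - 1) ^ (rk V E - rk V (insert c A)) =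
     (var_x - 1) ^ (card A - rk V A) * (var_y - 1) ^ (rk V (E - {c}) - rk V A)" if A: "A \<in> Pow (E - {c})" for A
  proof -
    have f: "finite A" "c \<notin> A" using A E by (auto intro: finite_subset)
    show ?thesis using f A by (simp add: ins rE)
  qed
  have 2: "(var_x - 1) ^ (card A - rk V A) * (var_y - 1) ^ (rk V E - rk V A) =
     (var_y - 1) * ((var_x - 1) ^ (card A - rk V A) * (var_y - 1) ^ (rk V (E - {c}) - rk V A))" if A: "A \<in> Pow (E - {c})" for A
  proof -
    have "rk V A \<le> rk V (E - {c})" by (rule rk_mono) (use A in blast)
    then have "rk V E - rk V A = Suc (rk V (E - {c}) - rk V A)" by (simp add: rE Suc_diff_le)
    then show ?thesis by (simp only: power_Suc mult.left_commute)
  qed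
  have "corank_sum E V = (var_y - 1) * corank_sum (E - {c}) V + corank_sum (E - {c}) V"
    unfolding corank_sum_def sum_Pow_insert[OF E c(1)] sum_distrib_left
    by (intro arg_cong2[where f = "(+)"] sum.cong) (simp_all only: 1 2)
  then show ?thesis by (simp add: algebra_simps)
qed

lemma corank_sum_empty: "corank_sum {} V = 1"
  by (simp add: corank_sum_def rk_def)

section \<open>Coloops\<close>

text \<open>Both signs of each class vector belong to the set, so spans can be compared without
  choosing a configuration.\<close>

definition vectors :: "'a::euclidean_space set set set \<Rightarrow> 'a set" where
  "vectors D = {u. \<exists>d\<in>D. edge_vector d u}"

context cubical
begin

lemma span_vectors:
  assumes D: "D \<subseteq> edge_classes C" and V: "\<And>d. d \<in> D \<Longrightarrow> edge_vector d (V d)"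
  shows "span (vectors D) = span (V ` D)"
proof
  show "span (V ` D) \<subseteq> span (vectors D)" by (rule span_mono) (use V in \<open>auto simp: vectors_def\<close>)
  have "vectors D \<subseteq> span (V ` D)"
  proof
    fix u assume "u \<in> vectors D"
    then obtain d where d: "d \<in> D" "edge_vector d u" by (auto simp: vectors_def)
    have "u = V d \<or> u = - V d" using class_vector_unique[OF _ V[OF d(1)] d(2)] d(1) D by blast
    then show "u \<in> span (V ` D)" using d(1) by (auto intro: span_base span_neg)
  qed
  then show "span (vectors D) \<subseteq> span (V ` D)" by (simp add: span_minimal)
qed

lemma par_edge_vector:
  assumes F: "par a B \<in> C" "independent B" and b: "b \<in> B"
  obtains d where "d \<in> edge_classes C" "edge_vector d b" "has_edge d (par a B)"
proof -
  have e: "par a {b} \<in> edges C" "par a {b} \<subseteq> par a B" using par_edge[OF F b, of "{}"] by auto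
  obtain d where d: "d \<in> edge_classes C" "par a {b} \<in> d" using class_exists[OF e(1)] by blast
  have "b \<noteq> 0" using F(2) b dependent_zero by blast
  then have "edge_vector d b" unfolding edge_vector_def using d(2) par_singleton by blast
  then show ?thesis using that[OF d(1)] d(2) e(2) unfolding has_edge_def by blast
qed

lemma cell_diff_span:
  assumes "F \<in> C" "x \<in> F" "y \<in> F"
  shows "x - y \<in> span (vectors {d \<in> edge_classes C. has_edge d F})"
proof -
  obtain a B where B: "independent B" "F = par a B" using cellE[OF assms(1)] .
  have "B \<subseteq> vectors {d \<in> edge_classes C. has_edge d F}"
  proof
    fix b assume "b \<in> B"
    then show "b \<in> vectors {d \<in> edge_classes C. has_edge d F}"
      using par_edge_vector[of a B b] B assms(1) unfolding vectors_def by blast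
  qed
  then show ?thesis using par_diff_span[of x a B y] assms(2,3) B(2) span_mono by blast
qed

text \<open>Only finitely many values occur, at most one per cell, and a continuous function with
  finitely many values on a connected set is constant.\<close>

lemma constant_of_constant_on_cells:
  fixes f :: "'a \<Rightarrow> real"
  assumes f: "continuous_on (\<Union>C) f" and const: "\<And>F x y. F \<in> C \<Longrightarrow> x \<in> F \<Longrightarrow> y \<in> F \<Longrightarrow> f x = f y"
    and xy: "x \<in> \<Union>C" "y \<in> \<Union>C"
  shows "f x = f y"
proof -
  have "f ` \<Union>C \<subseteq> (\<lambda>F. f (SOME x. x \<in> F)) ` C"
  proof
    fix r assume "r \<in> f ` \<Union>C"
    then obtain F z where F: "F \<in> C" "z \<in> F" "r = f z" by blast
    have "(SOME x. x \<in> F) \<in> F" using F(2) by (rule someI)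
    then have "r = f (SOME x. x \<in> F)" using const F by blast
    then show "r \<in> (\<lambda>F. f (SOME x. x \<in> F)) ` C" using F(1) by (rule image_eqI)
  qed
  then have "finite (f ` \<Union>C)" using finite_C finite_subset by blast
  then have "f constant_on \<Union>C"
    using continuous_finite_range_constant[OF convex_connected[OF convex_support] f] by blast
  then show ?thesis using xy unfolding constant_on_def by auto
qed

text \<open>Let \<open>u\<close> be the component of \<open>x - y\<close> orthogonal to all edge
  vectors. The inner product with \<open>u\<close> is constant on each cell, hence on the support,
  so \<open>u\<close> is orthogonal to \<open>x - y\<close> and therefore 0.\<close>

lemma diff_span_vectors:
  assumes "x \<in> \<Union>C" "y \<in> \<Union>C" shows "x - y \<in> span (vectors (edge_classes C))"
proof -
  let ?W = "vectors (edge_classes C)"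
  obtain s u where su: "s \<in> span ?W" "\<And>z. z \<in> span ?W \<Longrightarrow> orthogonal u z" "x - y = s + u"
    using orthogonal_subspace_decomp_exists[of ?W "x - y"] by metis
  have "u \<bullet> x = u \<bullet> y"
  proof (rule constant_of_constant_on_cells[OF _ _ assms])
    show "continuous_on (\<Union>C) (\<lambda>z. u \<bullet> z)" by (intro continuous_intros)
    fix F a b assume "F \<in> C" "a \<in> F" "b \<in> F"
    then have "a - b \<in> span (vectors {d \<in> edge_classes C. has_edge d F})" by (rule cell_diff_span)
    moreover have "vectors {d \<in> edge_classes C. has_edge d F} \<subseteq> ?W" unfolding vectors_def by blast
    ultimately have "a - b \<in> span ?W" using span_mono by blast
    then have "u \<bullet> (a - b) = 0" using su(2) by (simp add: orthogonal_def)
    then show "u \<bullet> a = u \<bullet> b" by (simp add: inner_diff_right)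
  qed
  then have "u \<bullet> (s + u) = 0" unfolding su(3)[symmetric] by (simp add: inner_diff_right)
  moreover have "u \<bullet> s = 0" using su(1,2) by (simp add: orthogonal_def)
  ultimately have "u = 0" by (simp add: inner_add_right)
  then show ?thesis using su by simp
qed

lemma span_support:
  assumes p: "p \<in> \<Union>C" shows "span ((+) (- p) ` \<Union>C) = span (vectors (edge_classes C))"
proof
  have "- p + x \<in> span (vectors (edge_classes C))" if "x \<in> \<Union>C" for x
    using diff_span_vectors[OF that p] by simp
  then have "(+) (- p) ` \<Union>C \<subseteq> span (vectors (edge_classes C))" by blast
  then show "span ((+) (- p) ` \<Union>C) \<subseteq> span (vectors (edge_classes C))" by (simp add: span_minimal)
  have "vectors (edge_classes C) \<subseteq> span ((+) (- p) ` \<Union>C)"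
  proof
    fix u assume "u \<in> vectors (edge_classes C)"
    then obtain d where d: "d \<in> edge_classes C" "edge_vector d u" by (auto simp: vectors_def)
    obtain e a where e: "e \<in> d" "e = closed_segment a (a + u)" using d(2) unfolding edge_vector_def by blast
    have "e \<in> C" using edge_cell[OF class_edges[OF d(1) e(1)]] .
    then have "a \<in> \<Union>C" "a + u \<in> \<Union>C" using e(2) by auto
    then have "(- p + (a + u)) - (- p + a) \<in> span ((+) (- p) ` \<Union>C)" by (intro span_diff span_base imageI)
    then show "u \<in> span ((+) (- p) ` \<Union>C)" by simp
  qed
  then show "span (vectors (edge_classes C)) \<subseteq> span ((+) (- p) ` \<Union>C)" by (simp add: span_minimal)
qed

lemma aff_dim_support: "aff_dim (\<Union>C) = int (dim (vectors (edge_classes C)))"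
proof -
  obtain p where p: "p \<in> \<Union>C" using nonempty cell_nonempty by blast
  have "aff_dim (\<Union>C) = int (dim ((+) (- p) ` \<Union>C))" by (rule aff_dim_eq_dim) (use p in \<open>rule hull_inc\<close>)
  also have "dim ((+) (- p) ` \<Union>C) = dim (vectors (edge_classes C))" by (metis span_support[OF p] dim_span)
  finally show ?thesis .
qed

lemma affine_hull_support:
  assumes p: "p \<in> \<Union>C" shows "affine hull \<Union>C = (+) p ` span (vectors (edge_classes C))"
  using affine_hull_span_gen[of p "\<Union>C"] span_support[OF p] p by (simp add: hull_inc)

text \<open>Without edges every cell is a point, and a finite connected support is a single
  point.\<close>

lemma no_classes:
  assumes "edge_classes C = {}" obtains a where "C = {{a}}"
proof -
  have sing: "\<exists>a. F = {a}" if F: "F \<in> C" for F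
  proof -
    obtain a B where B: "independent B" "F = par a B" using cellE[OF F] .
    have "B = {}"
    proof (rule ccontr)
      assume "B \<noteq> {}"
      then obtain b where "b \<in> B" by blast
      then show False using par_edge_vector[of a B b] B F assms by blast
    qed
    then show ?thesis using B(2) by (auto simp: par_def)
  qed
  then have "finite (\<Union>C)" using finite_C by (metis finite.simps finite_Union)
  then obtain a where a: "\<Union>C = {a}"
    using connected_finite_iff_sing[OF convex_connected[OF convex_support]] nonempty cell_nonempty by blast
  have "F = {a}" if "F \<in> C" for F
  proof -
    have "F \<subseteq> {a}" using a that by blast
    then show ?thesis using cell_nonempty[OF that] by blast
  qed
  then have "C = {{a}}" using nonempty by blast
  then show ?thesis by (rule that)
qed

end

lemma edge_classes_point: "edge_classes {{a}} = {}"
  by (simp add: edge_classes_def edges_def quotient_def)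

lemma aff_dim_inj_image:
  fixes f :: "'a::euclidean_space \<Rightarrow> 'a"
  assumes f: "linear f" "inj_on f (affine hull S)" shows "aff_dim (f ` S) = aff_dim S"
proof (cases "S = {}")
  case False
  then obtain p where p: "p \<in> S" by blast
  have "inj_on f (span ((+) (- p) ` S))"
  proof (rule inj_onI)
    fix x y assume xy: "x \<in> span ((+) (- p) ` S)" "y \<in> span ((+) (- p) ` S)" "f x = f y"
    have "p + x \<in> affine hull S" "p + y \<in> affine hull S"
      unfolding affine_hull_span_gen[OF hull_inc[OF p]] using xy by blast+
    moreover have "f (p + x) = f (p + y)" using xy(3) f(1) by (simp add: linear_add)
    ultimately show "x = y" using f(2) by (simp add: inj_on_eq_iff)
  qed
  then have "dim (f ` (+) (- p) ` S) = dim ((+) (- p) ` S)" by (rule dim_image_eq[OF f(1)])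
  moreover have "f ` (+) (- p) ` S = (+) (- f p) ` f ` S"
    unfolding image_image using f(1) by (simp add: linear_add linear_neg linear_diff)
  moreover have "aff_dim S = int (dim ((+) (- p) ` S))" by (rule aff_dim_eq_dim[OF hull_inc[OF p]])
  moreover have "aff_dim (f ` S) = int (dim ((+) (- f p) ` f ` S))" by (rule aff_dim_eq_dim[OF hull_inc]) (use p in blast)
  ultimately show ?thesis by simp
qed simp

context zone_class
begin

lemma vectors_shrunk: "vectors (edge_classes shrunk) = vectors (edge_classes C - {c})"
proof -
  interpret S: cubical shrunk by (rule cubical_shrunk)
  obtain h where h: "bij_betw h (edge_classes C - {c}) (edge_classes shrunk)"
     "\<And>d u. d \<in> edge_classes C - {c} \<Longrightarrow> edge_vector d u \<Longrightarrow> edge_vector (h d) u"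
    using shrunk_classes by blast
  show ?thesis
  proof (intro equalityI subsetI)
    fix u assume "u \<in> vectors (edge_classes shrunk)"
    then obtain k where k: "k \<in> edge_classes shrunk" "edge_vector k u" unfolding vectors_def by blast
    have "k \<in> h ` (edge_classes C - {c})" using k(1) h(1) by (simp add: bij_betw_def)
    then obtain d where d: "d \<in> edge_classes C - {c}" "k = h d" by blast
    obtain v where v: "edge_vector d v" using class_vector_exists d(1) by blast
    have "u = v \<or> u = - v" using S.class_vector_unique[OF k(1) _ k(2)] h(2)[OF d(1) v] d(2) by blast
    then have "edge_vector d u" using v edge_vector_minus by blast
    then show "u \<in> vectors (edge_classes C - {c})" using d(1) unfolding vectors_def by blast
  next
    fix u assume "u \<in> vectors (edge_classes C - {c})"
    then obtain d where d: "d \<in> edge_classes C - {c}" "edge_vector d u" unfolding vectors_def by blast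
    then have "h d \<in> edge_classes shrunk" using h(1) by (auto simp: bij_betw_def)
    then show "u \<in> vectors (edge_classes shrunk)" using h(2)[OF d] unfolding vectors_def by blast
  qed
qed

lemma aff_dim_projected:
  "aff_dim (\<Union>projected) + 1 = int (dim (vectors (edge_classes C)))"
proof -
  obtain p where p: "p \<in> \<Union>C" using nonempty cell_nonempty by blast
  let ?S = "(+) (- p) ` \<Union>C"
  have "aff_dim (\<Union>projected) = int (dim ((+) (- q p) ` q ` \<Union>C))"
    unfolding Union_projected by (rule aff_dim_eq_dim) (use p in \<open>intro hull_inc imageI\<close>)
  also have "(+) (- q p) ` q ` \<Union>C = q ` ?S"
    unfolding image_image using linear_quotient_map[of w] by (simp add: linear_add linear_neg linear_diff)
  finally have 1: "aff_dim (\<Union>projected) = int (dim (q ` ?S))" .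
  have "Suc (dim (q ` ?S)) = dim (insert w ?S)" using dim_insert_quotient[OF direction_nonzero, of ?S] by simp
  also have "w \<in> span ?S" unfolding span_support[OF p]
    by (rule span_base) (use cls in \<open>auto simp: vectors_def\<close>)
  then have "dim (insert w ?S) = dim ?S" by (simp add: dim_insert)
  also have "dim ?S = dim (vectors (edge_classes C))" by (metis span_support[OF p] dim_span)
  finally show ?thesis using 1 by simp
qed

text \<open>Some linear \<open>g\<close> is 1 on \<open>w\<close> and 0 on all other edge vectors.
  Then \<open>\<psi> - g\<close> is constant on cells outside the zone. In a prism both functions
  change equally when a point is shifted to the bottom, so the difference is constant on every cell
  and hence on the support.\<close>

lemma potential_linear_of_coloop:
  assumes co: "w \<notin> span (vectors (edge_classes C - {c}))"
  obtains g :: "'a \<Rightarrow> real" where "linear g" "g w = 1" "\<And>x y. x \<in> \<Union>C \<Longrightarrow> y \<in> \<Union>C \<Longrightarrow> \<psi> x - \<psi> y = g (x - y)"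
proof -
  let ?W = "vectors (edge_classes C - {c})"
  obtain B where B: "B \<subseteq> ?W" "independent B" "?W \<subseteq> span B" using maximal_independent_subset[of ?W] by metis
  have "span B = span ?W" using B(1,3) by (metis span_mono span_span subset_antisym)
  then have "independent (insert w B)" using co B(2) by (simp add: independent_insert)
  moreover have "w \<notin> B" using co B(1) span_base by blast
  ultimately obtain g where g: "linear g" "g w = 1" "\<And>b. b \<in> B \<Longrightarrow> g b = (0::real)"
    using independent_functional[of "insert w B" w] by auto
  have g0: "g z = 0" if "z \<in> span ?W" for z
  proof -
    have "z \<in> span B" using that \<open>span B = span ?W\<close> by simp
    then show ?thesis using linear_eq_0_on_span[OF g(1), of B] g(3) by blast
  qed
  have nonprism: "\<psi> x - g x = \<psi> y - g y" if F: "F \<in> C" "\<not> prism \<psi> w F" and xy: "x \<in> F" "y \<in> F" for F x y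
  proof -
    have "\<not> has_edge c F" using F has_edge_iff by blast
    then have "vectors {d \<in> edge_classes C. has_edge d F} \<subseteq> ?W" unfolding vectors_def by auto
    then have "x - y \<in> span ?W" using cell_diff_span[OF F(1) xy] span_mono by blast
    then have "g x = g y" using g0[of "x - y"] g(1) by (simp add: linear_diff)
    moreover have "\<psi> x = \<psi> y" using F(1) by (cases rule: cell_cases) (use F(2) xy in auto)
    ultimately show ?thesis by simp
  qed
  have all: "\<psi> x - g x = \<psi> y - g y" if F: "F \<in> C" and xy: "x \<in> F" "y \<in> F" for F x y
  proof (cases "prism \<psi> w F")
    case True
    define F0 where "F0 = {x\<in>F. \<psi> x = 0}"
    have F0: "F0 \<in> C" "shift ` F = F0" using prism_bottom_face[OF F True] by (auto simp: F0_def)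
    have "\<not> prism \<psi> w F0" by (rule constant_not_prism[OF F0(1), of 0]) (auto simp: F0_def)
    moreover have s: "shift x \<in> F0" "shift y \<in> F0" using xy F0(2) by blast+
    ultimately have "\<psi> (shift x) - g (shift x) = \<psi> (shift y) - g (shift y)" using nonprism[OF F0(1)] by blast
    moreover have "\<psi> (shift x) = 0" "\<psi> (shift y) = 0" using s by (auto simp: F0_def)
    moreover have "g (shift z) = g z - \<psi> z" for z using g(1,2) by (simp add: shift_def linear_diff linear_cmul)
    ultimately show ?thesis by simp
  qed (use nonprism[OF F _ xy] in blast)
  have "continuous_on (\<Union>C) (\<lambda>x. \<psi> x - g x)"
    using g(1) by (intro continuous_intros continuous linear_continuous_on) (simp add: linear_conv_bounded_linear)
  then have "\<psi> x - g x = \<psi> y - g y" if "x \<in> \<Union>C" "y \<in> \<Union>C" for x y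
    using constant_of_constant_on_cells[of "\<lambda>x. \<psi> x - g x"] all that by blast
  then have "\<psi> x - \<psi> y = g (x - y)" if "x \<in> \<Union>C" "y \<in> \<Union>C" for x y
    using that g(1) by (simp add: linear_diff) (smt (verit))
  then show ?thesis using that g(1,2) by blast
qed

text \<open>Here \<psi> has slope 1 along \<open>w\<close> on the whole support, so half a step from
  a relative interior point of a cell outside the zone leads to the level 1/2. The prism found there
  reaches back to the cell and contains it, so the image of the cell is a cell of the
  projection.\<close>

lemma projected_eq_image_of_coloop:
  assumes co: "w \<notin> span (vectors (edge_classes C - {c}))"
  shows "projected = (\<lambda>F. q ` F) ` shrunk"
proof -
  have qs: "q ` shift ` F = q ` F" for F
    unfolding image_image shift_def using quotient_map_add[of w _ "- \<psi> _"] by simp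
  obtain g where g: "linear g" "g w = 1" "\<And>x y. x \<in> \<Union>C \<Longrightarrow> y \<in> \<Union>C \<Longrightarrow> \<psi> x - \<psi> y = g (x - y)"
    using potential_linear_of_coloop[OF co] by metis
  have "q ` G \<in> projected" if G: "G \<in> C" "\<not> prism \<psi> w G" for G
  proof -
    have "rel_interior G \<noteq> {}" using cell_convex[OF G(1)] cell_nonempty[OF G(1)] rel_interior_eq_empty by blast
    then obtain x where x: "x \<in> rel_interior G" by blast
    have xG: "x \<in> G" using x rel_interior_subset by blast
    have xC: "x \<in> \<Union>C" using xG G(1) by blast
    \<comment> \<open>The half step goes forward from the level 0 and backward from the level
      1.\<close>
    define y where "y = x + (1/2 - \<psi> x) *\<^sub>R w"
    have yC: "y \<in> \<Union>C"
    proof (cases rule: nonprism_cases[OF G])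
      case 1
      then show ?thesis unfolding y_def using line_convex[OF xC, of 1 "1/2"] bottom_shift[OF xC] xG by simp
    next
      case 2
      then have px: "\<psi> x = 1" using xG by blast
      have "x - w + (1/2) *\<^sub>R w \<in> \<Union>C"
        using line_convex[OF top_shift[OF xC px], of 1 "1/2"] xC by simp
      moreover have "y = x - w + (1/2) *\<^sub>R w"
      proof -
        have "(1/2 - 1) *\<^sub>R w = (1/2) *\<^sub>R w - w" by (simp only: scaleR_left_diff_distrib scaleR_one)
        then show ?thesis unfolding y_def px by simp
      qed
      ultimately show ?thesis by simp
    qed
    have "\<psi> y - \<psi> x = g ((1/2 - \<psi> x) *\<^sub>R w)" using g(3)[OF yC xC] by (simp add: y_def)
    then have py: "\<psi> y = 1/2" using g(1,2) by (simp add: linear_cmul)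
    obtain H where H: "H \<in> C" "y \<in> H" using yC by blast
    have pH: "prism \<psi> w H" using interior_prism[OF H] py by simp
    have slid: "y + (\<psi> x - \<psi> y) *\<^sub>R w \<in> H"
      using prism_slide(1)[OF pH cell_convex[OF H(1)] H(2)] potential_range[OF xC] by blast
    have "y + (\<psi> x - 1/2) *\<^sub>R w = x" by (simp add: y_def algebra_simps)
    then have xH: "x \<in> H" using slid py by simp
    have "G \<subseteq> G \<inter> H" using subset_of_face_of[OF cell_Int[OF G(1) H(1)], of G] x xG xH by blast
    then have GH: "G \<subseteq> H" by blast
    obtain K where "K \<in> C" "prism \<psi> w K" "q ` K = q ` G" using closure_over_cell[OF G(1) GH H(1) pH] .
    then show ?thesis unfolding projected_def by (metis (mono_tags, lifting) image_eqI mem_Collect_eq)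
  qed
  then have "q ` F \<in> projected" if "F \<in> shrunk" for F using shrunkE[OF that] qs by metis
  then have "(\<lambda>F. q ` F) ` shrunk \<subseteq> projected" by blast
  moreover have "projected \<subseteq> (\<lambda>F. q ` F) ` shrunk"
  proof
    fix G assume "G \<in> projected"
    then obtain F where F: "F \<in> C" "G = q ` F" unfolding projected_def by blast
    then have "G = q ` shift ` F" "shift ` F \<in> shrunk" using qs unfolding shrunk_def by auto
    then show "G \<in> (\<lambda>F. q ` F) ` shrunk" by (rule image_eqI)
  qed
  ultimately show ?thesis by blast
qed

text \<open>An affine isomorphism preserves dimension, and the projection has one dimension less
  than the support. Shrinking must then lose a dimension too, which puts \<open>w\<close> outside
  the span of the other vectors. Conversely \<open>q\<close> itself is injective on the shrunk
  support and carries its cells to those of the projection.\<close>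

theorem same_iff_coloop:
  "same_tiled_zonotope (shrink C c w) (project C c w) \<longleftrightarrow> w \<notin> span (vectors (edge_classes C - {c}))"
  unfolding shrink_eq project_eq
proof
  interpret S: cubical shrunk by (rule cubical_shrunk)
  assume "same_tiled_zonotope shrunk projected"
  then obtain f a where f: "linear f" "inj_on f (affine hull \<Union>shrunk)" "projected = (\<lambda>F. (+) a ` f ` F) ` shrunk"
    unfolding same_tiled_zonotope_def by blast
  have "\<Union>projected = (+) a ` f ` \<Union>shrunk" unfolding f(3) by blast
  then have "aff_dim (\<Union>projected) = aff_dim (\<Union>shrunk)"
    using aff_dim_inj_image[OF f(1,2)] by (simp add: aff_dim_translation_eq)
  then have d: "Suc (dim (vectors (edge_classes C - {c}))) = dim (vectors (edge_classes C))"
    using aff_dim_projected S.aff_dim_support vectors_shrunk by simp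
  show "w \<notin> span (vectors (edge_classes C - {c}))"
  proof
    assume w: "w \<in> span (vectors (edge_classes C - {c}))"
    have "vectors (edge_classes C) \<subseteq> span (vectors (edge_classes C - {c}))"
    proof
      fix u assume "u \<in> vectors (edge_classes C)"
      then obtain d where d: "d \<in> edge_classes C" "edge_vector d u" unfolding vectors_def by blast
      show "u \<in> span (vectors (edge_classes C - {c}))"
      proof (cases "d = c")
        case True
        then have "u = w \<or> u = - w" using class_vector_unique[OF cls] d(2) by blast
        then show ?thesis using w span_neg by blast
      next
        case False
        then show ?thesis using d by (intro span_base) (auto simp: vectors_def)
      qed
    qed
    then have "dim (vectors (edge_classes C)) \<le> dim (vectors (edge_classes C - {c}))"
      by (metis dim_subset dim_span)
    then show False using d by simp
  qed
next
  interpret S: cubical shrunk by (rule cubical_shrunk)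
  assume co: "w \<notin> span (vectors (edge_classes C - {c}))"
  obtain p where p: "p \<in> \<Union>shrunk" using S.nonempty S.cell_nonempty by blast
  have i: "inj_on q (span (vectors (edge_classes C - {c})))" by (rule quotient_map_inj_span[OF co])
  have "inj_on q (affine hull \<Union>shrunk)"
    unfolding S.affine_hull_support[OF p] vectors_shrunk
  proof (rule inj_onI)
    fix x y assume x: "x \<in> (+) p ` span (vectors (edge_classes C - {c}))" and y: "y \<in> (+) p ` span (vectors (edge_classes C - {c}))"
      and eq: "q x = q y"
    obtain x' y' where x': "x = p + x'" "x' \<in> span (vectors (edge_classes C - {c}))"
      and y': "y = p + y'" "y' \<in> span (vectors (edge_classes C - {c}))" using x y by blast
    have "q x' = q y'" using eq linear_quotient_map[of w] unfolding x' y' by (simp add: linear_add)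
    then show "x = y" using i x' y' by (simp add: inj_on_eq_iff)
  qed
  moreover have "projected = (\<lambda>F. (+) 0 ` q ` F) ` shrunk" using projected_eq_image_of_coloop[OF co] by simp
  ultimately show "same_tiled_zonotope shrunk projected"
    unfolding same_tiled_zonotope_def using linear_quotient_map by blast
qed

end

section \<open>The splitting algorithm\<close>

lemma convex_zonotope: "convex (zonotope vs)"
  unfolding convex_alt
proof (intro ballI allI impI)
  fix x y and u :: real assume xy: "x \<in> zonotope vs" "y \<in> zonotope vs" and u: "0 \<le> u \<and> u \<le> 1"
  obtain a where a: "\<forall>i<length vs. 0 \<le> a i \<and> a i \<le> (1::real)" "x = (\<Sum>i<length vs. a i *\<^sub>R vs ! i)"
    using xy(1) unfolding zonotope_def by blast
  obtain b where b: "\<forall>i<length vs. 0 \<le> b i \<and> b i \<le> (1::real)" "y = (\<Sum>i<length vs. b i *\<^sub>R vs ! i)"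
    using xy(2) unfolding zonotope_def by blast
  define s where "s i = (1 - u) * a i + u * b i" for i
  have "(1 - u) *\<^sub>R x + u *\<^sub>R y = (\<Sum>i<length vs. s i *\<^sub>R vs ! i)"
    unfolding a(2) b(2) s_def by (simp add: scaleR_sum_right scaleR_add_left sum.distrib)
  moreover have "\<forall>i<length vs. 0 \<le> s i \<and> s i \<le> 1"
    unfolding s_def using a(1) b(1) u by (auto intro!: convex_bound_le add_nonneg_nonneg)
  ultimately show "(1 - u) *\<^sub>R x + u *\<^sub>R y \<in> zonotope vs" unfolding zonotope_def by blast
qed

lemma zonotope_zero: "0 \<in> zonotope vs"
  unfolding zonotope_def by (auto intro!: exI[of _ "\<lambda>_. 0"])

text \<open>Only the tiles are assumed to be parallelotopes; every cell is a face of a tile, and the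
  faces of a parallelotope are parallelotopes.\<close>

theorem cubical_zonotopal_tiling_cubical:
  assumes "cubical_zonotopal_tiling vs C" shows "cubical C"
proof
  have t: "polyhedral_complex C" "\<Union>C = zonotope vs" "\<And>T. T \<in> tiles C \<Longrightarrow> parallelotope_in (span (set vs)) T"
    using assms unfolding cubical_zonotopal_tiling_def by auto
  show "polyhedral_complex C" by (rule t(1))
  show "convex (\<Union>C)" unfolding t(2) by (rule convex_zonotope)
  show "C \<noteq> {}" using zonotope_zero[of vs] t(2) by blast
  show "\<exists>a B. independent B \<and> F = par a B" if F: "F \<in> C" for F
  proof -
    have fin: "finite C" using t(1) unfolding polyhedral_complex_def by blast
    obtain T where T: "T \<in> C" "F \<subseteq> T" "\<forall>G\<in>C. T \<subseteq> G \<longrightarrow> T = G" using finite_has_maximal2[OF fin F] by blast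
    then have "T \<in> tiles C" unfolding tiles_def by blast
    then obtain a bs where bs: "distinct bs" "independent (set bs)" "T = (+) a ` zonotope bs"
      using t(3) unfolding parallelotope_in_def by blast
    have "(F \<inter> T) face_of T" "F \<noteq> {}" using t(1) F T(1) unfolding polyhedral_complex_def by blast+
    then have "F face_of par a (set bs)" using T(2) zonotope_eq_par[OF bs(1)] bs(3) by (simp add: Int_absorb2)
    then obtain S D where SD: "D \<subseteq> set bs" "F = par (a + \<Sum>S) D"
      using par_face_form[OF bs(2)] \<open>F \<noteq> {}\<close> by metis
    then show ?thesis using independent_mono[OF bs(2)] by blast
  qed
qed

lemma quotient_map_minus: "quotient_map (- w) = quotient_map w"
  by (rule ext) (simp add: quotient_map_def)

lemma quotient_map_zero_iff: "quotient_map w u = 0 \<longleftrightarrow> (\<exists>t. u = t *\<^sub>R w)"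
proof
  assume "quotient_map w u = 0"
  then have "quotient_map w 0 = quotient_map w u" using linear_0[OF linear_quotient_map[of w]] by simp
  then obtain t where "u = 0 + t *\<^sub>R w" by (rule quotient_map_eqD)
  then show "\<exists>t. u = t *\<^sub>R w" by auto
next
  assume "\<exists>t. u = t *\<^sub>R w"
  then show "quotient_map w u = 0" using quotient_map_add[of w 0] linear_0[OF linear_quotient_map[of w]] by auto
qed

context cubical
begin

lemma zone_class_exists:
  assumes "c \<in> edge_classes C" "edge_vector c w" obtains \<psi> where "zone_class C w \<psi> c"
proof -
  obtain \<psi> where "zone_potential C w \<psi>" "\<And>F. F \<in> C \<Longrightarrow> has_edge c F \<longleftrightarrow> prism \<psi> w F"
    using class_zone_potential[OF assms] by metis
  then have "zone_class C w \<psi> c" using assms by (simp add: zone_class_def zone_class_axioms_def)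
  then show ?thesis by (rule that)
qed

end

text \<open>Copying the vectors along the bijection of classes keeps all ranks, and yields the
  configuration for the recursive call.\<close>

lemma transfer_configuration:
  assumes h: "bij_betw h E E'" and V: "\<And>d. d \<in> E \<Longrightarrow> edge_vector (h d) (V d)"
  obtains V' where "\<And>d. d \<in> E' \<Longrightarrow> edge_vector d (V' d)" "corank_sum E' V' = corank_sum E V"
proof -
  define V' where "V' k = V (inv_into E h k)" for k
  have inv: "inv_into E h (h d) = d" if "d \<in> E" for d
    using h that by (simp add: bij_betw_def)
  have 1: "edge_vector k (V' k)" if "k \<in> E'" for k
  proof -
    have "k \<in> h ` E" using h that by (simp add: bij_betw_def)
    then obtain d where "d \<in> E" "k = h d" by blast
    then show ?thesis using V inv by (simp add: V'_def)
  qed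
  have "rk V' (h ` A) = rk V A" if "A \<subseteq> E" for A
  proof -
    have "V' ` h ` A = V ` A" unfolding image_image V'_def using inv that by (intro image_cong) auto
    then show ?thesis by (simp add: rk_def)
  qed
  then have "corank_sum E' V' = corank_sum E V" by (rule corank_sum_bij[OF h])
  then show ?thesis using that 1 by blast
qed

context cubical
begin

lemma shrink_step:
  assumes c: "c \<in> edge_classes C" "edge_vector c w" and V: "\<And>d. d \<in> edge_classes C \<Longrightarrow> edge_vector d (V d)"
  obtains V' where "cubical (shrink C c w)" "card (edge_classes (shrink C c w)) < card (edge_classes C)"
    "\<And>d. d \<in> edge_classes (shrink C c w) \<Longrightarrow> edge_vector d (V' d)"
    "corank_sum (edge_classes (shrink C c w)) V' = corank_sum (edge_classes C - {c}) V"
proof -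
  obtain \<psi> where "zone_class C w \<psi> c" using zone_class_exists[OF c] .
  then interpret Z: zone_class C w \<psi> c .
  obtain h where h: "bij_betw h (edge_classes C - {c}) (edge_classes Z.shrunk)"
     "\<And>d u. d \<in> edge_classes C - {c} \<Longrightarrow> edge_vector d u \<Longrightarrow> edge_vector (h d) u"
    using Z.shrunk_classes by blast
  have hV: "edge_vector (h d) (V d)" if "d \<in> edge_classes C - {c}" for d using h(2)[OF that] V that by blast
  obtain V' where V': "\<And>d. d \<in> edge_classes Z.shrunk \<Longrightarrow> edge_vector d (V' d)"
    "corank_sum (edge_classes Z.shrunk) V' = corank_sum (edge_classes C - {c}) V"
    using transfer_configuration[of h "edge_classes C - {c}" "edge_classes Z.shrunk" V, OF h(1) hV] by metis
  have "card (edge_classes Z.shrunk) < card (edge_classes C)"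
    using bij_betw_same_card[OF h(1)] card_Diff1_less[OF finite_edge_classes c(1)] by simp
  then show ?thesis using that[of V'] V' Z.cubical_shrunk unfolding Z.shrink_eq by blast
qed

text \<open>Classes parallel to \<open>w\<close> become zero vectors in the contraction and have no
  counterpart among the projected classes; \<open>corank_sum_zeros\<close> turns them into the power
  of x.\<close>

lemma project_step:
  assumes c: "c \<in> edge_classes C" "edge_vector c w" and V: "\<And>d. d \<in> edge_classes C \<Longrightarrow> edge_vector d (V d)"
  obtains V' where "cubical (project C c w)" "card (edge_classes (project C c w)) < card (edge_classes C)"
    "\<And>d. d \<in> edge_classes (project C c w) \<Longrightarrow> edge_vector d (V' d)"
    "var_x ^ num_parallel C c w * corank_sum (edge_classes (project C c w)) V' =
       corank_sum (edge_classes C - {c}) (quotient_map (V c) \<circ> V)"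
proof -
  obtain \<psi> where "zone_class C w \<psi> c" using zone_class_exists[OF c] .
  then interpret Z: zone_class C w \<psi> c .
  let ?q = "quotient_map w"
  have w0: "w \<noteq> 0" using class_vector_nonzero[OF c] .
  have pm: "u = V d \<or> u = - V d" if "d \<in> edge_classes C" "edge_vector d u" for d u
    using class_vector_unique[OF that(1) V[OF that(1)] that(2)] .
  have qpm: "?q u = 0 \<longleftrightarrow> ?q (V d) = 0" if "d \<in> edge_classes C" "edge_vector d u" for d u
    using pm[OF that] linear_neg[OF linear_quotient_map[of w], of "V d"] by auto
  define E1 where "E1 = {d \<in> edge_classes C. ?q (V d) \<noteq> 0}"
  have E1: "{d \<in> edge_classes C. \<exists>u. edge_vector d u \<and> ?q u \<noteq> 0} = E1"
    unfolding E1_def using qpm V by blast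
  obtain h where h: "bij_betw h E1 (edge_classes Z.projected)"
     "\<And>d u. d \<in> E1 \<Longrightarrow> edge_vector d u \<Longrightarrow> edge_vector (h d) (?q u)"
    using Z.projected_classes unfolding E1 by blast
  have hV: "edge_vector (h d) ((?q \<circ> V) d)" if "d \<in> E1" for d using h(2)[OF that] V that by (simp add: E1_def)
  obtain V' where V': "\<And>d. d \<in> edge_classes Z.projected \<Longrightarrow> edge_vector d (V' d)"
    "corank_sum (edge_classes Z.projected) V' = corank_sum E1 (?q \<circ> V)"
    using transfer_configuration[of h E1 "edge_classes Z.projected" "?q \<circ> V", OF h(1) hV] by metis
  have Vc: "w = V c \<or> w = - V c" using pm[OF c] .
  then have qV: "quotient_map (V c) = ?q" using quotient_map_minus[of "V c"] by metis
  have qc: "?q (V c) = 0" using qpm[OF c] quotient_map_self[of w] by simp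
  define Y where "Y = {d \<in> edge_classes C - {c}. ?q (V d) = 0}"
  have "(\<exists>u. edge_vector d u \<and> collinear {0, w, u}) \<longleftrightarrow> ?q (V d) = 0" if d: "d \<in> edge_classes C" for d
  proof -
    have "collinear {0, w, u} \<longleftrightarrow> ?q u = 0" if "edge_vector d u" for u
    proof -
      have "u \<noteq> 0" using class_vector_nonzero[OF d that] .
      then show ?thesis unfolding collinear_lemma quotient_map_zero_iff using w0 by blast
    qed
    then show ?thesis using qpm[OF d] V[OF d] by blast
  qed
  then have "num_parallel C c w = card Y" unfolding num_parallel_def Y_def
    by (intro arg_cong[where f = card]) blast
  moreover have "edge_classes C - {c} - Y = E1" unfolding Y_def E1_def using qc by auto
  moreover have "corank_sum (edge_classes C - {c}) (?q \<circ> V) = var_x ^ card Y * corank_sum (edge_classes C - {c} - Y) (?q \<circ> V)"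
    by (rule corank_sum_zeros) (use finite_edge_classes in \<open>auto simp: Y_def\<close>)
  ultimately have cs: "var_x ^ num_parallel C c w * corank_sum (edge_classes Z.projected) V' =
       corank_sum (edge_classes C - {c}) (quotient_map (V c) \<circ> V)" using V'(2) qV by simp
  have "E1 \<subset> edge_classes C" unfolding E1_def using c(1) qc by blast
  then have "card (edge_classes Z.projected) < card (edge_classes C)"
    using bij_betw_same_card[OF h(1)] psubset_card_mono[OF finite_edge_classes] by metis
  then show ?thesis using that[of V'] V' cs Z.cubical_projected unfolding Z.project_eq by blast
qed

lemma same_iff:
  assumes c: "c \<in> edge_classes C" "edge_vector c w" and V: "\<And>d. d \<in> edge_classes C \<Longrightarrow> edge_vector d (V d)"
  shows "same_tiled_zonotope (shrink C c w) (project C c w) \<longleftrightarrow> V c \<notin> span (V ` (edge_classes C - {c}))"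
proof -
  obtain \<psi> where "zone_class C w \<psi> c" using zone_class_exists[OF c] .
  then interpret Z: zone_class C w \<psi> c .
  have "span (vectors (edge_classes C - {c})) = span (V ` (edge_classes C - {c}))"
    by (rule span_vectors) (use V in auto)
  moreover have "w = V c \<or> w = - V c" using class_vector_unique[OF c(1) V[OF c(1)] c(2)] .
  then have "w \<in> span S \<longleftrightarrow> V c \<in> span S" for S
    by (metis add.inverse_inverse span_neg)
  ultimately show ?thesis using Z.same_iff_coloop by simp
qed

end

text \<open>Induction on the number of classes, which drops in both branches. \<open>V\<close> is
  generalised because each recursive call comes with a configuration of its own. A result exists
  because some class can be chosen unless the complex is a point.\<close>

theorem splitting_corank_sum:
  fixes C :: "'a::euclidean_space set set"
  assumes "cubical C" "\<And>d. d \<in> edge_classes C \<Longrightarrow> edge_vector d (V d)"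
  shows "(\<exists>p. splitting C p) \<and> (\<forall>p. splitting C p \<longrightarrow> p = corank_sum (edge_classes C) V)"
  using assms
proof (induction "card (edge_classes C)" arbitrary: C V rule: less_induct)
  case less
  interpret cubical C by (rule less.prems(1))
  note V = less.prems(2)
  note fin = finite_edge_classes
  have coloop: "(\<exists>p. splitting (shrink C c w) p) \<and> (\<forall>p. splitting (shrink C c w) p \<longrightarrow> p = corank_sum (edge_classes C - {c}) V)"
    if c: "c \<in> edge_classes C" "edge_vector c w" for c w
  proof -
    obtain V' where V': "cubical (shrink C c w)" "card (edge_classes (shrink C c w)) < card (edge_classes C)"
      "\<And>d. d \<in> edge_classes (shrink C c w) \<Longrightarrow> edge_vector d (V' d)"
      "corank_sum (edge_classes (shrink C c w)) V' = corank_sum (edge_classes C - {c}) V"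
      using shrink_step[of c w V, OF c V] by metis
    show ?thesis using less.hyps[OF V'(2,1,3)] V'(4) by metis
  qed
  have proj: "(\<exists>p. splitting (project C c w) p) \<and> (\<forall>p. splitting (project C c w) p \<longrightarrow>
      var_x ^ num_parallel C c w * p = corank_sum (edge_classes C - {c}) (quotient_map (V c) \<circ> V))"
    if c: "c \<in> edge_classes C" "edge_vector c w" for c w
  proof -
    obtain V' where V': "cubical (project C c w)" "card (edge_classes (project C c w)) < card (edge_classes C)"
      "\<And>d. d \<in> edge_classes (project C c w) \<Longrightarrow> edge_vector d (V' d)"
      "var_x ^ num_parallel C c w * corank_sum (edge_classes (project C c w)) V' =
         corank_sum (edge_classes C - {c}) (quotient_map (V c) \<circ> V)"
      using project_step[of c w V, OF c V] by metis
    show ?thesis using less.hyps[OF V'(2,1,3)] V'(4) by metis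
  qed
  have rank: "rk V (edge_classes C - {c}) = rk V (edge_classes C)"
    if "c \<in> edge_classes C" "V c \<in> span (V ` (edge_classes C - {c}))" for c
  proof -
    have "V ` edge_classes C = insert (V c) (V ` (edge_classes C - {c}))" using that(1) by blast
    then show ?thesis unfolding rk_def using that(2) by (simp add: dim_insert)
  qed
  have nonzero: "V c \<noteq> 0" if "c \<in> edge_classes C" for c using class_vector_nonzero[OF that V[OF that]] .
  have "\<exists>p. splitting C p"
  proof (cases "edge_classes C = {}")
    case True
    then obtain a where "C = {{a}}" using no_classes by blast
    then show ?thesis using splitting.point by blast
  next
    case False
    then obtain c where c: "c \<in> edge_classes C" by blast
    note cw = c V[OF c]
    show ?thesis
      using splitting.same[OF cw] splitting.split[OF cw] coloop[OF cw] proj[OF cw] by blast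
  qed
  moreover have "p = corank_sum (edge_classes C) V" if "splitting C p" for p
    using that
  proof cases
    case (point a)
    then show ?thesis by (simp add: edge_classes_point corank_sum_empty)
  next
    case (same c w p')
    have "V c \<notin> span (V ` (edge_classes C - {c}))" using same_iff[of c w V, OF same(2,3) V] same(4) by blast
    moreover have "p' = corank_sum (edge_classes C - {c}) V" using coloop[OF same(2,3)] same(5) by blast
    ultimately show ?thesis using same(1) corank_sum_coloop[of "edge_classes C" c V, OF fin same(2)] by simp
  next
    case (split c w q p')
    have "V c \<in> span (V ` (edge_classes C - {c}))" using same_iff[of c w V, OF split(2,3) V] split(4) by blast
    then have r: "rk V (edge_classes C - {c}) = rk V (edge_classes C)" by (rule rank[OF split(2)])
    have "p' = corank_sum (edge_classes C - {c}) V" using coloop[OF split(2,3)] split(6) by blast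
    moreover have "var_x ^ num_parallel C c w * q = corank_sum (edge_classes C - {c}) (quotient_map (V c) \<circ> V)"
      using proj[OF split(2,3)] split(5) by blast
    ultimately show ?thesis using split(1) corank_sum_split[OF fin split(2) nonzero[OF split(2)] r] by simp
  qed
  ultimately show ?case by blast
qed

theorem theorem4p1p1:
  fixes vs :: "'a::euclidean_space list"
    and \<Z> :: "'a set set"
    and V :: "'a set set \<Rightarrow> 'a"
  assumes "cubical_zonotopal_tiling vs \<Z>"
    and "vector_configuration vs \<Z> V"
  shows "(\<exists>p. splitting \<Z> p) \<and>
         (\<forall>p. splitting \<Z> p \<longrightarrow>
              p = tutte_polynomial (edge_classes \<Z>) (dual_bases (edge_classes \<Z>) V))"
proof -
  interpret cubical \<Z> by (rule cubical_zonotopal_tiling_cubical[OF assms(1)])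
  have V: "edge_vector d (V d)" if "d \<in> edge_classes \<Z>" for d
    using assms(2) that unfolding vector_configuration_def by blast
  show ?thesis
    unfolding tutte_dual_corank_sum[OF finite_edge_classes]
    by (rule splitting_corank_sum[OF cubical_axioms V])
qed

end
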